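(* Let $\Omega\subset\mathbb{R}^N$ ($N\ge2$) be a bounded open set, $T>0$, $Q=(0,T)\times\Omega$, $\Gamma=(0,T)\times\partial\Omega$. Let $B\ge 1$ and, for each $n\in\mathbb{N}$, $n\ge1$, let $u_n$ be a solution of $$ \begin{cases} u_n'-\Delta u_n+B\,\dfrac{|\nabla u_n|^2}{u_n}=0 & \text{in } Q,\\ u_n(0,x)=1 & \text{in } \Omega,\\ u_n(t,x)=\frac1n & \text{on } \Gamma . \end{cases} $$ Then $u_n\to 0$ as $n\to\infty$ uniformly on compact subsets of $Q$.
   Context: Here $u'$ is the partial derivative in time and $\nabla$, $\Delta$ act in the space variable $x$. A solution of the initial-boundary value problem $$ \begin{cases} u_n'-\Delta u_n+B\,\dfrac{|\nabla u_n|^2}{u_n}=0 & \text{in } Q=(0,T)\times\Omega,\\ u_n(0,x)=1 & \text{in } \Omega,\\ u_n(t,x)=\frac1n & \text{on } \Gamma=(0,T)\times\partial\Omega \end{cases} $$ is a function $u_n$ with $u_n\ge\frac1n$ a.e. in $Q$, $u_n-\frac1n\in L^2(0,T;W^{1,2}_0(\Omega))\cap C([0,T];L^1(\Omega))$, $u_n'\in L^1(Q)+L^2(0,T;W^{-1,2}(\Omega))$, $u_n(0,\cdot)=1$, and $$\int_0^T\langle u_n',v\rangle+\int_Q\nabla u_n\cdot\nabla v+\int_Q B\,\frac{|\nabla u_n|^2}{u_n}\,v=0\qquad\text{for all } v\in L^2(0,T;W^{1,2}_0(\Omega))\cap L^\infty(Q).$$ *)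

theory Defs
  imports "HOL-Analysis.Analysis"
begin

text \<open>
  Lebesgue and Sobolev "functions" are represented by honest functions on the whole type, of which
  only the values on the domain matter.  No quotient by almost-everywhere equality is taken: all
  norms below are seminorms on representatives.
\<close>

primrec C_k :: "nat \<Rightarrow> ('a::euclidean_space \<Rightarrow> real) \<Rightarrow> bool" where
  "C_k 0 f \<longleftrightarrow> continuous_on UNIV f"
| "C_k (Suc k) f \<longleftrightarrow>
     (\<forall>x. f differentiable (at x)) \<and> (\<forall>i\<in>Basis. C_k k (\<lambda>x. frechet_derivative f (at x) i))"

definition test_functions :: "'a::euclidean_space set \<Rightarrow> ('a \<Rightarrow> real) set" where
  "test_functions \<Omega> =
     {\<phi>. (\<forall>k. C_k k \<phi>) \<and> compact (closure {x. \<phi> x \<noteq> 0}) \<and> closure {x. \<phi> x \<noteq> 0} \<subseteq> \<Omega>}"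

definition L2_space :: "'a::euclidean_space set \<Rightarrow> ('a \<Rightarrow> 'b::euclidean_space) set" where
  "L2_space \<Omega> = {v. v \<in> borel_measurable (lebesgue_on \<Omega>) \<and>
                   integrable (lebesgue_on \<Omega>) (\<lambda>x. (norm (v x))\<^sup>2)}"

definition L1_norm :: "'a::euclidean_space set \<Rightarrow> ('a \<Rightarrow> real) \<Rightarrow> real" where
  "L1_norm \<Omega> v = (LINT x|lebesgue_on \<Omega>. \<bar>v x\<bar>)"

definition is_weak_gradient ::
    "'a::euclidean_space set \<Rightarrow> ('a \<Rightarrow> real) \<Rightarrow> ('a \<Rightarrow> 'a) \<Rightarrow> bool" where
  "is_weak_gradient \<Omega> v g \<longleftrightarrow> g \<in> L2_space \<Omega> \<and>
     (\<forall>\<phi>\<in>test_functions \<Omega>. \<forall>i\<in>Basis.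
        (LINT x|lebesgue_on \<Omega>. v x * frechet_derivative \<phi> (at x) i)
          = - (LINT x|lebesgue_on \<Omega>. (g x \<bullet> i) * \<phi> x))"

definition W12 :: "'a::euclidean_space set \<Rightarrow> ('a \<Rightarrow> real) set" where
  "W12 \<Omega> = {v. v \<in> L2_space \<Omega> \<and> (\<exists>g. is_weak_gradient \<Omega> v g)}"

definition W12_norm :: "'a::euclidean_space set \<Rightarrow> ('a \<Rightarrow> real) \<Rightarrow> real" where
  "W12_norm \<Omega> v =
     (let g = (SOME g. is_weak_gradient \<Omega> v g)
      in sqrt ((LINT x|lebesgue_on \<Omega>. (v x)\<^sup>2) + (LINT x|lebesgue_on \<Omega>. (norm (g x))\<^sup>2)))"

definition W12_0 :: "'a::euclidean_space set \<Rightarrow> ('a \<Rightarrow> real) set" where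
  "W12_0 \<Omega> = {v. v \<in> W12 \<Omega> \<and>
     (\<exists>\<phi>. (\<forall>k. \<phi> k \<in> test_functions \<Omega>) \<and>
          (\<lambda>k::nat. W12_norm \<Omega> (\<lambda>x. \<phi> k x - v x)) \<longlonglongrightarrow> 0)}"

text \<open>The dual of \<open>W12_0\<close>; the values of a functional outside \<open>W12_0\<close> are irrelevant.  Boundedness
  with respect to the seminorm forces a functional to agree on functions that are equal almost
  everywhere.\<close>

definition W12_dual :: "'a::euclidean_space set \<Rightarrow> (('a \<Rightarrow> real) \<Rightarrow> real) set" where
  "W12_dual \<Omega> = {F.
     (\<forall>v\<in>W12_0 \<Omega>. \<forall>w\<in>W12_0 \<Omega>. \<forall>a b. F (\<lambda>x. a * v x + b * w x) = a * F v + b * F w) \<and>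
     (\<exists>C. \<forall>v\<in>W12_0 \<Omega>. \<bar>F v\<bar> \<le> C * W12_norm \<Omega> v)}"

definition W12_dual_norm :: "'a::euclidean_space set \<Rightarrow> (('a \<Rightarrow> real) \<Rightarrow> real) \<Rightarrow> real" where
  "W12_dual_norm \<Omega> F = Sup {\<bar>F v\<bar> |v. v \<in> W12_0 \<Omega> \<and> W12_norm \<Omega> v \<le> 1}"

text \<open>The Bochner space $L^2(0,T;X)$ for a space \<open>X\<close> of real functions (or functionals) with
  seminorm \<open>nrm\<close>: strong measurability is almost-everywhere approximability by simple
  functions with values in \<open>X\<close>.  The library's Bochner integral needs a Banach space given as a
  type, whereas here \<open>X\<close> depends on the domain.\<close>

definition simple_on :: "real \<Rightarrow> ('b \<Rightarrow> real) set \<Rightarrow> (real \<Rightarrow> 'b \<Rightarrow> real) \<Rightarrow> bool" where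
  "simple_on T X s \<longleftrightarrow> finite (s ` {0<..<T}) \<and> s ` {0<..<T} \<subseteq> X \<and>
     (\<forall>c. {t\<in>{0<..<T}. s t = c} \<in> sets lebesgue)"

definition L2_time ::
    "real \<Rightarrow> ('b \<Rightarrow> real) set \<Rightarrow> (('b \<Rightarrow> real) \<Rightarrow> real) \<Rightarrow> (real \<Rightarrow> 'b \<Rightarrow> real) set" where
  "L2_time T X nrm = {v.
     (AE t in lebesgue_on {0<..<T}. v t \<in> X) \<and>
     (\<exists>s. (\<forall>k. simple_on T X (s k)) \<and>
          (AE t in lebesgue_on {0<..<T}. (\<lambda>k::nat. nrm (\<lambda>x. s k t x - v t x)) \<longlonglongrightarrow> 0)) \<and>
     integrable (lebesgue_on {0<..<T}) (\<lambda>t. (nrm (v t))\<^sup>2)}"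

definition C_time_L1 :: "real \<Rightarrow> 'a::euclidean_space set \<Rightarrow> (real \<Rightarrow> 'a \<Rightarrow> real) set" where
  "C_time_L1 T \<Omega> = {v.
     (\<forall>t\<in>{0..T}. integrable (lebesgue_on \<Omega>) (v t)) \<and>
     (\<forall>t\<in>{0..T}. ((\<lambda>s. L1_norm \<Omega> (\<lambda>x. v s x - v t x)) \<longlongrightarrow> 0) (at t within {0..T}))}"

definition cyl :: "real \<Rightarrow> 'a::euclidean_space set \<Rightarrow> (real \<times> 'a) set" where
  "cyl T \<Omega> = {0<..<T} \<times> \<Omega>"

text \<open>The gradient in the space variable, for almost every time.  Joint measurability has to be
  demanded: a weak gradient chosen separately for each time need not have it.\<close>

definition is_space_gradient ::
    "real \<Rightarrow> 'a::euclidean_space set \<Rightarrow> (real \<Rightarrow> 'a \<Rightarrow> real) \<Rightarrow> (real \<Rightarrow> 'a \<Rightarrow> 'a) \<Rightarrow> bool" where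
  "is_space_gradient T \<Omega> v g \<longleftrightarrow>
     (\<lambda>(t,x). g t x) \<in> borel_measurable (lebesgue_on (cyl T \<Omega>)) \<and>
     (AE t in lebesgue_on {0<..<T}. is_weak_gradient \<Omega> (v t) (g t))"

definition Linfty_cyl :: "real \<Rightarrow> 'a::euclidean_space set \<Rightarrow> (real \<Rightarrow> 'a \<Rightarrow> real) set" where
  "Linfty_cyl T \<Omega> = {v. (\<lambda>(t,x). v t x) \<in> borel_measurable (lebesgue_on (cyl T \<Omega>)) \<and>
     (\<exists>C. AE (t,x) in lebesgue_on (cyl T \<Omega>). \<bar>v t x\<bar> \<le> C)}"

text \<open>An element of $L^1(Q) + L^2(0,T;W^{-1,2}(\Omega))$ is given by a pair \<open>(f, F)\<close>, and
  \<open>pairing\<close> is its action $\int_0^T \langle f + F, v\rangle$.  The action on test functions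
  determines the action on all of $L^2(0,T;W^{1,2}_0(\Omega)) \cap L^\infty(Q)$, so that it does not
  matter which decomposition of the time derivative is used.\<close>

definition pairing ::
    "real \<Rightarrow> 'a::euclidean_space set \<Rightarrow> (real \<Rightarrow> 'a \<Rightarrow> real) \<Rightarrow> (real \<Rightarrow> ('a \<Rightarrow> real) \<Rightarrow> real)
      \<Rightarrow> (real \<Rightarrow> 'a \<Rightarrow> real) \<Rightarrow> real" where
  "pairing T \<Omega> f F v =
     integral\<^sup>L (lebesgue_on (cyl T \<Omega>)) (\<lambda>(t,x). f t x * v t x)
     + (LINT t|lebesgue_on {0<..<T}. F t (v t))"

definition is_time_derivative ::
    "real \<Rightarrow> 'a::euclidean_space set \<Rightarrow> (real \<Rightarrow> 'a \<Rightarrow> real)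
      \<Rightarrow> (real \<Rightarrow> 'a \<Rightarrow> real) \<Rightarrow> (real \<Rightarrow> ('a \<Rightarrow> real) \<Rightarrow> real) \<Rightarrow> bool" where
  "is_time_derivative T \<Omega> u f F \<longleftrightarrow>
     integrable (lebesgue_on (cyl T \<Omega>)) (\<lambda>(t,x). f t x) \<and>
     F \<in> L2_time T (W12_dual \<Omega>) (W12_dual_norm \<Omega>) \<and>
     (\<forall>\<phi>\<in>test_functions (cyl T \<Omega>).
        - integral\<^sup>L (lebesgue_on (cyl T \<Omega>))
             (\<lambda>(t,x). u t x * frechet_derivative \<phi> (at (t,x)) (1,0))
          = pairing T \<Omega> f F (\<lambda>t x. \<phi> (t,x)))"

text \<open>\<open>u\<close> is the representative that is continuous in time with values in $L^1(\Omega)$.  The data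
  are the initial value 1 and the boundary value \<open>c\<close>.\<close>

definition is_solution ::
    "real \<Rightarrow> 'a::euclidean_space set \<Rightarrow> real \<Rightarrow> real \<Rightarrow> (real \<Rightarrow> 'a \<Rightarrow> real) \<Rightarrow> bool" where
  "is_solution T \<Omega> B c u \<longleftrightarrow>
     (\<lambda>(t,x). u t x) \<in> borel_measurable (lebesgue_on (cyl T \<Omega>)) \<and>
     (AE (t,x) in lebesgue_on (cyl T \<Omega>). u t x \<ge> c) \<and>
     (\<lambda>t x. u t x - c) \<in> L2_time T (W12_0 \<Omega>) (W12_norm \<Omega>) \<inter> C_time_L1 T \<Omega> \<and>
     (AE x in lebesgue_on \<Omega>. u 0 x = 1) \<and>
     (\<exists>Du f F. is_space_gradient T \<Omega> u Du \<and> is_time_derivative T \<Omega> u f F \<and>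
        (\<forall>v Dv. v \<in> L2_time T (W12_0 \<Omega>) (W12_norm \<Omega>) \<inter> Linfty_cyl T \<Omega> \<longrightarrow>
           is_space_gradient T \<Omega> v Dv \<longrightarrow>
           pairing T \<Omega> f F v
             + integral\<^sup>L (lebesgue_on (cyl T \<Omega>)) (\<lambda>(t,x). Du t x \<bullet> Dv t x)
             + integral\<^sup>L (lebesgue_on (cyl T \<Omega>))
                 (\<lambda>(t,x). B * ((norm (Du t x))\<^sup>2 / u t x) * v t x)
           = 0))"

end

theory Submission
  imports Defs
begin

text \<open>
  Where a solution \<open>u\<close> with boundary value \<open>c = 1/n\<close> is smooth, \<open>p = - ln u\<close> satisfies
  \<open>p' - \<Delta>p = (B - 1) |\<nabla>p|\<^sup>2 \<ge> 0\<close>. So \<open>p\<close> is a supersolution of the heat equation which is \<open>0\<close> at time \<open>0\<close> and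
  \<open>ln n\<close> on the lateral boundary, and it lies above \<open>ln n * h\<close> for every solution \<open>h\<close> of the heat equation
  that is nonpositive at time \<open>0\<close> and at most \<open>1\<close> on the cylinder. Since \<open>exp (\<mu> x \<bullet> e + \<mu>\<^sup>2 t)\<close> solves the heat
  equation, \<open>h = (exp (\<mu> x \<bullet> e + \<mu>\<^sup>2 t) - A) / M\<close> is such a function as soon as \<open>A\<close> bounds the exponential at
  small times and \<open>M\<close> bounds it at all times. Given \<open>\<tau> > 0\<close>, a large \<open>\<mu>\<close> makes \<open>h \<ge> \<delta> > 0\<close> for all \<open>t \<ge> \<tau>\<close>.
  Hence \<open>u\<^sub>n \<le> n powr - \<delta>\<close> almost everywhere on \<open>[\<tau>, T) \<times> \<Omega>\<close> (\<open>solution_decay\<close>), and every compact subset of the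
  open cylinder lies in such a set.
  
  Put \<open>E = exp (ln n * h)\<close> and \<open>r = u E\<close>; the claim is \<open>r \<le> 1\<close>. The equation is tested with
  \<open>v = pen1 r * E\<close>, where \<open>pen1 = pen'\<close> is bounded, nondecreasing and zero on \<open>r \<le> 1\<close>; on the boundary \<open>r = c E \<le> 1\<close>,
  so \<open>v\<close> is admissible. With \<open>a = \<nabla>u / u\<close> and \<open>b = \<nabla>E / E\<close>, an integration by parts of the heat flux of
  \<open>ln E\<close> turns all terms besides the time derivative of the integral of \<open>pen r\<close> into
  \<open>r (r pen'' |a + b|\<^sup>2 + pen' (|a + b|\<^sup>2 + (B - 1) |a|\<^sup>2)) \<ge> 0\<close> (\<open>dissipation_nonneg\<close>).
  The additional weight \<open>T - t\<close> removes the contribution of the final time and leaves the integral of \<open>pen r\<close>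
  over the cylinder, which is therefore \<open>0\<close> (\<open>comparison\<close>).
  
  Only tensor products \<open>\<theta>(t) \<eta>(x)\<close> of test functions are inserted into the weak equation.
  They determine, for each \<open>\<eta>\<close>, the increments of the integral of \<open>u(t) \<eta>\<close> in time (\<open>moment_increment\<close>). For fixed
  times \<open>t - h < t\<close> the resulting identity extends by density to \<open>\<eta> = v(t)\<close> (\<open>chain_rule_approximation\<close>,
  \<open>weak_identity_extends\<close>). It is then integrated over \<open>t\<close> and divided by \<open>h\<close>: convexity of \<open>pen\<close> bounds the difference
  quotient \<open>(u(t) - u(t - h)) v(t)\<close> from below, and continuity of translations (\<open>translation_pairing_L2\<close>) identifies
  the limit of the averaged space terms. Thus the chain rule is needed in space only, never for the time derivative.
\<close>

section \<open>Smooth functions\<close>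

definition smooth :: "('a::euclidean_space \<Rightarrow> real) \<Rightarrow> bool" where
  "smooth f \<longleftrightarrow> (\<forall>k. C_k k f)"

definition grad :: "('a::euclidean_space \<Rightarrow> real) \<Rightarrow> 'a \<Rightarrow> 'a" where
  "grad f x = (\<Sum>i\<in>Basis. frechet_derivative f (at x) i *\<^sub>R i)"

lemma grad_inner: "i \<in> Basis \<Longrightarrow> grad f x \<bullet> i = frechet_derivative f (at x) i"
  by (simp add: grad_def inner_sum_left inner_Basis if_distrib cong: if_cong)

lemma C_k_SucI:
  assumes "\<And>x. (f has_derivative f' x) (at x)" "\<And>i. i \<in> Basis \<Longrightarrow> C_k k (\<lambda>x. f' x i)"
  shows "C_k (Suc k) f"
proof -
  have "frechet_derivative f (at x) = f' x" for x
    using assms(1) by (metis frechet_derivative_at)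
  then show ?thesis
    using assms by (auto simp: differentiable_def)
qed

lemma C_k_Suc_has_derivative:
  "C_k (Suc k) f \<Longrightarrow> (f has_derivative frechet_derivative f (at x)) (at x)"
  by (auto simp: frechet_derivative_works[symmetric])

lemma linear_Basis:
  fixes F :: "'a::euclidean_space \<Rightarrow> real"
  assumes "linear F"
  shows "F v = (\<Sum>j\<in>Basis. (v \<bullet> j) * F j)"
proof -
  have "F v = F (\<Sum>j\<in>Basis. (v \<bullet> j) *\<^sub>R j)"
    by (simp only: euclidean_representation)
  also have "\<dots> = (\<Sum>j\<in>Basis. (v \<bullet> j) * F j)"
    by (simp only: linear_sum[OF assms] linear_scale[OF assms] real_scaleR_def)
  finally show ?thesis .
qed

lemma C_k_le: "C_k (Suc k) f \<Longrightarrow> C_k k f"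
proof (induction k arbitrary: f)
  case 0
  then show ?case
    by (auto intro!: continuous_at_imp_continuous_on differentiable_imp_continuous_within)
next
  case (Suc k)
  from Suc.prems have "\<forall>x. f differentiable (at x)"
    "\<forall>i\<in>Basis. C_k (Suc k) (\<lambda>x. frechet_derivative f (at x) i)"
    by (metis C_k.simps(2))+
  with Suc.IH show ?case
    unfolding C_k.simps(2)[of k f] by blast
qed

lemma C_k_const: "C_k k (\<lambda>x. c)"
proof (induction k arbitrary: c)
  case (Suc k)
  show ?case
    by (rule C_k_SucI[OF has_derivative_const]) (rule Suc)
qed simp

lemma C_k_add: "C_k k f \<Longrightarrow> C_k k g \<Longrightarrow> C_k k (\<lambda>x. f x + g x)"
proof (induction k arbitrary: f g)
  case (Suc k)
  show ?case
    by (rule C_k_SucI[OF has_derivative_add[OF C_k_Suc_has_derivative[OF Suc.prems(1)]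
            C_k_Suc_has_derivative[OF Suc.prems(2)]]])
      (use Suc in auto)
qed (auto intro: continuous_intros)

lemma C_k_mult: "C_k k f \<Longrightarrow> C_k k g \<Longrightarrow> C_k k (\<lambda>x. f x * g x)"
proof (induction k arbitrary: f g)
  case (Suc k)
  have "C_k k f" "C_k k g"
    using Suc.prems C_k_le by blast+
  then show ?case
    by (intro C_k_SucI[OF has_derivative_mult[OF C_k_Suc_has_derivative[OF Suc.prems(1)]
            C_k_Suc_has_derivative[OF Suc.prems(2)]]] C_k_add Suc.IH)
      (use Suc.prems in auto)
qed (auto intro: continuous_intros)

text \<open>
  The derivative of \<open>g \<circ> f\<close> contains \<open>g' \<circ> f\<close>. Smoothness of \<open>g\<close> to all orders is inherited by \<open>g'\<close>,
  which keeps the induction hypothesis applicable.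
\<close>

lemma C_k_compose:
  fixes g :: "real \<Rightarrow> real"
  assumes "smooth g" "C_k k f"
  shows "C_k k (\<lambda>x. g (f x))"
  using assms
proof (induction k arbitrary: f g)
  case 0
  then show ?case
    unfolding smooth_def by (metis C_k.simps(1) continuous_on_compose2 subset_UNIV)
next
  case (Suc k)
  define g' where "g' y = frechet_derivative g (at y) 1" for y
  have "C_k (Suc j) g" for j
    using Suc.prems(1) by (simp add: smooth_def del: C_k.simps)
  then have g': "smooth g'"
    unfolding smooth_def g'_def[abs_def] C_k.simps(2) by (metis Basis_real_def singletonI)
  have g_der: "(g has_derivative frechet_derivative g (at y)) (at y)" for y
    using \<open>\<And>j. C_k (Suc j) g\<close> C_k_Suc_has_derivative by blast
  have "frechet_derivative g (at y) h = h * g' y" for y h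
    using linear_scale[OF has_derivative_linear[OF g_der[of y]], of h 1] by (simp add: g'_def)
  then have "frechet_derivative g (at y) = (\<lambda>h. h * g' y)" for y
    by auto
  with g_der have "(g has_derivative (\<lambda>h. h * g' y)) (at y)" for y
    by metis
  from has_derivative_compose[OF C_k_Suc_has_derivative[OF Suc.prems(2)] this]
  show ?case
  proof (rule C_k_SucI)
    fix i :: 'a assume "i \<in> Basis"
    then have "C_k k (\<lambda>x. frechet_derivative f (at x) i)"
      using Suc.prems(2) unfolding C_k.simps(2) by blast
    then show "C_k k (\<lambda>x. frechet_derivative f (at x) i * g' (f x))"
      by (rule C_k_mult) (rule Suc.IH[OF g' C_k_le[OF Suc.prems(2)]])
  qed
qed

lemma C_k_linear: "bounded_linear f \<Longrightarrow> C_k k f"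
proof (cases k)
  case 0
  assume "bounded_linear f"
  with 0 show ?thesis
    by (auto intro: linear_continuous_on)
next
  case (Suc j)
  assume f: "bounded_linear f"
  show ?thesis
    unfolding Suc
    by (rule C_k_SucI[OF bounded_linear_imp_has_derivative[OF f]]) (rule C_k_const)
qed

lemma C_k_comp_linear:
  fixes L :: "'b::euclidean_space \<Rightarrow> 'a::euclidean_space"
  assumes L: "bounded_linear L"
  shows "C_k k f \<Longrightarrow> C_k k (\<lambda>x. f (L x))"
proof (induction k arbitrary: f)
  case 0
  then show ?case
    using linear_continuous_on[OF L] by (auto intro: continuous_on_compose2)
next
  case (Suc k)
  have d: "((\<lambda>x. f (L x)) has_derivative (\<lambda>h. frechet_derivative f (at (L x)) (L h))) (at x)" for x
    using has_derivative_compose[OF bounded_linear_imp_has_derivative[OF L] C_k_Suc_has_derivative[OF Suc.prems]] .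
  have eq: "frechet_derivative f (at y) v = (\<Sum>j\<in>Basis. (v \<bullet> j) * frechet_derivative f (at y) j)" for y v
    using has_derivative_linear[OF C_k_Suc_has_derivative[OF Suc.prems, of y]] by (rule linear_Basis)
  have sum: "finite S \<Longrightarrow> (\<And>j. j \<in> S \<Longrightarrow> C_k k (h j)) \<Longrightarrow> C_k k (\<lambda>x. \<Sum>j\<in>S. h j x)"
    for S :: "'a set" and h :: "'a \<Rightarrow> 'b \<Rightarrow> real"
    by (induction S rule: finite_induct) (auto intro: C_k_const C_k_add)
  show ?case
  proof (rule C_k_SucI[OF d])
    fix i :: 'b assume "i \<in> Basis"
    show "C_k k (\<lambda>x. frechet_derivative f (at (L x)) (L i))"
      unfolding eq[of _ "L i"]
      by (rule sum) (use Suc in \<open>auto intro!: C_k_mult C_k_const\<close>)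
  qed
qed

lemma smooth_const: "smooth (\<lambda>x. c)"
  by (simp add: smooth_def C_k_const)

lemma smooth_add: "smooth f \<Longrightarrow> smooth g \<Longrightarrow> smooth (\<lambda>x. f x + g x)"
  by (simp add: smooth_def C_k_add)

lemma smooth_mult: "smooth f \<Longrightarrow> smooth g \<Longrightarrow> smooth (\<lambda>x. f x * g x)"
  by (simp add: smooth_def C_k_mult)

lemma smooth_diff: "smooth f \<Longrightarrow> smooth g \<Longrightarrow> smooth (\<lambda>x. f x - g x)"
  using smooth_add[of f "\<lambda>x. (-1) * g x"] smooth_mult[OF smooth_const, of g "-1"] by simp

lemma smooth_compose: "smooth g \<Longrightarrow> smooth f \<Longrightarrow> smooth (\<lambda>x. g (f x))" for g :: "real \<Rightarrow> real"
  using C_k_compose[of g] unfolding smooth_def[of f] smooth_def[of "\<lambda>x. g (f x)"] by blast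

lemma smooth_linear: "bounded_linear f \<Longrightarrow> smooth f"
  by (simp add: smooth_def C_k_linear)

lemma smooth_comp_linear: "bounded_linear L \<Longrightarrow> smooth f \<Longrightarrow> smooth (\<lambda>x. f (L x))"
  for L :: "'b::euclidean_space \<Rightarrow> 'a::euclidean_space"
  by (simp add: smooth_def C_k_comp_linear)

lemma smooth_prod: "(\<And>i. i \<in> S \<Longrightarrow> smooth (f i)) \<Longrightarrow> smooth (\<lambda>x. \<Prod>i\<in>S. f i x)"
  by (induction S rule: infinite_finite_induct) (auto intro: smooth_const smooth_mult)

lemma smooth_has_derivative: "smooth f \<Longrightarrow> (f has_derivative frechet_derivative f (at x)) (at x)"
  using C_k_Suc_has_derivative unfolding smooth_def by blast

lemma smooth_partial: "smooth f \<Longrightarrow> i \<in> Basis \<Longrightarrow> smooth (\<lambda>x. frechet_derivative f (at x) i)"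
  unfolding smooth_def by (metis C_k.simps(2))

lemma smooth_continuous: "smooth f \<Longrightarrow> continuous_on UNIV f"
  unfolding smooth_def by (metis C_k.simps(1))

lemma smooth_has_gradient: "smooth f \<Longrightarrow> (f has_derivative (\<lambda>h. grad f x \<bullet> h)) (at x)"
proof -
  assume f: "smooth f"
  have "frechet_derivative f (at x) h = grad f x \<bullet> h" for h
    using linear_Basis[OF has_derivative_linear[OF smooth_has_derivative[OF f, of x]], of h]
    by (simp add: grad_def inner_sum_left inner_commute[of h] mult.commute)
  then have "frechet_derivative f (at x) = (\<lambda>h. grad f x \<bullet> h)"
    by auto
  with smooth_has_derivative[OF f] show ?thesis
    by metis
qed

lemma gradI:
  assumes "(f has_derivative (\<lambda>h. g \<bullet> h)) (at x)"
  shows "grad f x = g"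
proof -
  have "frechet_derivative f (at x) = (\<lambda>h. g \<bullet> h)"
    using assms by (metis frechet_derivative_at)
  then show ?thesis
    by (simp add: grad_def euclidean_representation)
qed

lemma continuous_grad: "smooth f \<Longrightarrow> continuous_on UNIV (grad f)"
  unfolding grad_def[abs_def] by (intro continuous_intros smooth_continuous smooth_partial) auto

lemma borel_measurable_smooth [measurable_dest]: "smooth f \<Longrightarrow> f \<in> borel_measurable borel"
  by (intro borel_measurable_continuous_onI smooth_continuous)

lemma borel_measurable_grad: "smooth f \<Longrightarrow> grad f \<in> borel_measurable borel"
  by (intro borel_measurable_continuous_onI continuous_grad)

lemma smooth_exp: "smooth (exp :: real \<Rightarrow> real)"
proof -
  have "C_k k (exp :: real \<Rightarrow> real)" for k
  proof (induction k)
    case (Suc k)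
    have "(exp has_derivative (\<lambda>h. exp x * h)) (at x)" for x :: real
      using DERIV_exp[of x] by (simp add: has_field_derivative_def)
    then show ?case
      by (rule C_k_SucI) (use Suc in \<open>auto\<close>)
  qed (auto intro: continuous_intros)
  then show ?thesis
    by (simp add: smooth_def)
qed

section \<open>Flat functions\<close>

text \<open>
  The functions \<open>exp (- 1/s) / s ^ j\<close>, extended by \<open>0\<close>. The derivative of each is a linear combination of two
  others, so that the whole family is smooth by a single induction on the order.
\<close>

definition flat :: "nat \<Rightarrow> real \<Rightarrow> real" where
  "flat j s = (if s > 0 then exp (- inverse s) * inverse s ^ j else 0)"

lemma exp_ge_power: "x ^ j / fact j \<le> exp x" if "x \<ge> 0" for x :: real
proof -
  have "(\<lambda>n. x ^ n /\<^sub>R fact n) sums exp x"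
    by (rule exp_converges)
  then have "(\<Sum>n<Suc j. x ^ n /\<^sub>R fact n) \<le> exp x"
    using that by (intro sum_le_suminf[of "\<lambda>n. x ^ n /\<^sub>R fact n" "{..<Suc j}", THEN order_trans])
       (auto simp: sums_iff)
  moreover have "x ^ j /\<^sub>R fact j \<le> (\<Sum>n<Suc j. x ^ n /\<^sub>R fact n)"
    using that by (auto intro!: sum_nonneg)
  ultimately show ?thesis
    by (simp add: divide_inverse mult.commute)
qed

lemma flat_nonneg: "flat j s \<ge> 0"
  by (simp add: flat_def)

lemma flat_pos: "s > 0 \<Longrightarrow> flat j s > 0"
  by (simp add: flat_def)

lemma flat_eq_0: "s \<le> 0 \<Longrightarrow> flat j s = 0"
  by (simp add: flat_def)

lemma flat_le: "flat j s \<le> fact j"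
proof (cases "s > 0")
  case True
  have "inverse s ^ j \<le> exp (inverse s) * fact j"
    using exp_ge_power[of "inverse s" j] True by (simp add: field_simps)
  then show ?thesis
    using True by (simp add: flat_def exp_minus field_simps)
qed (simp add: flat_def)

lemma flat_mult: "s * flat (Suc j) s = flat j s"
  by (simp add: flat_def)

text \<open>
  At the origin the difference quotient of \<open>flat j\<close> is \<open>h * flat (j + 2) h\<close>, and \<open>flat (j + 2)\<close> is bounded.
\<close>

lemma flat_deriv: "(flat j has_real_derivative flat (j + 2) s - real j * flat (j + 1) s) (at s)"
proof (cases s "0::real" rule: linorder_cases)
  case less
  have "((\<lambda>_. 0) has_real_derivative 0) (at s)"
    by simp
  then have "(flat j has_real_derivative 0) (at s)"
    by (rule has_field_derivative_transform_within[where d = "-s"])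
      (use less in \<open>auto simp: flat_def dist_real_def\<close>)
  then show ?thesis
    using less by (simp add: flat_def)
next
  case equal
  have "norm (flat j h / h) \<le> fact (j + 2) * \<bar>h\<bar>" for h
  proof (cases "h = 0")
    case False
    have "flat j h = h * (h * flat (j + 2) h)"
      by (simp add: flat_mult)
    then have "norm (flat j h / h) = \<bar>h\<bar> * flat (j + 2) h"
      using False by (simp add: abs_mult flat_nonneg)
    then show ?thesis
      using flat_le[of "j+2" h] by (simp add: mult.commute mult_left_mono del: fact_Suc)
  qed simp
  moreover have "((\<lambda>h. fact (j + 2) * \<bar>h\<bar>) \<longlongrightarrow> fact (j + 2) * \<bar>0\<bar>) (at (0::real))"
    by (intro tendsto_intros)
  ultimately have "((\<lambda>h. flat j h / h) \<longlongrightarrow> 0) (at 0)"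
    unfolding abs_zero mult_zero_right by (rule Lim_null_comparison[OF always_eventually[OF allI]])
  then show ?thesis
    using equal by (simp add: DERIV_def flat_def)
next
  case greater
  have eq: "exp (- inverse t) * inverse t ^ j = flat j t" if "t \<in> {0<..}" for t
    using that by (simp add: flat_def)
  have j: "real j * inverse s ^ (j - 1) * inverse s ^ 2 = real j * inverse s ^ (j + 1)"
    by (cases j) (simp_all add: power2_eq_square)
  have "((\<lambda>t. exp (- inverse t) * inverse t ^ j) has_real_derivative
      exp (- inverse s) * inverse s ^ 2 * inverse s ^ j
      - exp (- inverse s) * (real j * inverse s ^ (j - 1) * inverse s ^ 2)) (at s)"
    using greater by (auto intro!: derivative_eq_intros simp: power2_eq_square)
  then have "((\<lambda>t. exp (- inverse t) * inverse t ^ j) has_real_derivative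
      flat (j + 2) s - real j * flat (j + 1) s) (at s)"
    unfolding j using greater by (simp add: flat_def power_add power2_eq_square mult_ac)
  then show ?thesis
    by (rule has_field_derivative_transform_within_open[where S = "{0<..}"]) (use greater eq in auto)
qed

lemma smooth_flat: "smooth (flat j)"
proof -
  have "C_k k (flat j)" for k
  proof (induction k arbitrary: j)
    case 0
    have "isCont (flat j) s" for s
      using flat_deriv DERIV_isCont by blast
    then show ?case
      by (auto intro: continuous_at_imp_continuous_on)
  next
    case (Suc k)
    have "(flat j has_derivative (\<lambda>h. (flat (j + 2) s + (- real j) * flat (j + 1) s) * h)) (at s)" for s
      using flat_deriv[of j s] by (simp add: has_field_derivative_def)
    then show ?case
      by (rule C_k_SucI) (intro C_k_add C_k_mult C_k_const Suc)
  qed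
  then show ?thesis
    by (simp add: smooth_def)
qed

lemma flat_0_le_1: "flat 0 s \<le> 1"
  using flat_le[of 0 s] by simp

lemma flat_0_scaled_tendsto: "(\<lambda>k. flat 0 (real k * s)) \<longlonglongrightarrow> (if s > 0 then 1 else 0)"
proof (cases "s > 0")
  case True
  have "filterlim (\<lambda>k. s * real k) at_top sequentially"
    by (rule filterlim_tendsto_pos_mult_at_top[OF tendsto_const True filterlim_real_sequentially])
  then have "(\<lambda>k. inverse (s * real k)) \<longlonglongrightarrow> 0"
    by (rule tendsto_inverse_0_at_top)
  then have "(\<lambda>k. exp (- inverse (real k * s))) \<longlonglongrightarrow> exp (- 0)"
    unfolding mult.commute[of _ s] by (intro tendsto_exp tendsto_minus)
  moreover have "eventually (\<lambda>k. exp (- inverse (real k * s)) = flat 0 (real k * s)) sequentially"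
    using eventually_gt_at_top[of 0] by eventually_elim (use True in \<open>simp add: flat_def\<close>)
  ultimately show ?thesis
    using True by (simp add: Lim_transform_eventually)
next
  case False
  then have "flat 0 (real k * s) = 0" for k
    by (intro flat_eq_0) (simp add: mult_le_0_iff)
  with False show ?thesis
    by simp
qed

section \<open>Test functions and the divergence theorem\<close>

lemma test_functionsI:
  assumes "smooth \<phi>" "compact K" "K \<subseteq> \<Omega>" "\<And>x. x \<notin> K \<Longrightarrow> \<phi> x = 0"
  shows "\<phi> \<in> test_functions \<Omega>"
proof -
  have "closure {x. \<phi> x \<noteq> 0} \<subseteq> K"
    using assms by (intro closure_minimal) (auto intro: compact_imp_closed)
  then have "compact (closure {x. \<phi> x \<noteq> 0})" "closure {x. \<phi> x \<noteq> 0} \<subseteq> \<Omega>"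
    using assms compact_Int_closed[of K "closure {x. \<phi> x \<noteq> 0}"] by (auto simp: Int_absorb1)
  then show ?thesis
    using assms(1) by (simp add: test_functions_def smooth_def)
qed

lemma test_functionsE:
  assumes "\<phi> \<in> test_functions \<Omega>"
  obtains K where "smooth \<phi>" "compact K" "K \<subseteq> \<Omega>" "\<And>x. x \<notin> K \<Longrightarrow> \<phi> x = 0" "\<And>x. x \<notin> K \<Longrightarrow> grad \<phi> x = 0"
proof -
  let ?K = "closure {x. \<phi> x \<noteq> 0}"
  have K: "smooth \<phi>" "compact ?K" "?K \<subseteq> \<Omega>"
    using assms by (auto simp: test_functions_def smooth_def)
  have 0: "\<phi> x = 0" if "x \<notin> ?K" for x
    using that closure_subset[of "{x. \<phi> x \<noteq> 0}"] by blast
  have g0: "grad \<phi> x = 0" if x: "x \<notin> ?K" for x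
  proof (rule gradI)
    have 1: "open (- ?K)"
      by (rule open_Compl[OF closed_closure])
    have 2: "x \<in> - ?K"
      using x by (simp only: Compl_iff not_False_eq_True)
    have 3: "0 = \<phi> y" if "y \<in> - ?K" for y
      using 0[OF ComplD[OF that]] by (rule sym)
    have 4: "((\<lambda>_::'a. 0::real) has_derivative (\<lambda>h. 0 \<bullet> h)) (at x)"
      by simp
    show "(\<phi> has_derivative (\<lambda>h. 0 \<bullet> h)) (at x)"
      by (rule has_derivative_transform_within_open[OF 4 1 2 3])
  qed
  from K 0 g0 show ?thesis
    by (rule that)
qed

lemma test_functions_smooth: "\<phi> \<in> test_functions \<Omega> \<Longrightarrow> smooth \<phi>"
  by (simp add: test_functions_def smooth_def)

lemma test_functions_mult:
  assumes "\<phi> \<in> test_functions \<Omega>" "smooth f"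
  shows "(\<lambda>x. f x * \<phi> x) \<in> test_functions \<Omega>"
  using assms(1)
proof (rule test_functionsE)
  fix K assume "smooth \<phi>" "compact K" "K \<subseteq> \<Omega>" "\<And>x. x \<notin> K \<Longrightarrow> \<phi> x = 0"
  then show ?thesis
    by (intro test_functionsI[of _ K] smooth_mult assms) auto
qed

lemma compactly_supported_bounded:
  fixes f :: "'a::euclidean_space \<Rightarrow> 'b::real_normed_vector"
  assumes "continuous_on UNIV f" "compact K" "\<And>x. x \<notin> K \<Longrightarrow> f x = 0"
  obtains C where "C > 0" "\<And>x. norm (f x) \<le> C"
proof -
  have "bounded (f ` K)"
    using assms by (intro compact_imp_bounded compact_continuous_image) (auto intro: continuous_on_subset)
  then obtain C where C: "C > 0" "\<And>y. y \<in> f ` K \<Longrightarrow> norm y \<le> C"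
    by (auto simp: bounded_pos)
  have "norm (f x) \<le> C" for x
    using C assms(3)[of x] by (cases "x \<in> K") auto
  with C(1) that show ?thesis by blast
qed

lemma test_functions_bounded:
  assumes "\<phi> \<in> test_functions \<Omega>"
  obtains C where "C > 0" "\<And>x. \<bar>\<phi> x\<bar> \<le> C" "\<And>x. norm (grad \<phi> x) \<le> C"
proof -
  obtain K where K: "smooth \<phi>" "compact K" "\<And>x. x \<notin> K \<Longrightarrow> \<phi> x = 0" "\<And>x. x \<notin> K \<Longrightarrow> grad \<phi> x = 0"
    using test_functionsE[OF assms] by metis
  obtain C1 where C1: "C1 > 0" "\<And>x. norm (\<phi> x) \<le> C1"
    using compactly_supported_bounded[OF smooth_continuous[OF K(1)] K(2,3)] by metis
  obtain C2 where C2: "C2 > 0" "\<And>x. norm (grad \<phi> x) \<le> C2"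
    using compactly_supported_bounded[OF continuous_grad[OF K(1)] K(2,4)] by metis
  show ?thesis
  proof (rule that[of "max C1 C2"])
    show "\<bar>\<phi> x\<bar> \<le> max C1 C2" "norm (grad \<phi> x) \<le> max C1 C2" for x
      using C1(2)[of x] C2(2)[of x] by (simp_all add: le_max_iff_disj)
  qed (use C1 in auto)
qed

lemma grad_mult:
  assumes "smooth f" "smooth g"
  shows "grad (\<lambda>x. f x * g x) x = f x *\<^sub>R grad g x + g x *\<^sub>R grad f x"
  using has_derivative_mult[OF smooth_has_gradient[OF assms(1)] smooth_has_gradient[OF assms(2)], of x]
  by (intro gradI) (simp add: inner_add_left mult.commute add.commute)

lemma integrable_compactly_supported:
  fixes f :: "'a::euclidean_space \<Rightarrow> 'b::euclidean_space"
  assumes "continuous_on UNIV f" "compact K" "\<And>x. x \<notin> K \<Longrightarrow> f x = 0"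
  shows "integrable lborel f"
proof -
  have "integrable lborel (\<lambda>x. indicator K x *\<^sub>R f x)"
    using assms by (intro borel_integrable_compact) (auto intro: continuous_on_subset)
  moreover have "(\<lambda>x. indicator K x *\<^sub>R f x) = f"
    using assms(3) by (auto simp: indicator_def)
  ultimately show ?thesis by simp
qed

lemma integrable_test_function:
  assumes "\<phi> \<in> test_functions \<Omega>"
  shows "integrable lborel \<phi>" "integrable lborel (grad \<phi>)"
  using test_functionsE[OF assms]
  by (metis integrable_compactly_supported smooth_continuous continuous_grad)+

lemma has_real_derivative_along_line:
  assumes "smooth f"
  shows "((\<lambda>s. f (x + s *\<^sub>R i)) has_real_derivative (grad f (x + s *\<^sub>R i) \<bullet> i)) (at s)"
proof -
  have "((\<lambda>s. x + s *\<^sub>R i) has_derivative (\<lambda>h. h *\<^sub>R i)) (at s)"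
    by (auto intro!: derivative_eq_intros)
  from has_derivative_compose[OF this smooth_has_gradient[OF assms]] show ?thesis
    by (simp add: has_field_derivative_def mult_commute_abs)
qed

lemma lborel_translation:
  fixes f :: "'b::euclidean_space \<Rightarrow> 'c::{banach, second_countable_topology}"
  assumes f: "f \<in> borel_measurable borel"
  shows "integrable lborel (\<lambda>x. f (x - c)) \<longleftrightarrow> integrable lborel f"
    "(LBINT x. f (x - c)) = (LBINT x. f x)"
proof -
  have "(\<lambda>x. x - c) = (+) (- c)"
    by auto
  then have "distr lborel borel (\<lambda>x. x - c) = lborel"
    using lborel_distr_plus[of "- c"] by simp
  then show "integrable lborel (\<lambda>x. f (x - c)) \<longleftrightarrow> integrable lborel f"
    "(LBINT x. f (x - c)) = (LBINT x. f x)"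
    using integrable_distr_eq[of "\<lambda>x. x - c" lborel borel f]
      integral_distr[of "\<lambda>x. x - c" lborel borel f] f by simp_all
qed

text \<open>
  Difference quotients integrate to \<open>0\<close> because Lebesgue measure is invariant under translations. They converge to the
  derivative, dominated by a constant on a ball.
\<close>

theorem integral_partial_derivative_eq_0:
  fixes \<phi> :: "'a::euclidean_space \<Rightarrow> real"
  assumes \<phi>: "\<phi> \<in> test_functions \<Omega>" and i: "norm i = 1"
  shows "(LBINT x. grad \<phi> x \<bullet> i) = 0"
proof -
  obtain K where K: "smooth \<phi>" "compact K" "\<And>x. x \<notin> K \<Longrightarrow> \<phi> x = 0"
    using test_functionsE[OF \<phi>] by metis
  obtain C where C: "C > 0" "\<And>x. norm (grad \<phi> x) \<le> C"
    using test_functions_bounded[OF \<phi>] by metis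
  obtain R where R: "\<And>x. x \<in> K \<Longrightarrow> norm x \<le> R"
    using compact_imp_bounded[OF K(2)] unfolding bounded_iff by blast
  define h :: "nat \<Rightarrow> real" where "h n = inverse (real (Suc n))" for n
  have h: "h n > 0" "h n \<le> 1" for n
    by (auto simp: h_def field_simps)
  define q where "q n x = (\<phi> (x + h n *\<^sub>R i) - \<phi> x) / h n" for n x
  have [measurable]: "\<phi> \<in> borel_measurable borel"
    using K(1) by (rule borel_measurable_smooth)
  have [measurable]: "grad \<phi> \<in> borel_measurable borel"
    using K(1) by (rule borel_measurable_grad)
  have lim: "(\<lambda>n. q n x) \<longlonglongrightarrow> grad \<phi> x \<bullet> i" for x
  proof -
    have "((\<lambda>s. (\<phi> (x + s *\<^sub>R i) - \<phi> x) / s) \<longlongrightarrow> grad \<phi> x \<bullet> i) (at 0)"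
      using has_real_derivative_along_line[OF K(1), of x i 0] by (simp add: DERIV_def)
    moreover have "filterlim h (at 0) sequentially"
      unfolding filterlim_at using LIMSEQ_inverse_real_of_nat h(1)
      by (auto simp: h_def[abs_def] intro!: always_eventually)
    ultimately show ?thesis
      unfolding q_def by (rule filterlim_compose)
  qed
  have bound: "\<bar>q n x\<bar> \<le> C * indicator (cball 0 (R + 1)) x" for n x
  proof (cases "x \<in> cball 0 (R + 1)")
    case True
    obtain z where "\<phi> (x + h n *\<^sub>R i) - \<phi> (x + 0 *\<^sub>R i) = (h n - 0) * (grad \<phi> (x + z *\<^sub>R i) \<bullet> i)"
      using MVT2[OF h(1)[of n], of "\<lambda>s. \<phi> (x + s *\<^sub>R i)" "\<lambda>s. grad \<phi> (x + s *\<^sub>R i) \<bullet> i"]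
        has_real_derivative_along_line[OF K(1), of x i]
      by blast
    then have "q n x = grad \<phi> (x + z *\<^sub>R i) \<bullet> i"
      using h(1)[of n] by (simp add: q_def)
    also have "\<bar>\<dots>\<bar> \<le> norm (grad \<phi> (x + z *\<^sub>R i)) * norm i"
      by (rule Cauchy_Schwarz_ineq2)
    finally show ?thesis
      using True C(2)[of "x + z *\<^sub>R i"] i by simp
  next
    case False
    then have x: "norm x > R + 1" by simp
    have "norm x \<le> norm (x + h n *\<^sub>R i) + norm (h n *\<^sub>R i)"
      by (metis add_diff_cancel_right' norm_triangle_ineq4)
    then have "norm (x + h n *\<^sub>R i) > R"
      using x h[of n] i by simp
    with x have "x \<notin> K" "x + h n *\<^sub>R i \<notin> K"
      using R by force+
    then show ?thesis
      using K(3) by (simp add: q_def C(1) less_imp_le)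
  qed
  have "(\<lambda>n. LBINT x. q n x) \<longlonglongrightarrow> (LBINT x. grad \<phi> x \<bullet> i)"
  proof (rule integral_dominated_convergence[where w = "\<lambda>x. C * indicator (cball 0 (R + 1)) x"])
    show "integrable lborel (\<lambda>x::'a. C * indicator (cball 0 (R + 1)) x)"
      by (intro integrable_mult_right integrable_real_indicator) (auto simp: emeasure_bounded_finite[simplified])
  qed (use lim bound in \<open>auto simp: q_def[abs_def]\<close>)
  moreover have "(LBINT x. q n x) = 0" for n
  proof -
    have int: "integrable lborel \<phi>"
      using integrable_test_function[OF \<phi>] by simp
    have shift: "integrable lborel (\<lambda>x. \<phi> (x + c))" "(LBINT x. \<phi> (x + c)) = (LBINT x. \<phi> x)" for c
      using int lborel_translation[of \<phi> "- c"] by simp_all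
    show ?thesis
      unfolding q_def using shift int by simp
  qed
  ultimately have "(\<lambda>n::nat. 0) \<longlonglongrightarrow> (LBINT x. grad \<phi> x \<bullet> i)"
    by simp
  then show ?thesis
    by (simp add: LIMSEQ_const_iff)
qed

lemma integration_by_parts:
  fixes f \<phi> :: "'a::euclidean_space \<Rightarrow> real"
  assumes \<phi>: "\<phi> \<in> test_functions \<Omega>" and f: "smooth f" and i: "norm i = 1"
  shows "(LBINT x. f x * (grad \<phi> x \<bullet> i)) = - (LBINT x. (grad f x \<bullet> i) * \<phi> x)"
proof -
  obtain K where K: "smooth \<phi>" "compact K" "\<And>x. x \<notin> K \<Longrightarrow> \<phi> x = 0" "\<And>x. x \<notin> K \<Longrightarrow> grad \<phi> x = 0"
    using test_functionsE[OF \<phi>] by metis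
  have "integrable lborel (\<lambda>x. f x * (grad \<phi> x \<bullet> i))" "integrable lborel (\<lambda>x. (grad f x \<bullet> i) * \<phi> x)"
    using K by (auto intro!: integrable_compactly_supported[of _ K] continuous_intros continuous_grad
        simp: smooth_continuous f)
  moreover have "(LBINT x. f x * (grad \<phi> x \<bullet> i) + (grad f x \<bullet> i) * \<phi> x) = 0"
    using integral_partial_derivative_eq_0[OF test_functions_mult[OF \<phi> f] i]
    by (simp add: grad_mult[OF f K(1)] inner_add_left mult.commute[of "\<phi> _"])
  ultimately show ?thesis
    by simp
qed

section \<open>Bump functions and the fundamental lemma of the calculus of variations\<close>

text \<open>
  A product of one-dimensional flat edges of width about \<open>1/k\<close>: a test function that increases to the indicator of the
  open box as \<open>k\<close> grows.
\<close>

definition bump :: "'a::euclidean_space \<Rightarrow> 'a \<Rightarrow> nat \<Rightarrow> 'a \<Rightarrow> real" where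
  "bump a b k x = (\<Prod>i\<in>Basis. flat 0 (real k * (x \<bullet> i - a \<bullet> i)) * flat 0 (real k * (b \<bullet> i - x \<bullet> i)))"

lemma smooth_bump: "smooth (bump a b k)"
  unfolding bump_def[abs_def]
  by (intro smooth_prod smooth_mult smooth_compose[OF smooth_flat] smooth_diff smooth_const smooth_linear)
    (auto intro: bounded_linear_inner_left)

lemma bump_eq_0: "x \<notin> cbox a b \<Longrightarrow> bump a b k x = 0"
proof -
  assume "x \<notin> cbox a b"
  then obtain i where i: "i \<in> Basis" "x \<bullet> i < a \<bullet> i \<or> b \<bullet> i < x \<bullet> i"
    by (force simp: mem_box not_le)
  then have "real k * (x \<bullet> i - a \<bullet> i) \<le> 0 \<or> real k * (b \<bullet> i - x \<bullet> i) \<le> 0"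
    by (auto simp: mult_le_0_iff)
  then show ?thesis
    unfolding bump_def using i(1) by (intro prod_zero) (auto intro!: bexI[of _ i] flat_eq_0)
qed

lemma bump_test_function: "cbox a b \<subseteq> \<Omega> \<Longrightarrow> bump a b k \<in> test_functions \<Omega>"
  by (rule test_functionsI[OF smooth_bump compact_cbox]) (auto simp: bump_eq_0)

lemma bump_bounds: "0 \<le> bump a b k x" "bump a b k x \<le> 1"
  unfolding bump_def
  by (auto intro!: prod_nonneg prod_le_1 mult_le_one flat_0_le_1 simp: flat_nonneg)

lemma bump_tendsto: "(\<lambda>k. bump a b k x) \<longlonglongrightarrow> indicator (box a b) x"
proof -
  have "(\<lambda>k. bump a b k x) \<longlonglongrightarrow>
      (\<Prod>i\<in>Basis. (if x \<bullet> i - a \<bullet> i > 0 then 1 else 0) * (if b \<bullet> i - x \<bullet> i > 0 then 1 else 0))"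
    unfolding bump_def by (intro tendsto_intros flat_0_scaled_tendsto)
  also have "(\<Prod>i\<in>Basis. (if x \<bullet> i - a \<bullet> i > 0 then 1 else 0) * (if b \<bullet> i - x \<bullet> i > 0 then 1 else 0))
      = (indicator (box a b) x :: real)"
  proof (cases "x \<in> box a b")
    case True
    then show ?thesis by (simp add: mem_box)
  next
    case False
    then obtain i where i: "i \<in> Basis" "\<not> (a \<bullet> i < x \<bullet> i \<and> x \<bullet> i < b \<bullet> i)"
      by (auto simp: mem_box)
    then show ?thesis
      using False by (subst prod_zero) (auto intro!: bexI[of _ i])
  qed
  finally show ?thesis .
qed

text \<open>
  The positive and the negative part, used as densities, define finite measures that agree on boxes; boxes are stable under
  intersection and generate the Borel sets.
\<close>

lemma AE_eq_0_if_box_integrals_0: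
  fixes F :: "'a::euclidean_space \<Rightarrow> real"
  assumes F: "integrable lborel F" and 0: "\<And>a b. (LBINT x. F x * indicator (box a b) x) = 0"
  shows "AE x in lborel. F x = 0"
proof -
  have [measurable]: "F \<in> borel_measurable borel"
    using F by auto
  let ?P = "density lborel (\<lambda>x. ennreal (F x))" and ?N = "density lborel (\<lambda>x. ennreal (- F x))"
  have fin: "emeasure ?P A < \<infinity>" "emeasure ?N A < \<infinity>" if [measurable]: "A \<in> sets borel" for A
  proof -
    have "(\<integral>\<^sup>+x. ennreal (norm (F x)) \<partial>lborel) < \<infinity>"
      using F by (simp add: integrable_iff_bounded)
    moreover have "emeasure ?P A \<le> (\<integral>\<^sup>+x. ennreal (norm (F x)) \<partial>lborel)"
      "emeasure ?N A \<le> (\<integral>\<^sup>+x. ennreal (norm (F x)) \<partial>lborel)"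
      by (auto simp: emeasure_density intro!: nn_integral_mono ennreal_leI split: split_indicator)
    ultimately show "emeasure ?P A < \<infinity>" "emeasure ?N A < \<infinity>"
      by auto
  qed
  have "?P = ?N"
  proof (rule measure_eqI_generator_eq)
    let ?E = "range (\<lambda>(a, b). box a b :: 'a set)"
    show "Int_stable ?E"
      by (auto simp: Int_stable_def box_Int_box)
    show "?E \<subseteq> Pow UNIV" "sets ?P = sigma_sets UNIV ?E" "sets ?N = sigma_sets UNIV ?E"
      by (simp_all add: borel_eq_box)
    let ?A = "\<lambda>n::nat. box (- (real n *\<^sub>R One)) (real n *\<^sub>R One) :: 'a set"
    show "range ?A \<subseteq> ?E" "(\<Union>i. ?A i) = UNIV"
      unfolding UN_box_eq_UNIV by auto
    show "emeasure ?P (?A i) \<noteq> \<infinity>" for i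
      using fin(1)[of "?A i"] by (simp add: top.not_eq_extremum)
    show "emeasure ?P X = emeasure ?N X" if X: "X \<in> ?E" for X
    proof -
      obtain a b where Xab: "X = box a b"
        using X by auto
      then have [measurable]: "X \<in> sets borel"
        by simp
      let ?F = "\<lambda>x. F x * indicator X x"
      have int: "integrable lborel ?F"
        using F by (rule integrable_real_mult_indicator[rotated]) simp
      have P: "emeasure ?P X = (\<integral>\<^sup>+x. ennreal (?F x) \<partial>lborel)"
        by (auto simp: emeasure_density intro!: nn_integral_cong split: split_indicator)
      have N: "emeasure ?N X = (\<integral>\<^sup>+x. ennreal (- ?F x) \<partial>lborel)"
        by (auto simp: emeasure_density intro!: nn_integral_cong split: split_indicator)
      have "enn2real (emeasure ?P X) = enn2real (emeasure ?N X)"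
        using real_lebesgue_integral_def[OF int] 0[of a b] by (simp only: P N) (simp add: Xab)
      then show ?thesis
        using fin[of X] by (metis \<open>X \<in> sets borel\<close> ennreal_enn2real infinity_ennreal_def)
    qed
  qed
  then have "AE x in lborel. ennreal (F x) = ennreal (- F x)"
    by (intro sigma_finite_measure.density_unique[OF sigma_finite_lborel]) auto
  then show ?thesis
    by eventually_elim
      (smt (verit) ennreal_eq_0_iff ennreal_neg)
qed

text \<open>
  Slices of a Lebesgue measurable function on a product need not be measurable. Passing to Borel representatives
  makes Fubini's theorem for the product of two Lebesgue-Borel measures applicable.
\<close>

lemma lebesgue_on_borel_representative:
  fixes f :: "'a::euclidean_space \<Rightarrow> real"
  assumes \<Omega>: "\<Omega> \<in> sets borel" and f: "f \<in> borel_measurable (lebesgue_on \<Omega>)"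
  obtains f' where "f' \<in> borel_measurable borel" "AE x in lborel. x \<in> \<Omega> \<longrightarrow> f x = f' x"
    "\<And>x. x \<notin> \<Omega> \<Longrightarrow> f' x = 0"
proof -
  have "(\<lambda>x. if x \<in> \<Omega> then f x else 0) \<in> borel_measurable lebesgue"
    using f \<Omega> by (simp add: borel_measurable_if)
  from completion_ex_borel_measurable_real[OF this]
  obtain f0 where f0: "f0 \<in> borel_measurable lborel" "AE x in lborel. (if x \<in> \<Omega> then f x else 0) = f0 x"
    by auto
  show ?thesis
  proof (rule that[of "\<lambda>x. indicator \<Omega> x * f0 x"])
    show "(\<lambda>x. indicator \<Omega> x * f0 x) \<in> borel_measurable borel"
      using f0(1) \<Omega> by simp
    show "AE x in lborel. x \<in> \<Omega> \<longrightarrow> f x = indicator \<Omega> x * f0 x"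
      using f0(2) by eventually_elim auto
  qed auto
qed

lemma AE_lebesgue_on_iff:
  "\<Omega> \<in> sets borel \<Longrightarrow> (AE x in lebesgue_on \<Omega>. P x) \<longleftrightarrow> (AE x in lborel. x \<in> \<Omega> \<longrightarrow> P x)"
  by (subst AE_restrict_space_iff) (auto simp: AE_completion_iff)

lemma integral_lebesgue_on_AE_eq:
  fixes f f' :: "'a::euclidean_space \<Rightarrow> 'b::{banach, second_countable_topology}"
  assumes "\<Omega> \<in> sets borel" "f' \<in> borel_measurable borel"
    "AE x in lborel. x \<in> \<Omega> \<longrightarrow> f x = f' x"
    "f \<in> borel_measurable (lebesgue_on \<Omega>)"
  shows "(LINT x|lebesgue_on \<Omega>. f x) = (LBINT x. indicator \<Omega> x *\<^sub>R f' x)"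
    "integrable (lebesgue_on \<Omega>) f \<longleftrightarrow> integrable lborel (\<lambda>x. indicator \<Omega> x *\<^sub>R f' x)"
proof -
  have m: "f' \<in> borel_measurable (lebesgue_on \<Omega>)"
    using assms(2) by (intro measurable_restrict_space1) (simp add: measurable_completion)
  have ae: "AE x in lebesgue_on \<Omega>. f x = f' x"
    using assms by (simp add: AE_lebesgue_on_iff)
  have meas: "(\<lambda>x. indicator \<Omega> x *\<^sub>R f' x) \<in> borel_measurable lborel"
    using assms by simp
  have "(LINT x|lebesgue_on \<Omega>. f x) = (LINT x|lebesgue_on \<Omega>. f' x)"
    using assms(4) m ae by (rule integral_cong_AE)
  also have "\<dots> = (LINT x|lebesgue. indicator \<Omega> x *\<^sub>R f' x)"
    using assms(1) by (intro integral_restrict_space) simp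
  also have "\<dots> = (LBINT x. indicator \<Omega> x *\<^sub>R f' x)"
    using meas by (rule integral_completion)
  finally show "(LINT x|lebesgue_on \<Omega>. f x) = (LBINT x. indicator \<Omega> x *\<^sub>R f' x)" .
  have "integrable (lebesgue_on \<Omega>) f \<longleftrightarrow> integrable (lebesgue_on \<Omega>) f'"
    using assms(4) m ae by (rule integrable_cong_AE)
  also have "\<dots> \<longleftrightarrow> integrable lebesgue (\<lambda>x. indicator \<Omega> x *\<^sub>R f' x)"
    using assms(1) by (intro integrable_restrict_space) simp
  also have "\<dots> \<longleftrightarrow> integrable lborel (\<lambda>x. indicator \<Omega> x *\<^sub>R f' x)"
    using meas by (rule integrable_completion)
  finally show "integrable (lebesgue_on \<Omega>) f \<longleftrightarrow> integrable lborel (\<lambda>x. indicator \<Omega> x *\<^sub>R f' x)" .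
qed

theorem fundamental_lemma:
  fixes f :: "'a::euclidean_space \<Rightarrow> real"
  assumes \<Omega>: "open \<Omega>" and f: "integrable (lebesgue_on \<Omega>) f"
    and 0: "\<And>\<phi>. \<phi> \<in> test_functions \<Omega> \<Longrightarrow> (LINT x|lebesgue_on \<Omega>. f x * \<phi> x) = 0"
  shows "AE x in lebesgue_on \<Omega>. f x = 0"
proof -
  have [measurable]: "\<Omega> \<in> sets borel" and fm: "f \<in> borel_measurable (lebesgue_on \<Omega>)"
    using \<Omega> f by auto
  obtain F where [measurable]: "F \<in> borel_measurable borel" and F: "AE x in lborel. x \<in> \<Omega> \<longrightarrow> f x = F x"
    "\<And>x. x \<notin> \<Omega> \<Longrightarrow> F x = 0"
    using lebesgue_on_borel_representative[OF _ fm] by (metis \<open>\<Omega> \<in> sets borel\<close>)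
  have ind: "indicator \<Omega> x *\<^sub>R F x = F x" for x
    using F(2)[of x] by (auto simp: indicator_def)
  have intF: "integrable lborel F"
    using integral_lebesgue_on_AE_eq(2)[OF _ _ F(1) fm] f by (simp add: ind del: real_scaleR_def)
  have test: "(LBINT x. F x * \<phi> x) = 0" if \<phi>: "\<phi> \<in> test_functions \<Omega>" for \<phi>
  proof -
    have [measurable]: "\<phi> \<in> borel_measurable borel"
      using \<phi> test_functions_smooth borel_measurable_smooth by blast
    have "(LINT x|lebesgue_on \<Omega>. f x * \<phi> x) = (LBINT x. indicator \<Omega> x *\<^sub>R (F x * \<phi> x))"
    proof (rule integral_lebesgue_on_AE_eq)
      show "AE x in lborel. x \<in> \<Omega> \<longrightarrow> f x * \<phi> x = F x * \<phi> x"
        using F(1) by eventually_elim auto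
      show "(\<lambda>x. f x * \<phi> x) \<in> borel_measurable (lebesgue_on \<Omega>)"
        using fm by (rule borel_measurable_times) (simp add: measurable_completion measurable_restrict_space1)
    qed auto
    also have "(\<lambda>x. indicator \<Omega> x *\<^sub>R (F x * \<phi> x)) = (\<lambda>x. F x * \<phi> x)"
      using F(2) by (intro ext) (auto simp: indicator_def)
    finally show ?thesis
      using 0[OF \<phi>] by simp
  qed
  have box: "(LBINT x. F x * indicator (box a b) x) = 0" if "cbox a b \<subseteq> \<Omega>" for a b
  proof -
    have "(\<lambda>k. LBINT x. F x * bump a b k x) \<longlonglongrightarrow> (LBINT x. F x * indicator (box a b) x)"
    proof (rule integral_dominated_convergence[where w = "\<lambda>x. \<bar>F x\<bar>"])
      have [measurable]: "bump a b k \<in> borel_measurable borel" for k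
        by (rule borel_measurable_smooth[OF smooth_bump])
      show "(\<lambda>x. F x * bump a b k x) \<in> borel_measurable lborel" for k
        by simp
      show "AE x in lborel. norm (F x * bump a b k x) \<le> \<bar>F x\<bar>" for k
        using bump_bounds[of a b k] by (auto simp: abs_mult mult_left_le)
    qed (auto intro!: tendsto_intros bump_tendsto integrable_abs intF)
    then show ?thesis
      by (simp add: test[OF bump_test_function[OF that]] LIMSEQ_const_iff)
  qed
  obtain \<D> where \<D>: "countable \<D>" "\<D> \<subseteq> Pow \<Omega>" "\<And>X. X \<in> \<D> \<Longrightarrow> \<exists>a b. X = cbox a b" "\<Union>\<D> = \<Omega>"
    by (rule open_countable_Union_open_cbox[OF \<Omega>]) blast
  have "AE x in lborel. x \<in> X \<longrightarrow> F x = 0" if X: "X \<in> \<D>" for X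
  proof -
    obtain a b where Xab: "X = cbox a b" and sub: "cbox a b \<subseteq> \<Omega>"
      using \<D>(2,3) X by blast
    have "AE x in lborel. F x * indicator (box a b) x = 0"
    proof (rule AE_eq_0_if_box_integrals_0)
      show "integrable lborel (\<lambda>x. F x * indicator (box a b) x)"
        using intF by (rule integrable_real_mult_indicator[rotated]) simp
      fix c d :: 'a
      obtain p q where pq: "box a b \<inter> box c d = box p q"
        using box_Int_box[of a b c d] by blast
      have "box p q \<subseteq> cbox a b"
        using pq box_subset_cbox[of a b] by blast
      then have "closure (box p q) \<subseteq> cbox a b"
        by (intro closure_minimal) auto
      then have "cbox p q \<subseteq> \<Omega> \<or> box p q = {}"
        using sub by (cases "box p q = {}") auto
      then have "(LBINT x. F x * indicator (box p q) x) = 0"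
        using box[of p q] by auto
      then show "(LBINT x. F x * indicator (box a b) x * indicator (box c d) x) = 0"
        by (simp add: mult.assoc indicator_inter_arith[symmetric] pq)
    qed
    moreover have "AE x in lborel. x \<notin> cbox a b - box a b"
    proof (rule AE_not_in)
      have "negligible (cbox a b - box a b)"
        by (rule negligible_frontier_interval)
      then show "cbox a b - box a b \<in> null_sets lborel"
        by (simp add: negligible_iff_null_sets null_sets_completion_iff)
    qed
    ultimately show ?thesis
      by eventually_elim (auto simp: Xab indicator_def split: if_splits)
  qed
  then have "AE x in lborel. \<forall>X\<in>\<D>. x \<in> X \<longrightarrow> F x = 0"
    by (subst AE_ball_countable[OF \<D>(1)]) blast
  with F(1) show ?thesis
    unfolding AE_lebesgue_on_iff[OF \<open>\<Omega> \<in> sets borel\<close>]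
    by eventually_elim (use \<D>(4) in auto)
qed

section \<open>Square-integrable functions\<close>

definition L2 :: "'x measure \<Rightarrow> ('x \<Rightarrow> 'b::euclidean_space) \<Rightarrow> bool" where
  "L2 M f \<longleftrightarrow> f \<in> borel_measurable M \<and> integrable M (\<lambda>x. (norm (f x))\<^sup>2)"

text \<open>
  Convergence in the seminorm of \<open>L2\<close>. The integral alone would say nothing when the integrand is not integrable, whence the
  membership conditions.
\<close>

definition L2_lim :: "'x measure \<Rightarrow> (nat \<Rightarrow> 'x \<Rightarrow> 'b::euclidean_space) \<Rightarrow> ('x \<Rightarrow> 'b) \<Rightarrow> bool" where
  "L2_lim M f F \<longleftrightarrow> (\<forall>k. L2 M (f k)) \<and> L2 M F \<and> (\<lambda>k. LINT x|M. (norm (f k x - F x))\<^sup>2) \<longlonglongrightarrow> 0"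

lemma L2_bound:
  assumes "f \<in> borel_measurable M" "integrable M w" "AE x in M. (norm (f x))\<^sup>2 \<le> w x"
  shows "L2 M f"
  unfolding L2_def
proof
  show "integrable M (\<lambda>x. (norm (f x))\<^sup>2)"
    by (rule Bochner_Integration.integrable_bound[OF assms(2)])
      (use assms(1,3) in \<open>auto elim!: eventually_mono\<close>)
qed fact

lemma norm_add_power2_le: "(norm (a + b))\<^sup>2 \<le> 2 * (norm a)\<^sup>2 + 2 * (norm b)\<^sup>2"
proof -
  have "(norm (a + b))\<^sup>2 \<le> (norm a + norm b)\<^sup>2"
    by (intro power_mono norm_triangle_ineq) auto
  also have "\<dots> \<le> 2 * (norm a)\<^sup>2 + 2 * (norm b)\<^sup>2"
    using sum_squares_bound[of "norm a" "norm b"] by (simp add: power2_sum)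
  finally show ?thesis .
qed

lemma L2_add: "L2 M f \<Longrightarrow> L2 M g \<Longrightarrow> L2 M (\<lambda>x. f x + g x)"
  by (rule L2_bound[where w = "\<lambda>x. 2 * (norm (f x))\<^sup>2 + 2 * (norm (g x))\<^sup>2"])
    (auto simp: L2_def norm_add_power2_le)

lemma L2_mult_bounded:
  assumes "L2 M f" "m \<in> borel_measurable M" "AE x in M. \<bar>m x\<bar> \<le> C"
  shows "L2 M (\<lambda>x. m x *\<^sub>R f x)"
proof (rule L2_bound[where w = "\<lambda>x. C\<^sup>2 * (norm (f x))\<^sup>2"])
  show "AE x in M. (norm (m x *\<^sub>R f x))\<^sup>2 \<le> C\<^sup>2 * (norm (f x))\<^sup>2"
    using assms(3) by eventually_elim
      (auto simp: power_mult_distrib intro!: mult_right_mono power2_le_iff_abs_le[THEN iffD2])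
qed (use assms in \<open>auto simp: L2_def\<close>)

lemma L2_cmult: "L2 M f \<Longrightarrow> L2 M (\<lambda>x. c *\<^sub>R f x)"
  by (rule L2_mult_bounded[where C = "\<bar>c\<bar>"]) auto

lemma L2_diff: "L2 M f \<Longrightarrow> L2 M g \<Longrightarrow> L2 M (\<lambda>x. f x - g x)"
  using L2_add[of M f "\<lambda>x. (-1) *\<^sub>R g x"] L2_cmult[of M g "-1"] by simp

lemma L2_cong_AE: "L2 M f \<Longrightarrow> g \<in> borel_measurable M \<Longrightarrow> AE x in M. f x = g x \<Longrightarrow> L2 M g"
  by (rule L2_bound[where w = "\<lambda>x. (norm (f x))\<^sup>2"]) (auto simp: L2_def)

lemma (in finite_measure) L2_bounded:
  "f \<in> borel_measurable M \<Longrightarrow> AE x in M. norm (f x) \<le> C \<Longrightarrow> L2 M f"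
  by (rule L2_bound[where w = "\<lambda>x. C\<^sup>2"]) (auto elim!: eventually_mono intro: power_mono)

lemma L2_norm_mult_integrable:
  assumes "L2 M f" "L2 M g"
  shows "integrable M (\<lambda>x. norm (f x) * norm (g x))"
proof (rule Bochner_Integration.integrable_bound)
  show "integrable M (\<lambda>x. (norm (f x))\<^sup>2 + (norm (g x))\<^sup>2)"
    using assms by (simp add: L2_def)
  have "norm (f x) * norm (g x) \<le> (norm (f x))\<^sup>2 + (norm (g x))\<^sup>2" for x
  proof -
    have "2 * (norm (f x) * norm (g x)) \<le> (norm (f x))\<^sup>2 + (norm (g x))\<^sup>2"
      using sum_squares_bound[of "norm (f x)" "norm (g x)"] by simp
    moreover have "0 \<le> norm (f x) * norm (g x)"
      by simp
    ultimately show ?thesis by linarith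
  qed
  then show "AE x in M. norm (norm (f x) * norm (g x)) \<le> norm ((norm (f x))\<^sup>2 + (norm (g x))\<^sup>2)"
    by (auto simp: abs_mult)
qed (use assms in \<open>auto simp: L2_def\<close>)

lemma L2_inner_integrable: "L2 M f \<Longrightarrow> L2 M g \<Longrightarrow> integrable M (\<lambda>x. f x \<bullet> g x)"
  by (rule Bochner_Integration.integrable_bound[OF L2_norm_mult_integrable[of M f g]])
    (auto simp: L2_def Cauchy_Schwarz_ineq2 abs_mult)

lemma (in finite_measure) L2_integrable: "L2 M f \<Longrightarrow> integrable M f"
  using L2_norm_mult_integrable[of M f "\<lambda>_. 1::real"]
  by (auto simp: L2_def intro: integrable_norm_cancel)

text \<open>
  The integral of \<open>(s |f| - |g|)\<^sup>2\<close> is a nonnegative quadratic polynomial in \<open>s\<close>.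
\<close>

lemma L2_Cauchy_Schwarz:
  assumes "L2 M f" "L2 M g"
  shows "(LINT x|M. norm (f x) * norm (g x)) \<le> sqrt (LINT x|M. (norm (f x))\<^sup>2) * sqrt (LINT x|M. (norm (g x))\<^sup>2)"
proof -
  define A where "A = (LINT x|M. (norm (f x))\<^sup>2)"
  define C where "C = (LINT x|M. (norm (g x))\<^sup>2)"
  define P where "P = (LINT x|M. norm (f x) * norm (g x))"
  have int: "integrable M (\<lambda>x. (norm (f x))\<^sup>2)" "integrable M (\<lambda>x. (norm (g x))\<^sup>2)"
    "integrable M (\<lambda>x. norm (f x) * norm (g x))"
    using assms L2_norm_mult_integrable by (auto simp: L2_def)
  have nn: "A \<ge> 0" "C \<ge> 0" "P \<ge> 0"
    by (auto simp: A_def C_def P_def)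
  have quad: "0 \<le> s\<^sup>2 * A - 2 * s * P + C" for s
  proof -
    have "0 \<le> (LINT x|M. (s * norm (f x) - norm (g x))\<^sup>2)"
      by simp
    also have "(\<lambda>x. (s * norm (f x) - norm (g x))\<^sup>2)
        = (\<lambda>x. s\<^sup>2 * (norm (f x))\<^sup>2 - 2 * s * (norm (f x) * norm (g x)) + (norm (g x))\<^sup>2)"
      by (auto simp: power2_diff power_mult_distrib)
    also have "(LINT x|M. \<dots> x) = s\<^sup>2 * A - 2 * s * P + C"
      using int by (simp add: A_def C_def P_def)
    finally show ?thesis .
  qed
  have "P\<^sup>2 \<le> A * C"
  proof (cases "A = 0")
    case True
    have "P = 0"
    proof (rule ccontr)
      assume "P \<noteq> 0"
      then show False
        using quad[of "(C + 1) / (2 * P)"] nn True by (simp add: field_simps)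
    qed
    with nn show ?thesis by simp
  next
    case False
    then show ?thesis
      using quad[of "P / A"] nn by (simp add: field_simps power2_eq_square)
  qed
  then show ?thesis
    using nn unfolding A_def[symmetric] C_def[symmetric] P_def[symmetric]
    by (simp add: real_le_rsqrt flip: real_sqrt_mult)
qed

lemma L2_lim_inner:
  assumes f: "L2_lim M f F" and G: "L2 M G"
  shows "(\<lambda>k. LINT x|M. f k x \<bullet> G x) \<longlonglongrightarrow> (LINT x|M. F x \<bullet> G x)"
proof -
  have fk: "L2 M (f k)" and F: "L2 M F" and lim: "(\<lambda>k. LINT x|M. (norm (f k x - F x))\<^sup>2) \<longlonglongrightarrow> 0" for k
    using f by (auto simp: L2_lim_def)
  have lim0: "(\<lambda>k. sqrt (LINT x|M. (norm (f k x - F x))\<^sup>2) * sqrt (LINT x|M. (norm (G x))\<^sup>2)) \<longlonglongrightarrow> 0"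
    using tendsto_mult_right[OF tendsto_real_sqrt[OF lim], of "sqrt (LINT x|M. (norm (G x))\<^sup>2)"] by simp
  have bound: "\<bar>(LINT x|M. f k x \<bullet> G x) - (LINT x|M. F x \<bullet> G x)\<bar>
      \<le> sqrt (LINT x|M. (norm (f k x - F x))\<^sup>2) * sqrt (LINT x|M. (norm (G x))\<^sup>2)" for k
  proof -
    have d: "L2 M (\<lambda>x. f k x - F x)"
      using fk F by (rule L2_diff)
    have "(LINT x|M. f k x \<bullet> G x) - (LINT x|M. F x \<bullet> G x) = (LINT x|M. (f k x - F x) \<bullet> G x)"
      by (simp add: inner_diff_left L2_inner_integrable[OF fk G] L2_inner_integrable[OF F G])
    also have "\<bar>\<dots>\<bar> \<le> (LINT x|M. norm ((f k x - F x) \<bullet> G x))"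
      using integral_norm_bound[of M "\<lambda>x. (f k x - F x) \<bullet> G x"] by simp
    also have "\<dots> \<le> (LINT x|M. norm (f k x - F x) * norm (G x))"
      by (intro integral_mono integrable_norm L2_inner_integrable[OF d G] L2_norm_mult_integrable[OF d G])
        (simp add: Cauchy_Schwarz_ineq2)
    also note L2_Cauchy_Schwarz[OF d G]
    finally show ?thesis .
  qed
  have "(\<lambda>k. (LINT x|M. f k x \<bullet> G x) - (LINT x|M. F x \<bullet> G x)) \<longlonglongrightarrow> 0"
    by (rule Lim_null_comparison[OF always_eventually lim0]) (simp add: bound)
  then show ?thesis
    by (simp add: LIM_zero_iff)
qed

lemma L2_lim_bound:
  assumes "\<And>k. L2 M (f k)" "L2 M F" "\<And>k. AE x in M. (norm (f k x - F x))\<^sup>2 \<le> w k x"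
    "\<And>k. integrable M (w k)" "(\<lambda>k. LINT x|M. w k x) \<longlonglongrightarrow> 0"
  shows "L2_lim M f F"
  unfolding L2_lim_def
proof (intro conjI allI)
  show "(\<lambda>k. LINT x|M. (norm (f k x - F x))\<^sup>2) \<longlonglongrightarrow> 0"
  proof (rule tendsto_sandwich[OF always_eventually always_eventually tendsto_const assms(5)])
    show "\<forall>k. (LINT x|M. (norm (f k x - F x))\<^sup>2) \<le> (LINT x|M. w k x)"
      using L2_diff[OF assms(1,2)] assms(3,4) by (auto intro!: integral_mono_AE simp: L2_def)
  qed simp
qed (use assms in auto)

lemma L2_lim_add:
  assumes "L2_lim M f F" "L2_lim M g G"
  shows "L2_lim M (\<lambda>k x. f k x + g k x) (\<lambda>x. F x + G x)"
proof (rule L2_lim_bound[where w = "\<lambda>k x. 2 * (norm (f k x - F x))\<^sup>2 + 2 * (norm (g k x - G x))\<^sup>2"])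
  show i: "integrable M (\<lambda>x. 2 * (norm (f k x - F x))\<^sup>2 + 2 * (norm (g k x - G x))\<^sup>2)" for k
    using L2_diff[of M "f k" F] L2_diff[of M "g k" G] assms by (simp add: L2_def L2_lim_def)
  have "(\<lambda>k. 2 * (LINT x|M. (norm (f k x - F x))\<^sup>2) + 2 * (LINT x|M. (norm (g k x - G x))\<^sup>2)) \<longlonglongrightarrow> 2 * 0 + 2 * 0"
    using assms by (intro tendsto_intros) (auto simp: L2_lim_def)
  moreover have "integrable M (\<lambda>x. (norm (f k x - F x))\<^sup>2)" "integrable M (\<lambda>x. (norm (g k x - G x))\<^sup>2)" for k
    using L2_diff[of M "f k" F] L2_diff[of M "g k" G] assms by (auto simp: L2_def L2_lim_def)
  ultimately show "(\<lambda>k. LINT x|M. 2 * (norm (f k x - F x))\<^sup>2 + 2 * (norm (g k x - G x))\<^sup>2) \<longlonglongrightarrow> 0"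
    by simp
  have "(norm (f k x + g k x - (F x + G x)))\<^sup>2 \<le> 2 * (norm (f k x - F x))\<^sup>2 + 2 * (norm (g k x - G x))\<^sup>2" for k x
    using norm_add_power2_le[of "f k x - F x" "g k x - G x"] by (simp add: add_diff_add)
  then show "AE x in M. (norm (f k x + g k x - (F x + G x)))\<^sup>2 \<le> 2 * (norm (f k x - F x))\<^sup>2 + 2 * (norm (g k x - G x))\<^sup>2" for k
    by simp
qed (use assms in \<open>auto simp: L2_lim_def intro: L2_add\<close>)

lemma L2_lim_mult_bounded:
  assumes f: "L2_lim M f F" and m: "\<And>k. m k \<in> borel_measurable M" "\<And>k. AE x in M. \<bar>m k x\<bar> \<le> C"
  shows "L2_lim M (\<lambda>k x. m k x *\<^sub>R (f k x - F x)) (\<lambda>x. 0)"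
proof (rule L2_lim_bound[where w = "\<lambda>k x. C\<^sup>2 * (norm (f k x - F x))\<^sup>2"])
  have d: "L2 M (\<lambda>x. f k x - F x)" for k
    using f by (auto simp: L2_lim_def intro: L2_diff)
  show "L2 M (\<lambda>x. m k x *\<^sub>R (f k x - F x))" for k
    by (rule L2_mult_bounded[OF d m])
  show "AE x in M. (norm (m k x *\<^sub>R (f k x - F x) - 0))\<^sup>2 \<le> C\<^sup>2 * (norm (f k x - F x))\<^sup>2" for k
    using m(2)[of k] by eventually_elim
      (auto simp: power_mult_distrib intro!: mult_right_mono power2_le_iff_abs_le[THEN iffD2])
  show "integrable M (\<lambda>x. C\<^sup>2 * (norm (f k x - F x))\<^sup>2)" for k
    using d by (auto simp: L2_def)
  show "(\<lambda>k. LINT x|M. C\<^sup>2 * (norm (f k x - F x))\<^sup>2) \<longlonglongrightarrow> 0"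
    using f tendsto_mult_right_zero[of "\<lambda>k. LINT x|M. (norm (f k x - F x))\<^sup>2" sequentially "C\<^sup>2"]
    by (simp add: L2_lim_def)
  show "L2 M (\<lambda>x. 0)"
    by (simp add: L2_def)
qed

lemma L2_lim_const: "L2 M F \<Longrightarrow> L2_lim M (\<lambda>k. F) F"
  by (simp add: L2_lim_def)

lemma L2_lim_mult_fixed:
  assumes f: "L2_lim M f F" and m: "m \<in> borel_measurable M" "AE x in M. \<bar>m x\<bar> \<le> C"
  shows "L2_lim M (\<lambda>k x. m x *\<^sub>R f k x) (\<lambda>x. m x *\<^sub>R F x)"
proof -
  have "L2_lim M (\<lambda>k x. m x *\<^sub>R (f k x - F x) + m x *\<^sub>R F x) (\<lambda>x. 0 + m x *\<^sub>R F x)"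
    using f m by (intro L2_lim_add L2_lim_mult_bounded L2_lim_const L2_mult_bounded) (auto simp: L2_lim_def)
  then show ?thesis
    by (simp add: algebra_simps)
qed

text \<open>
  Products of a fixed square-integrable function with bounded factors that converge only pointwise: this is how
  \<open>\<sigma>' (z\<^sub>k)\<close>, for which no rate is available, is handled in the chain rule.
\<close>

lemma L2_lim_dominated:
  assumes F: "L2 M F" and m: "\<And>k. m k \<in> borel_measurable M" "\<And>k. AE x in M. \<bar>m k x\<bar> \<le> C"
    and m': "m' \<in> borel_measurable M" and lim: "AE x in M. (\<lambda>k. m k x) \<longlonglongrightarrow> m' x"
  shows "L2_lim M (\<lambda>k x. m k x *\<^sub>R F x) (\<lambda>x. m' x *\<^sub>R F x)"
proof (rule L2_lim_bound[where w = "\<lambda>k x. (norm (m k x *\<^sub>R F x - m' x *\<^sub>R F x))\<^sup>2"])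
  have all: "AE x in M. \<forall>k. \<bar>m k x\<bar> \<le> C"
    using m(2) by (simp add: AE_all_countable)
  have C': "AE x in M. \<bar>m' x\<bar> \<le> C"
    using all lim by eventually_elim (rule LIMSEQ_le_const2[OF tendsto_rabs], auto)
  show 1: "L2 M (\<lambda>x. m k x *\<^sub>R F x)" for k
    by (rule L2_mult_bounded[OF F m])
  show 2: "L2 M (\<lambda>x. m' x *\<^sub>R F x)"
    by (rule L2_mult_bounded[OF F m' C'])
  show "integrable M (\<lambda>x. (norm (m k x *\<^sub>R F x - m' x *\<^sub>R F x))\<^sup>2)" for k
    using L2_diff[OF 1 2] by (simp add: L2_def)
  have [measurable]: "F \<in> borel_measurable M"
    using F by (simp add: L2_def)
  note m(1)[measurable] m'[measurable]
  have "(\<lambda>k. LINT x|M. (norm (m k x *\<^sub>R F x - m' x *\<^sub>R F x))\<^sup>2) \<longlonglongrightarrow> (LINT x|M. 0)"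
  proof (rule integral_dominated_convergence[where w = "\<lambda>x. (2 * C)\<^sup>2 * (norm (F x))\<^sup>2"])
    show "integrable M (\<lambda>x. (2 * C)\<^sup>2 * (norm (F x))\<^sup>2)"
      using F by (simp add: L2_def)
    show "AE x in M. (\<lambda>k. (norm (m k x *\<^sub>R F x - m' x *\<^sub>R F x))\<^sup>2) \<longlonglongrightarrow> 0"
      using lim
    proof eventually_elim
      case (elim x)
      have "(\<lambda>k. (norm (m k x *\<^sub>R F x - m' x *\<^sub>R F x))\<^sup>2) \<longlonglongrightarrow> (norm (m' x *\<^sub>R F x - m' x *\<^sub>R F x))\<^sup>2"
        by (intro tendsto_intros elim)
      then show ?case by simp
    qed
    show "AE x in M. norm ((norm (m k x *\<^sub>R F x - m' x *\<^sub>R F x))\<^sup>2) \<le> (2 * C)\<^sup>2 * (norm (F x))\<^sup>2" for k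
      using m(2)[of k] C'
    proof eventually_elim
      case (elim x)
      have "norm (m k x *\<^sub>R F x - m' x *\<^sub>R F x) = \<bar>m k x - m' x\<bar> * norm (F x)"
        by (simp flip: scaleR_diff_left)
      also have "\<dots> \<le> (2 * C) * norm (F x)"
        using elim by (intro mult_right_mono) auto
      finally have "(norm (m k x *\<^sub>R F x - m' x *\<^sub>R F x))\<^sup>2 \<le> ((2 * C) * norm (F x))\<^sup>2"
        by (intro power_mono) auto
      then show ?case
        by (simp add: power_mult_distrib)
    qed
  qed auto
  then show "(\<lambda>k. LINT x|M. (norm (m k x *\<^sub>R F x - m' x *\<^sub>R F x))\<^sup>2) \<longlonglongrightarrow> 0"
    by simp
qed auto

lemma L2_lim_subseq: "L2_lim M f F \<Longrightarrow> strict_mono r \<Longrightarrow> L2_lim M (\<lambda>k. f (r k)) F"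
  using LIMSEQ_subseq_LIMSEQ[of "\<lambda>k. LINT x|M. (norm (f k x - F x))\<^sup>2" 0 r]
  by (auto simp: L2_lim_def o_def)

lemma L2_lim_AE_subseq:
  assumes "L2_lim M f F"
  obtains r :: "nat \<Rightarrow> nat" where "strict_mono r" "AE x in M. (\<lambda>k. f (r k) x) \<longlonglongrightarrow> F x"
proof -
  have "integrable M (\<lambda>x. (norm (f k x - F x))\<^sup>2)" for k
    using assms L2_diff[of M "f k" F] by (auto simp: L2_def L2_lim_def)
  then obtain r :: "nat \<Rightarrow> nat" where r: "strict_mono r" "AE x in M. (\<lambda>k. (norm (f (r k) x - F x))\<^sup>2) \<longlonglongrightarrow> 0"
    using tendsto_L1_AE_subseq[of M "\<lambda>k x. (norm (f k x - F x))\<^sup>2"] assms by (auto simp: L2_lim_def)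
  show ?thesis
  proof (rule that[OF r(1)])
    show "AE x in M. (\<lambda>k. f (r k) x) \<longlonglongrightarrow> F x"
      using r(2)
    proof eventually_elim
      case (elim x)
      have "(\<lambda>k. norm (f (r k) x - F x)) \<longlonglongrightarrow> 0"
        using tendsto_real_sqrt[OF elim] by simp
      then show ?case
        by (simp add: LIM_zero_iff tendsto_norm_zero_iff)
    qed
  qed
qed

text \<open>
  The workhorse for Lipschitz images and for products with bounded functions.
\<close>

lemma L2_lim_comparison:
  assumes f: "L2_lim M f F" and H: "L2 M H" and h: "\<And>k. h k \<in> borel_measurable M"
    and le: "\<And>k. AE x in M. norm (h k x - H x) \<le> C * norm (f k x - F x)"
  shows "L2_lim M h H"
proof (rule L2_lim_bound[where w = "\<lambda>k x. C\<^sup>2 * (norm (f k x - F x))\<^sup>2"])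
  have d: "integrable M (\<lambda>x. (norm (f k x - F x))\<^sup>2)" for k
    using f L2_diff[of M "f k" F] by (auto simp: L2_lim_def L2_def)
  show le2: "AE x in M. (norm (h k x - H x))\<^sup>2 \<le> C\<^sup>2 * (norm (f k x - F x))\<^sup>2" for k
    using le[of k]
  proof eventually_elim
    case (elim x)
    then have "(norm (h k x - H x))\<^sup>2 \<le> (C * norm (f k x - F x))\<^sup>2"
      by (intro power_mono) auto
    then show ?case
      by (simp add: power_mult_distrib)
  qed
  show i: "integrable M (\<lambda>x. C\<^sup>2 * (norm (f k x - F x))\<^sup>2)" for k
    using d by simp
  have "L2 M (\<lambda>x. h k x - H x)" for k
    by (rule L2_bound[OF _ i le2]) (use h H in \<open>auto simp: L2_def\<close>)
  from L2_add[OF this H] show "L2 M (h k)" for k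
    by simp
  show "(\<lambda>k. LINT x|M. C\<^sup>2 * (norm (f k x - F x))\<^sup>2) \<longlonglongrightarrow> 0"
    using f tendsto_mult_right_zero[of "\<lambda>k. LINT x|M. (norm (f k x - F x))\<^sup>2" sequentially "C\<^sup>2"]
    by (simp add: L2_lim_def)
qed fact

lemma L2_lim_cong:
  assumes "L2_lim M f F" "\<And>k x. x \<in> space M \<Longrightarrow> f k x = f' k x"
  shows "L2_lim M f' F"
proof -
  have "(\<lambda>k. LINT x|M. (norm (f k x - F x))\<^sup>2) = (\<lambda>k. LINT x|M. (norm (f' k x - F x))\<^sup>2)"
    by (intro ext Bochner_Integration.integral_cong) (auto simp: assms(2))
  moreover have "L2 M (f k) \<longleftrightarrow> L2 M (f' k)" for k
    unfolding L2_def
    by (intro conj_cong measurable_cong Bochner_Integration.integrable_cong) (auto simp: assms(2))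
  ultimately show ?thesis
    using assms(1) by (simp add: L2_lim_def)
qed

lemma L2_lim_cong_limit_AE:
  assumes lim: "L2_lim M f F" and m: "F' \<in> borel_measurable M" and ae: "AE x in M. F x = F' x"
  shows "L2_lim M f F'"
proof -
  have F': "L2 M F'"
    using lim unfolding L2_lim_def by (intro L2_cong_AE[OF _ m ae]) blast
  have "(LINT x|M. (norm (f k x - F x))\<^sup>2) = (LINT x|M. (norm (f k x - F' x))\<^sup>2)" for k
  proof (rule integral_cong_AE)
    have [measurable]: "f k \<in> borel_measurable M" "F \<in> borel_measurable M"
      using lim by (auto simp: L2_lim_def L2_def)
    note m [measurable]
    show "(\<lambda>x. (norm (f k x - F x))\<^sup>2) \<in> borel_measurable M" "(\<lambda>x. (norm (f k x - F' x))\<^sup>2) \<in> borel_measurable M"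
      by measurable
    show "AE x in M. (norm (f k x - F x))\<^sup>2 = (norm (f k x - F' x))\<^sup>2"
      using ae by eventually_elim simp
  qed
  then show ?thesis
    using lim F' by (simp add: L2_lim_def)
qed

section \<open>Weak gradients\<close>

lemma L2_space_iff: "v \<in> L2_space \<Omega> \<longleftrightarrow> L2 (lebesgue_on \<Omega>) v"
  by (simp add: L2_space_def L2_def)

lemma finite_measure_lebesgue_on:
  assumes "open \<Omega>" "bounded \<Omega>"
  shows "finite_measure (lebesgue_on \<Omega>)"
proof
  have "emeasure lebesgue \<Omega> < \<infinity>"
    using assms emeasure_bounded_finite[of \<Omega>] by simp
  then show "emeasure (lebesgue_on \<Omega>) (space (lebesgue_on \<Omega>)) \<noteq> \<infinity>"
    using assms by (subst emeasure_restrict_space) auto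
qed

lemma measurable_lebesgue_on: "f \<in> borel_measurable borel \<Longrightarrow> f \<in> borel_measurable (lebesgue_on \<Omega>)"
  by (intro measurable_restrict_space1) (simp add: measurable_completion)

lemma integral_lebesgue_on_borel:
  fixes f :: "'a::euclidean_space \<Rightarrow> 'b::{banach, second_countable_topology}"
  assumes "\<Omega> \<in> sets borel" "f \<in> borel_measurable borel"
  shows "(LINT x|lebesgue_on \<Omega>. f x) = (LBINT x. indicator \<Omega> x *\<^sub>R f x)"
    "integrable (lebesgue_on \<Omega>) f \<longleftrightarrow> integrable lborel (\<lambda>x. indicator \<Omega> x *\<^sub>R f x)"
  using integral_lebesgue_on_AE_eq[OF assms(1,2), of f] assms(2) measurable_lebesgue_on by auto

context
  fixes \<Omega> :: "'a::euclidean_space set"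
  assumes \<Omega>: "open \<Omega>" "bounded \<Omega>"
begin

interpretation D: finite_measure "lebesgue_on \<Omega>"
  by (rule finite_measure_lebesgue_on[OF \<Omega>])

lemma L2_test_function:
  assumes "\<phi> \<in> test_functions \<Omega>"
  shows "L2 (lebesgue_on \<Omega>) \<phi>" "L2 (lebesgue_on \<Omega>) (grad \<phi>)"
proof -
  obtain C where "\<And>x. \<bar>\<phi> x\<bar> \<le> C" "\<And>x. norm (grad \<phi> x) \<le> C"
    using test_functions_bounded[OF assms] by metis
  then show "L2 (lebesgue_on \<Omega>) \<phi>" "L2 (lebesgue_on \<Omega>) (grad \<phi>)"
    using test_functions_smooth[OF assms]
    by (auto intro!: D.L2_bounded[where C = C] measurable_lebesgue_on borel_measurable_smooth borel_measurable_grad)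
qed

lemma weak_gradient_iff:
  "is_weak_gradient \<Omega> v g \<longleftrightarrow> L2 (lebesgue_on \<Omega>) g \<and>
     (\<forall>\<phi>\<in>test_functions \<Omega>. \<forall>i\<in>Basis. (LINT x|lebesgue_on \<Omega>. v x * (grad \<phi> x \<bullet> i))
        = - (LINT x|lebesgue_on \<Omega>. (g x \<bullet> i) * \<phi> x))"
  by (auto simp: is_weak_gradient_def L2_space_iff grad_inner)

lemma L2_times_test:
  assumes "L2 (lebesgue_on \<Omega>) v" "\<phi> \<in> test_functions \<Omega>" "i \<in> Basis"
  shows "integrable (lebesgue_on \<Omega>) (\<lambda>x. v x * (grad \<phi> x \<bullet> i))"
    "L2 (lebesgue_on \<Omega>) g \<Longrightarrow> integrable (lebesgue_on \<Omega>) (\<lambda>x. (g x \<bullet> i) * \<phi> x)"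
proof -
  have "L2 (lebesgue_on \<Omega>) (\<lambda>x. v x *\<^sub>R i)"
    using assms(1,3) unfolding L2_def by (auto intro: borel_measurable_scaleR)
  from L2_inner_integrable[OF this L2_test_function(2)[OF assms(2)]]
  show "integrable (lebesgue_on \<Omega>) (\<lambda>x. v x * (grad \<phi> x \<bullet> i))"
    by (simp add: inner_commute)
  assume g: "L2 (lebesgue_on \<Omega>) g"
  have "L2 (lebesgue_on \<Omega>) (\<lambda>x. \<phi> x *\<^sub>R i)"
    using L2_test_function(1)[OF assms(2)] assms(3) unfolding L2_def by (auto intro: borel_measurable_scaleR)
  from L2_inner_integrable[OF g this]
  show "integrable (lebesgue_on \<Omega>) (\<lambda>x. (g x \<bullet> i) * \<phi> x)"
    by (simp add: mult.commute)
qed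

lemma weak_gradient_lincomb:
  assumes "L2 (lebesgue_on \<Omega>) v" "L2 (lebesgue_on \<Omega>) w" "is_weak_gradient \<Omega> v g" "is_weak_gradient \<Omega> w h"
  shows "is_weak_gradient \<Omega> (\<lambda>x. a * v x + b * w x) (\<lambda>x. a *\<^sub>R g x + b *\<^sub>R h x)"
  unfolding weak_gradient_iff
proof (intro conjI ballI)
  have gh: "L2 (lebesgue_on \<Omega>) g" "L2 (lebesgue_on \<Omega>) h"
    using assms by (auto simp: weak_gradient_iff)
  show "L2 (lebesgue_on \<Omega>) (\<lambda>x. a *\<^sub>R g x + b *\<^sub>R h x)"
    by (intro L2_add L2_cmult gh)
  fix \<phi> i assume \<phi>: "\<phi> \<in> test_functions \<Omega>" and i: "(i::'a) \<in> Basis"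
  note int = L2_times_test(1)[OF assms(1) \<phi> i] L2_times_test(1)[OF assms(2) \<phi> i]
    L2_times_test(2)[OF assms(1) \<phi> i gh(1)] L2_times_test(2)[OF assms(1) \<phi> i gh(2)]
  have "(LINT x|lebesgue_on \<Omega>. (a * v x + b * w x) * (grad \<phi> x \<bullet> i))
      = (LINT x|lebesgue_on \<Omega>. a * (v x * (grad \<phi> x \<bullet> i)) + b * (w x * (grad \<phi> x \<bullet> i)))"
    by (simp add: algebra_simps)
  also have "\<dots> = a * (LINT x|lebesgue_on \<Omega>. v x * (grad \<phi> x \<bullet> i)) + b * (LINT x|lebesgue_on \<Omega>. w x * (grad \<phi> x \<bullet> i))"
    using int by simp
  also have "\<dots> = - (a * (LINT x|lebesgue_on \<Omega>. (g x \<bullet> i) * \<phi> x) + b * (LINT x|lebesgue_on \<Omega>. (h x \<bullet> i) * \<phi> x))"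
    using assms(3,4) \<phi> i by (simp add: weak_gradient_iff)
  also have "\<dots> = - (LINT x|lebesgue_on \<Omega>. a * ((g x \<bullet> i) * \<phi> x) + b * ((h x \<bullet> i) * \<phi> x))"
    using int by simp
  finally show "(LINT x|lebesgue_on \<Omega>. (a * v x + b * w x) * (grad \<phi> x \<bullet> i))
      = - (LINT x|lebesgue_on \<Omega>. ((a *\<^sub>R g x + b *\<^sub>R h x) \<bullet> i) * \<phi> x)"
    by (simp add: algebra_simps)
qed

text \<open>
  \<open>W12_norm\<close> is computed from an arbitrarily chosen weak gradient. Uniqueness shows that every weak gradient gives the same
  value, which makes the seminorm usable.
\<close>

lemma weak_gradient_unique:
  assumes "is_weak_gradient \<Omega> v g" "is_weak_gradient \<Omega> v h"
  shows "AE x in lebesgue_on \<Omega>. g x = h x"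
proof -
  have gh: "L2 (lebesgue_on \<Omega>) g" "L2 (lebesgue_on \<Omega>) h"
    using assms by (auto simp: weak_gradient_iff)
  have "AE x in lebesgue_on \<Omega>. g x \<bullet> i - h x \<bullet> i = 0" if i: "i \<in> Basis" for i
  proof (rule fundamental_lemma[OF \<Omega>(1)])
    have "integrable (lebesgue_on \<Omega>) g" "integrable (lebesgue_on \<Omega>) h"
      using gh D.L2_integrable by auto
    then show "integrable (lebesgue_on \<Omega>) (\<lambda>x. g x \<bullet> i - h x \<bullet> i)"
      by simp
    fix \<phi> assume \<phi>: "\<phi> \<in> test_functions \<Omega>"
    have "(LINT x|lebesgue_on \<Omega>. (g x \<bullet> i) * \<phi> x) = (LINT x|lebesgue_on \<Omega>. (h x \<bullet> i) * \<phi> x)"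
      using assms \<phi> i by (simp add: weak_gradient_iff)
    then show "(LINT x|lebesgue_on \<Omega>. (g x \<bullet> i - h x \<bullet> i) * \<phi> x) = 0"
      using L2_times_test(2)[OF L2_test_function(1)[OF \<phi>] \<phi> i] gh by (simp add: algebra_simps)
  qed
  then have "AE x in lebesgue_on \<Omega>. \<forall>i\<in>Basis. g x \<bullet> i - h x \<bullet> i = 0"
    by (intro AE_finite_allI) auto
  then show ?thesis
    by eventually_elim (auto intro: euclidean_eqI)
qed

lemma W12_norm_eq:
  assumes "is_weak_gradient \<Omega> v g"
  shows "W12_norm \<Omega> v = sqrt ((LINT x|lebesgue_on \<Omega>. (v x)\<^sup>2) + (LINT x|lebesgue_on \<Omega>. (norm (g x))\<^sup>2))"
proof -
  define h where "h = (SOME g. is_weak_gradient \<Omega> v g)"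
  have h: "is_weak_gradient \<Omega> v h"
    unfolding h_def by (rule someI[of "is_weak_gradient \<Omega> v", OF assms])
  have "(LINT x|lebesgue_on \<Omega>. (norm (h x))\<^sup>2) = (LINT x|lebesgue_on \<Omega>. (norm (g x))\<^sup>2)"
    using weak_gradient_unique[OF h assms] h assms
    by (intro integral_cong_AE) (auto simp: weak_gradient_iff L2_def)
  then show ?thesis
    by (simp add: W12_norm_def h_def Let_def)
qed

lemma weak_gradient_test_function:
  assumes "f \<in> test_functions \<Omega>"
  shows "is_weak_gradient \<Omega> f (grad f)"
  unfolding weak_gradient_iff
proof (intro conjI ballI)
  show "L2 (lebesgue_on \<Omega>) (grad f)"
    by (rule L2_test_function(2)[OF assms])
  fix \<phi> and i :: 'a assume \<phi>: "\<phi> \<in> test_functions \<Omega>" and i: "i \<in> Basis"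
  obtain K where K: "smooth \<phi>" "K \<subseteq> \<Omega>" "\<And>x. x \<notin> K \<Longrightarrow> \<phi> x = 0" "\<And>x. x \<notin> K \<Longrightarrow> grad \<phi> x = 0"
    using test_functionsE[OF \<phi>] by metis
  have off: "\<phi> x = 0" "grad \<phi> x = 0" if "x \<notin> \<Omega>" for x
    using that K(2) K(3,4)[of x] by auto
  have f: "smooth f"
    using assms by (rule test_functions_smooth)
  have [measurable]: "f \<in> borel_measurable borel" "grad f \<in> borel_measurable borel"
    "\<phi> \<in> borel_measurable borel" "grad \<phi> \<in> borel_measurable borel"
    using f K(1) by (auto intro: borel_measurable_smooth borel_measurable_grad)
  have "(\<lambda>x. indicator \<Omega> x *\<^sub>R (f x * (grad \<phi> x \<bullet> i))) = (\<lambda>x. f x * (grad \<phi> x \<bullet> i))"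
    "(\<lambda>x. indicator \<Omega> x *\<^sub>R ((grad f x \<bullet> i) * \<phi> x)) = (\<lambda>x. (grad f x \<bullet> i) * \<phi> x)"
    by (auto simp: indicator_def fun_eq_iff off)
  then show "(LINT x|lebesgue_on \<Omega>. f x * (grad \<phi> x \<bullet> i)) = - (LINT x|lebesgue_on \<Omega>. (grad f x \<bullet> i) * \<phi> x)"
    using integration_by_parts[OF \<phi> f, of i] i \<Omega>(1)
    by (simp add: integral_lebesgue_on_borel del: real_scaleR_def)
qed

lemma weak_gradient_add_const:
  assumes v: "L2 (lebesgue_on \<Omega>) v" and g: "is_weak_gradient \<Omega> v g"
  shows "is_weak_gradient \<Omega> (\<lambda>x. v x + c) g"
  unfolding weak_gradient_iff
proof (intro conjI ballI)
  show "L2 (lebesgue_on \<Omega>) g"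
    using g by (simp add: weak_gradient_iff)
  fix \<phi> and i :: 'a assume \<phi>: "\<phi> \<in> test_functions \<Omega>" and i: "i \<in> Basis"
  obtain K where K: "smooth \<phi>" "K \<subseteq> \<Omega>" "\<And>x. x \<notin> K \<Longrightarrow> \<phi> x = 0" "\<And>x. x \<notin> K \<Longrightarrow> grad \<phi> x = 0"
    using test_functionsE[OF \<phi>] by metis
  have off: "\<phi> x = 0" "grad \<phi> x = 0" if "x \<notin> \<Omega>" for x
    using that K(2) K(3,4)[of x] by auto
  have [measurable]: "grad \<phi> \<in> borel_measurable borel"
    using K(1) by (rule borel_measurable_grad)
  have "(\<lambda>x. indicator \<Omega> x *\<^sub>R (grad \<phi> x \<bullet> i)) = (\<lambda>x. grad \<phi> x \<bullet> i)"
    by (auto simp: indicator_def fun_eq_iff off)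
  then have 0: "(LINT x|lebesgue_on \<Omega>. grad \<phi> x \<bullet> i) = 0"
    using integral_partial_derivative_eq_0[OF \<phi>, of i] i \<Omega>(1)
    by (simp add: integral_lebesgue_on_borel del: real_scaleR_def)
  have "integrable (lebesgue_on \<Omega>) (\<lambda>x. c * (grad \<phi> x \<bullet> i))"
    by (rule L2_times_test(1)[OF _ \<phi> i]) (simp add: L2_def)
  moreover have "integrable (lebesgue_on \<Omega>) (\<lambda>x. v x * (grad \<phi> x \<bullet> i))"
    by (rule L2_times_test(1)[OF v \<phi> i])
  ultimately show "(LINT x|lebesgue_on \<Omega>. (v x + c) * (grad \<phi> x \<bullet> i)) = - (LINT x|lebesgue_on \<Omega>. (g x \<bullet> i) * \<phi> x)"
    using g \<phi> i 0 by (simp add: weak_gradient_iff distrib_right)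
qed

text \<open>
  The weak gradient of \<open>\<phi>\<^sub>k - v\<close> is \<open>\<nabla>\<phi>\<^sub>k - g\<close>, so convergence in \<open>W12_norm\<close> splits into two convergences in \<open>L2\<close>.
\<close>

lemma W12_0_approximation:
  assumes v: "v \<in> W12_0 \<Omega>" and g: "is_weak_gradient \<Omega> v g"
  obtains \<phi> where "\<And>k. \<phi> k \<in> test_functions \<Omega>" "L2_lim (lebesgue_on \<Omega>) \<phi> v"
    "L2_lim (lebesgue_on \<Omega>) (\<lambda>k. grad (\<phi> k)) g"
proof -
  obtain \<phi> where \<phi>: "\<And>k. \<phi> k \<in> test_functions \<Omega>"
    and lim: "(\<lambda>k. W12_norm \<Omega> (\<lambda>x. \<phi> k x - v x)) \<longlonglongrightarrow> 0"
    using v by (auto simp: W12_0_def)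
  have v2: "L2 (lebesgue_on \<Omega>) v" and g2: "L2 (lebesgue_on \<Omega>) g"
    using v g by (auto simp: W12_0_def W12_def L2_space_iff weak_gradient_iff)
  note \<phi>2 = L2_test_function[OF \<phi>]
  have "is_weak_gradient \<Omega> (\<lambda>x. \<phi> k x - v x) (\<lambda>x. grad (\<phi> k) x - g x)" for k
    using weak_gradient_lincomb[OF \<phi>2(1) v2 weak_gradient_test_function[OF \<phi>] g, of 1 k "-1"] by simp
  then have W: "W12_norm \<Omega> (\<lambda>x. \<phi> k x - v x) = sqrt ((LINT x|lebesgue_on \<Omega>. (\<phi> k x - v x)\<^sup>2)
      + (LINT x|lebesgue_on \<Omega>. (norm (grad (\<phi> k) x - g x))\<^sup>2))" for k
    by (rule W12_norm_eq)
  have sq: "(\<lambda>k. (LINT x|lebesgue_on \<Omega>. (\<phi> k x - v x)\<^sup>2)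
      + (LINT x|lebesgue_on \<Omega>. (norm (grad (\<phi> k) x - g x))\<^sup>2)) \<longlonglongrightarrow> 0"
    using tendsto_power[OF lim, of 2] unfolding W by simp
  have "(\<lambda>k. LINT x|lebesgue_on \<Omega>. (norm (\<phi> k x - v x))\<^sup>2) \<longlonglongrightarrow> 0"
    "(\<lambda>k. LINT x|lebesgue_on \<Omega>. (norm (grad (\<phi> k) x - g x))\<^sup>2) \<longlonglongrightarrow> 0"
    by (rule tendsto_sandwich[OF always_eventually always_eventually tendsto_const sq]; simp)+
  then show ?thesis
    using \<phi> \<phi>2 v2 g2 by (intro that[of \<phi>]) (auto simp: L2_lim_def)
qed

lemma W12_0_test_function:
  assumes "\<phi> \<in> test_functions \<Omega>"
  shows "\<phi> \<in> W12_0 \<Omega>"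
proof -
  have "is_weak_gradient \<Omega> (\<lambda>x. \<phi> x - \<phi> x) (\<lambda>x. 0)"
    by (simp add: weak_gradient_iff L2_def)
  from W12_norm_eq[OF this] have "W12_norm \<Omega> (\<lambda>x. \<phi> x - \<phi> x) = 0"
    by simp
  then have "(\<lambda>k::nat. W12_norm \<Omega> (\<lambda>x. \<phi> x - \<phi> x)) \<longlonglongrightarrow> 0"
    by simp
  then show ?thesis
    using assms weak_gradient_test_function[OF assms] L2_test_function[OF assms]
    unfolding W12_0_def W12_def by (auto simp: L2_space_iff intro!: exI[of _ "\<lambda>_. \<phi>"])
qed

end

section \<open>The chain rule for functions with zero boundary values\<close>

lemma has_derivative_real_compose:
  fixes \<sigma> :: "real \<Rightarrow> real"
  assumes "(\<sigma> has_real_derivative s) (at (f x))" "(f has_derivative (\<lambda>h. g \<bullet> h)) (at x)"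
  shows "((\<lambda>x. \<sigma> (f x)) has_derivative (\<lambda>h. (s *\<^sub>R g) \<bullet> h)) (at x)"
  using has_derivative_compose[OF assms(2) assms(1)[unfolded has_field_derivative_def]] by simp

text \<open>
  Let \<open>w + c\<close> have boundary value \<open>c\<close> and let \<open>c E \<le> 1\<close>. Since \<open>\<sigma>\<close> vanishes up to \<open>1\<close>, the function \<open>\<sigma> ((w + c) E) m\<close> vanishes
  on the boundary, and it is approximated by test functions together with its gradient as given by the chain rule.
  The approximations are obtained by inserting test functions for \<open>w\<close>; a bound on \<open>\<sigma>\<close> carries over to them, which allows
  pairing them with integrable functions.
\<close>

lemma chain_rule_approximation:
  fixes \<Omega> :: "'a::euclidean_space set" and E m :: "'a \<Rightarrow> real" and \<sigma> \<sigma>' :: "real \<Rightarrow> real"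
  assumes \<Omega>: "open \<Omega>" "bounded \<Omega>"
    and \<phi>: "\<And>k. \<phi> k \<in> test_functions \<Omega>" "L2_lim (lebesgue_on \<Omega>) \<phi> w"
      "L2_lim (lebesgue_on \<Omega>) (\<lambda>k. grad (\<phi> k)) g"
    and \<sigma>: "smooth \<sigma>" "\<And>r. (\<sigma> has_real_derivative \<sigma>' r) (at r)" "continuous_on UNIV \<sigma>'"
      "\<And>r. \<bar>\<sigma>' r\<bar> \<le> C" "\<And>r. r \<le> 1 \<Longrightarrow> \<sigma> r = 0"
    and E: "smooth E" "\<And>x. x \<in> \<Omega> \<Longrightarrow> \<bar>E x\<bar> \<le> C1" "\<And>x. x \<in> \<Omega> \<Longrightarrow> norm (grad E x) \<le> C1"
      "\<And>x. x \<in> \<Omega> \<Longrightarrow> c * E x \<le> 1"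
    and m: "smooth m" "\<And>x. x \<in> \<Omega> \<Longrightarrow> \<bar>m x\<bar> \<le> C2" "\<And>x. x \<in> \<Omega> \<Longrightarrow> norm (grad m x) \<le> C2"
  obtains \<eta> where "\<And>k. \<eta> k \<in> test_functions \<Omega>"
    "L2_lim (lebesgue_on \<Omega>) \<eta> (\<lambda>x. \<sigma> ((w x + c) * E x) * m x)"
    "L2_lim (lebesgue_on \<Omega>) (\<lambda>k. grad (\<eta> k)) (\<lambda>x. (\<sigma>' ((w x + c) * E x) * m x) *\<^sub>R
        (E x *\<^sub>R g x + (w x + c) *\<^sub>R grad E x) + \<sigma> ((w x + c) * E x) *\<^sub>R grad m x)"
    "AE x in lebesgue_on \<Omega>. (\<lambda>k. \<eta> k x) \<longlonglongrightarrow> \<sigma> ((w x + c) * E x) * m x"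
    "\<And>k x S. x \<in> \<Omega> \<Longrightarrow> (\<And>r. \<bar>\<sigma> r\<bar> \<le> S) \<Longrightarrow> \<bar>\<eta> k x\<bar> \<le> S * C2"
proof -
  let ?D = "lebesgue_on \<Omega>"
  interpret D: finite_measure ?D
    by (rule finite_measure_lebesgue_on[OF \<Omega>])
  have sp: "space ?D = \<Omega>"
    by simp
  obtain r :: "nat \<Rightarrow> nat" where r: "strict_mono r" and rlim: "AE x in ?D. (\<lambda>k. \<phi> (r k) x) \<longlonglongrightarrow> w x"
    using L2_lim_AE_subseq[OF \<phi>(2)] .
  define \<psi> where "\<psi> k = \<phi> (r k)" for k
  have \<psi>: "\<psi> k \<in> test_functions \<Omega>" "smooth (\<psi> k)" for k
    using \<phi>(1)[of "r k"] test_functions_smooth[OF \<phi>(1)[of "r k"]] by (auto simp: \<psi>_def)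
  have \<psi>w: "L2_lim ?D \<psi> w" and \<psi>g: "L2_lim ?D (\<lambda>k. grad (\<psi> k)) g"
    using L2_lim_subseq[OF \<phi>(2) r] L2_lim_subseq[OF \<phi>(3) r] by (auto simp: \<psi>_def[abs_def])
  have w2: "L2 ?D w" and g2: "L2 ?D g"
    using \<phi> by (auto simp: L2_lim_def)
  have [measurable]: "E \<in> borel_measurable borel" "grad E \<in> borel_measurable borel"
    "m \<in> borel_measurable borel" "grad m \<in> borel_measurable borel" "\<sigma> \<in> borel_measurable borel"
    "\<sigma>' \<in> borel_measurable borel" "\<psi> k \<in> borel_measurable borel" "grad (\<psi> k) \<in> borel_measurable borel" for k
    using E(1) m(1) \<sigma>(1,3) \<psi>(2)
    by (auto intro: borel_measurable_smooth borel_measurable_grad borel_measurable_continuous_onI)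
  have [measurable]: "w \<in> borel_measurable ?D" "g \<in> borel_measurable ?D"
    using w2 g2 by (auto simp: L2_def)
  have D[measurable]: "E \<in> borel_measurable ?D" "grad E \<in> borel_measurable ?D"
    "m \<in> borel_measurable ?D" "grad m \<in> borel_measurable ?D"
    "\<psi> k \<in> borel_measurable ?D" "grad (\<psi> k) \<in> borel_measurable ?D" for k
    by (auto intro: measurable_lebesgue_on)
  have lip: "\<bar>\<sigma> a - \<sigma> b\<bar> \<le> C * \<bar>a - b\<bar>" for a b
    using field_differentiable_bound[of UNIV \<sigma> \<sigma>' C a b] \<sigma>(2,4) by (auto simp: has_field_derivative_at_within)
  have \<sigma>0: "\<sigma> 0 = 0"
    using \<sigma>(5) by simp
  define z where "z x = (w x + c) * E x" for x
  define zk where "zk k x = (\<psi> k x + c) * E x" for k x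
  define Z where "Z x = E x *\<^sub>R g x + (w x + c) *\<^sub>R grad E x" for x
  define Zk where "Zk k x = E x *\<^sub>R grad (\<psi> k) x + (\<psi> k x + c) *\<^sub>R grad E x" for k x
  (* The bound c * E <= 1 holds only inside the domain. Subtracting the value for w = 0 makes the function
     vanish off the support of \<psi> k in the whole space, and changes nothing inside the domain. *)
  define \<eta> where "\<eta> k x = (\<sigma> (zk k x) - \<sigma> (c * E x)) * m x" for k x
  have [measurable]: "z \<in> borel_measurable ?D" "zk k \<in> borel_measurable ?D"
    "Z \<in> borel_measurable ?D" "Zk k \<in> borel_measurable ?D" for k
    unfolding z_def[abs_def] zk_def[abs_def] Z_def[abs_def] Zk_def[abs_def] by measurable
  have E_ae: "AE x in ?D. \<bar>E x\<bar> \<le> C1 \<and> norm (grad E x) \<le> C1 \<and> \<bar>m x\<bar> \<le> C2 \<and> norm (grad m x) \<le> C2"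
    using E m by (intro AE_I2) auto
  have wc2: "L2 ?D (\<lambda>x. w x + c)"
    by (intro L2_add w2 D.L2_bounded[where C = "\<bar>c\<bar>"]) auto
  have zkz: "L2_lim ?D zk z"
  proof (rule L2_lim_comparison[OF \<psi>w, where C = C1])
    have "L2 ?D (\<lambda>x. E x *\<^sub>R (w x + c))"
      by (rule L2_mult_bounded[OF wc2, where C = C1]) (use E_ae in auto)
    then show "L2 ?D z"
      by (simp add: z_def[abs_def] mult.commute)
    show "AE x in ?D. norm (zk k x - z x) \<le> C1 * norm (\<psi> k x - w x)" for k
      using E_ae
    proof eventually_elim
      case (elim x)
      have "zk k x - z x = E x * (\<psi> k x - w x)"
        by (simp add: zk_def z_def algebra_simps)
      then show ?case
        using elim by (simp add: abs_mult mult_right_mono)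
    qed
  qed measurable
  have ZkZ: "L2_lim ?D Zk Z"
    unfolding Z_def[abs_def] Zk_def[abs_def]
  proof (rule L2_lim_add)
    show "L2_lim ?D (\<lambda>k x. E x *\<^sub>R grad (\<psi> k) x) (\<lambda>x. E x *\<^sub>R g x)"
      by (rule L2_lim_mult_fixed[OF \<psi>g, where C = C1]) (use E_ae in auto)
    show "L2_lim ?D (\<lambda>k x. (\<psi> k x + c) *\<^sub>R grad E x) (\<lambda>x. (w x + c) *\<^sub>R grad E x)"
    proof (rule L2_lim_comparison[OF \<psi>w, where C = C1])
      show "AE x in ?D. norm ((\<psi> k x + c) *\<^sub>R grad E x - (w x + c) *\<^sub>R grad E x) \<le> C1 * norm (\<psi> k x - w x)" for k
        using E_ae
      proof eventually_elim
        case (elim x)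
        have "norm ((\<psi> k x + c) *\<^sub>R grad E x - (w x + c) *\<^sub>R grad E x) = \<bar>\<psi> k x - w x\<bar> * norm (grad E x)"
          by (simp flip: scaleR_diff_left)
        then show ?case
          using elim by (simp add: mult.commute[of C1] mult_left_mono)
      qed
      show "L2 ?D (\<lambda>x. (w x + c) *\<^sub>R grad E x)"
      proof (rule L2_bound[where w = "\<lambda>x. C1\<^sup>2 * (norm (w x + c))\<^sup>2"])
        show "AE x in ?D. (norm ((w x + c) *\<^sub>R grad E x))\<^sup>2 \<le> C1\<^sup>2 * (norm (w x + c))\<^sup>2"
          using E_ae by eventually_elim
            (auto simp: power_mult_distrib mult.commute[of "C1\<^sup>2"] intro!: mult_left_mono power_mono)
      qed (use wc2 in \<open>auto simp: L2_def\<close>)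
    qed measurable
  qed
  have z2: "L2 ?D z" and Z2: "L2 ?D Z"
    using zkz ZkZ by (auto simp: L2_lim_def)
  have lim_z: "AE x in ?D. (\<lambda>k. zk k x) \<longlonglongrightarrow> z x"
    using rlim by eventually_elim (auto simp: zk_def z_def \<psi>_def intro!: tendsto_intros)
  have cont: "(\<lambda>k. \<sigma> (zk k x)) \<longlonglongrightarrow> \<sigma> (z x)" "(\<lambda>k. \<sigma>' (zk k x)) \<longlonglongrightarrow> \<sigma>' (z x)"
    if "(\<lambda>k. zk k x) \<longlonglongrightarrow> z x" for x
    using continuous_on_tendsto_compose[OF smooth_continuous[OF \<sigma>(1)] that]
      continuous_on_tendsto_compose[OF \<sigma>(3) that] by auto
  have \<eta>_test: "\<eta> k \<in> test_functions \<Omega>" for k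
  proof -
    obtain K where K: "compact K" "K \<subseteq> \<Omega>" "\<And>x. x \<notin> K \<Longrightarrow> \<psi> k x = 0"
      using test_functionsE[OF \<psi>(1)] by metis
    show ?thesis
    proof (rule test_functionsI[OF _ K(1,2)])
      show "smooth (\<eta> k)"
        unfolding \<eta>_def[abs_def] zk_def
        by (intro smooth_mult smooth_diff smooth_compose[OF \<sigma>(1)] smooth_add smooth_const \<psi> E m)
      show "\<eta> k x = 0" if "x \<notin> K" for x
        using K(3)[OF that] by (simp add: \<eta>_def zk_def)
    qed
  qed
  have \<eta>_eq: "\<eta> k x = \<sigma> (zk k x) * m x" if "x \<in> \<Omega>" for k x
    using E(4)[OF that] \<sigma>(5)[of "c * E x"] by (simp add: \<eta>_def)
  have \<eta>_grad: "grad (\<eta> k) x = (m x * \<sigma>' (zk k x)) *\<^sub>R Zk k x + \<sigma> (zk k x) *\<^sub>R grad m x" if x: "x \<in> \<Omega>" for k x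
  proof (rule gradI)
    have "(zk k has_derivative (\<lambda>h. Zk k x \<bullet> h)) (at x)"
      unfolding zk_def[abs_def] Zk_def
      using has_derivative_mult[OF has_derivative_add[OF smooth_has_gradient[OF \<psi>(2), of k x] has_derivative_const[of c]]
          smooth_has_gradient[OF E(1), of x]]
      by (simp add: inner_add_left mult.commute add.commute)
    from has_derivative_mult[OF has_derivative_real_compose[OF \<sigma>(2) this] smooth_has_gradient[OF m(1), of x]]
    have "((\<lambda>x. \<sigma> (zk k x) * m x) has_derivative
        (\<lambda>h. ((m x * \<sigma>' (zk k x)) *\<^sub>R Zk k x + \<sigma> (zk k x) *\<^sub>R grad m x) \<bullet> h)) (at x)"
      by (simp add: inner_add_left mult_ac add.commute)
    then show "(\<eta> k has_derivative
        (\<lambda>h. ((m x * \<sigma>' (zk k x)) *\<^sub>R Zk k x + \<sigma> (zk k x) *\<^sub>R grad m x) \<bullet> h)) (at x)"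
      by (rule has_derivative_transform_within_open[OF _ \<Omega>(1) x]) (simp add: \<eta>_eq)
  qed
  show ?thesis
  proof (rule that[of \<eta>])
    show "\<eta> k \<in> test_functions \<Omega>" for k
      by (rule \<eta>_test)
    have "L2_lim ?D (\<lambda>k x. \<sigma> (zk k x) * m x) (\<lambda>x. \<sigma> (z x) * m x)"
    proof (rule L2_lim_comparison[OF zkz, where C = "C * C2"])
      show "AE x in ?D. norm (\<sigma> (zk k x) * m x - \<sigma> (z x) * m x) \<le> C * C2 * norm (zk k x - z x)" for k
        using E_ae
      proof eventually_elim
        case (elim x)
        have "norm (\<sigma> (zk k x) * m x - \<sigma> (z x) * m x) = \<bar>\<sigma> (zk k x) - \<sigma> (z x)\<bar> * \<bar>m x\<bar>"
          by (simp flip: left_diff_distrib abs_mult)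
        also have "\<dots> \<le> (C * \<bar>zk k x - z x\<bar>) * C2"
          using elim order_trans[OF abs_ge_zero lip] by (intro mult_mono lip) auto
        finally show ?case
          by (simp add: mult_ac)
      qed
      show "L2 ?D (\<lambda>x. \<sigma> (z x) * m x)"
      proof (rule L2_bound[where w = "\<lambda>x. (C * C2)\<^sup>2 * (norm (z x))\<^sup>2"])
        show "AE x in ?D. (norm (\<sigma> (z x) * m x))\<^sup>2 \<le> (C * C2)\<^sup>2 * (norm (z x))\<^sup>2"
          using E_ae
        proof eventually_elim
          case (elim x)
          have "\<bar>\<sigma> (z x) * m x\<bar> \<le> (C * \<bar>z x\<bar>) * C2"
            unfolding abs_mult using elim lip[of "z x" 0] order_trans[OF abs_ge_zero lip, of "z x" 0]
            by (intro mult_mono) (auto simp: \<sigma>0)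
          then have "(norm (\<sigma> (z x) * m x))\<^sup>2 \<le> ((C * \<bar>z x\<bar>) * C2)\<^sup>2"
            by (intro power_mono) auto
          then show ?case
            by (simp add: power_mult_distrib mult_ac)
        qed
      qed (use z2 in \<open>auto simp: L2_def\<close>)
    qed measurable
    then show "L2_lim ?D \<eta> (\<lambda>x. \<sigma> ((w x + c) * E x) * m x)"
      unfolding z_def[symmetric] by (rule L2_lim_cong) (simp add: \<eta>_eq)
    have 1: "L2_lim ?D (\<lambda>k x. \<sigma> (zk k x) *\<^sub>R grad m x) (\<lambda>x. \<sigma> (z x) *\<^sub>R grad m x)"
    proof (rule L2_lim_comparison[OF zkz, where C = "C * C2"])
      show "AE x in ?D. norm (\<sigma> (zk k x) *\<^sub>R grad m x - \<sigma> (z x) *\<^sub>R grad m x) \<le> C * C2 * norm (zk k x - z x)" for k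
        using E_ae
      proof eventually_elim
        case (elim x)
        have "norm (\<sigma> (zk k x) *\<^sub>R grad m x - \<sigma> (z x) *\<^sub>R grad m x) = \<bar>\<sigma> (zk k x) - \<sigma> (z x)\<bar> * norm (grad m x)"
          by (simp flip: scaleR_diff_left)
        also have "\<dots> \<le> (C * \<bar>zk k x - z x\<bar>) * C2"
          using elim order_trans[OF abs_ge_zero lip] by (intro mult_mono lip) auto
        finally show ?case
          by (simp add: mult_ac)
      qed
      show "L2 ?D (\<lambda>x. \<sigma> (z x) *\<^sub>R grad m x)"
      proof (rule L2_bound[where w = "\<lambda>x. (C * C2)\<^sup>2 * (norm (z x))\<^sup>2"])
        show "AE x in ?D. (norm (\<sigma> (z x) *\<^sub>R grad m x))\<^sup>2 \<le> (C * C2)\<^sup>2 * (norm (z x))\<^sup>2"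
          using E_ae
        proof eventually_elim
          case (elim x)
          have "norm (\<sigma> (z x) *\<^sub>R grad m x) \<le> (C * \<bar>z x\<bar>) * C2"
            unfolding norm_scaleR using elim lip[of "z x" 0] order_trans[OF abs_ge_zero lip, of "z x" 0]
            by (intro mult_mono) (auto simp: \<sigma>0)
          then have "(norm (\<sigma> (z x) *\<^sub>R grad m x))\<^sup>2 \<le> ((C * \<bar>z x\<bar>) * C2)\<^sup>2"
            by (intro power_mono) auto
          then show ?case
            by (simp add: power_mult_distrib mult_ac)
        qed
      qed (use z2 in \<open>auto simp: L2_def\<close>)
    qed measurable
    have b: "AE x in ?D. \<bar>m x * \<sigma>' (zk k x)\<bar> \<le> C2 * C" for k
      using E_ae
    proof eventually_elim
      case (elim x)
      then show ?case
        unfolding abs_mult using \<sigma>(4) order_trans[OF abs_ge_zero, of "m x" C2] by (intro mult_mono) auto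
    qed
    have 2: "L2_lim ?D (\<lambda>k x. (m x * \<sigma>' (zk k x)) *\<^sub>R (Zk k x - Z x)) (\<lambda>x. 0)"
      by (rule L2_lim_mult_bounded[OF ZkZ _ b]) measurable
    have 3: "L2_lim ?D (\<lambda>k x. (m x * \<sigma>' (zk k x)) *\<^sub>R Z x) (\<lambda>x. (m x * \<sigma>' (z x)) *\<^sub>R Z x)"
    proof (rule L2_lim_dominated[OF Z2 _ b])
      show "AE x in ?D. (\<lambda>k. m x * \<sigma>' (zk k x)) \<longlonglongrightarrow> m x * \<sigma>' (z x)"
        using lim_z by eventually_elim (intro tendsto_intros cont)
    qed measurable
    have "L2_lim ?D (\<lambda>k x. (m x * \<sigma>' (zk k x)) *\<^sub>R Zk k x + \<sigma> (zk k x) *\<^sub>R grad m x)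
        (\<lambda>x. (m x * \<sigma>' (z x)) *\<^sub>R Z x + \<sigma> (z x) *\<^sub>R grad m x)"
      using L2_lim_add[OF L2_lim_add[OF 2 3] 1] by (simp add: scaleR_diff_right)
    then have "L2_lim ?D (\<lambda>k. grad (\<eta> k)) (\<lambda>x. (m x * \<sigma>' (z x)) *\<^sub>R Z x + \<sigma> (z x) *\<^sub>R grad m x)"
      by (rule L2_lim_cong) (simp add: \<eta>_grad)
    then show "L2_lim ?D (\<lambda>k. grad (\<eta> k)) (\<lambda>x. (\<sigma>' ((w x + c) * E x) * m x) *\<^sub>R
        (E x *\<^sub>R g x + (w x + c) *\<^sub>R grad E x) + \<sigma> ((w x + c) * E x) *\<^sub>R grad m x)"
      unfolding z_def Z_def by (simp add: mult.commute)
    have "AE x in ?D. (\<lambda>k. \<sigma> (zk k x) * m x) \<longlonglongrightarrow> \<sigma> (z x) * m x"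
      using lim_z by eventually_elim (intro tendsto_intros cont)
    then show "AE x in ?D. (\<lambda>k. \<eta> k x) \<longlonglongrightarrow> \<sigma> ((w x + c) * E x) * m x"
      using AE_space by eventually_elim (simp add: \<eta>_eq z_def)
    show "\<bar>\<eta> k x\<bar> \<le> S * C2" if "x \<in> \<Omega>" "\<And>r. \<bar>\<sigma> r\<bar> \<le> S" for k x S
      unfolding \<eta>_eq[OF that(1)] abs_mult
      using that m(2)[OF that(1)] order_trans[OF abs_ge_zero, of "m x" C2] order_trans[OF abs_ge_zero that(2)]
      by (intro mult_mono) auto
  qed
qed

section \<open>A convex penalty\<close>

text \<open>
  A smooth convex version of the positive part of \<open>r - 1\<close> and its first two derivatives. Boundedness of \<open>pen1\<close>, rather than
  of \<open>pen\<close>, is essential: solutions are not known to be bounded from above, and test functions must be.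
  Boundedness of \<open>r pen2 r\<close> controls the term of the gradient of \<open>pen1 (u E)\<close> in which the barrier is differentiated.
\<close>

definition pen :: "real \<Rightarrow> real" where "pen r = (r - 1) * flat 0 (r - 1)"
definition pen1 :: "real \<Rightarrow> real" where "pen1 r = flat 0 (r - 1) + flat 1 (r - 1)"
definition pen2 :: "real \<Rightarrow> real" where "pen2 r = flat 3 (r - 1)"

lemma pen_deriv: "(pen has_real_derivative pen1 r) (at r)"
proof -
  have "((\<lambda>r. (r - 1) * flat 0 (r - 1)) has_real_derivative
      (r - 1) * (flat 2 (r - 1) * 1) + 1 * flat 0 (r - 1)) (at r)"
    using flat_deriv[of 0 "r - 1"]
    by (intro DERIV_mult' DERIV_chain2[of "flat 0"]) (auto intro!: derivative_eq_intros simp: eval_nat_numeral)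
  then show ?thesis
    using flat_mult[of "r - 1" 1] by (simp add: pen_def[abs_def] pen1_def eval_nat_numeral add.commute)
qed

lemma pen1_deriv: "(pen1 has_real_derivative pen2 r) (at r)"
proof -
  have "((\<lambda>r. flat 0 (r - 1) + flat 1 (r - 1)) has_real_derivative
      flat 2 (r - 1) * 1 + (flat 3 (r - 1) - flat 2 (r - 1)) * 1) (at r)"
    using flat_deriv[of 0 "r - 1"] flat_deriv[of 1 "r - 1"]
    by (intro DERIV_add DERIV_chain2[of "flat _"]) (auto intro!: derivative_eq_intros simp: eval_nat_numeral)
  then show ?thesis
    by (simp add: pen1_def[abs_def] pen2_def)
qed

lemma pen2_bounds: "0 \<le> pen2 r" "pen2 r \<le> 6" "0 \<le> r * pen2 r" "r * pen2 r \<le> 8"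
proof -
  show "0 \<le> pen2 r" "pen2 r \<le> 6"
    using flat_le[of 3 "r - 1"] by (simp_all add: pen2_def flat_nonneg eval_nat_numeral)
  have "r * pen2 r = flat 2 (r - 1) + flat 3 (r - 1)"
    using flat_mult[of "r - 1" 2] by (simp add: pen2_def algebra_simps eval_nat_numeral)
  then show "0 \<le> r * pen2 r" "r * pen2 r \<le> 8"
    using flat_le[of 3 "r - 1"] flat_le[of 2 "r - 1"] by (simp_all add: flat_nonneg eval_nat_numeral)
qed

lemma pen1_bounds: "0 \<le> pen1 r" "pen1 r \<le> 1"
proof -
  show "0 \<le> pen1 r"
    by (simp add: pen1_def flat_nonneg)
  show "pen1 r \<le> 1"
  proof (cases "r > 1")
    case True
    have "1 + inverse (r - 1) \<le> exp (inverse (r - 1))"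
      by (rule exp_ge_add_one_self)
    then have "exp (- inverse (r - 1)) * (1 + inverse (r - 1)) \<le> exp (- inverse (r - 1)) * exp (inverse (r - 1))"
      by (intro mult_left_mono) auto
    also have "\<dots> = 1"
      by (simp flip: exp_add)
    finally show ?thesis
      using True by (simp add: pen1_def flat_def algebra_simps)
  qed (simp add: pen1_def flat_eq_0)
qed

lemma pen_eq_0: "r \<le> 1 \<Longrightarrow> pen r = 0" and pen1_eq_0: "r \<le> 1 \<Longrightarrow> pen1 r = 0"
  by (simp_all add: pen_def pen1_def flat_eq_0)

lemma pen_pos: "r > 1 \<Longrightarrow> pen r > 0"
  by (simp add: pen_def flat_pos)

lemma pen_nonneg: "pen r \<ge> 0"
  using pen_eq_0[of r] pen_pos[of r] by (cases "r \<le> 1") auto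

lemma pen_le: "pen r \<le> \<bar>r\<bar>"
proof (cases "r > 1")
  case True
  then have "pen r \<le> (r - 1) * 1"
    unfolding pen_def by (intro mult_left_mono flat_0_le_1) auto
  with True show ?thesis by simp
qed (simp add: pen_eq_0)

lemma pen1_mono: "a \<le> b \<Longrightarrow> pen1 a \<le> pen1 b"
  by (rule DERIV_nonneg_imp_nondecreasing) (use pen1_deriv pen2_bounds in blast)+

lemma pen_Lipschitz: "\<bar>pen a - pen b\<bar> \<le> \<bar>a - b\<bar>"
  using field_differentiable_bound[of UNIV pen pen1 1 a b] pen_deriv pen1_bounds
  by (auto simp: has_field_derivative_at_within)

lemma pen_convex: "pen a - pen b \<le> pen1 a * (a - b)"
proof (cases a b rule: linorder_cases)
  case less
  then obtain z where z: "a < z" "z < b" "pen b - pen a = (b - a) * pen1 z"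
    using MVT2[of a b pen pen1] pen_deriv by blast
  have "(b - a) * pen1 a \<le> (b - a) * pen1 z"
    using z less by (intro mult_left_mono pen1_mono) auto
  with z(3) show ?thesis
    by (simp add: algebra_simps)
next
  case greater
  then obtain z where z: "b < z" "z < a" "pen a - pen b = (a - b) * pen1 z"
    using MVT2[of b a pen pen1] pen_deriv by blast
  have "(a - b) * pen1 z \<le> (a - b) * pen1 a"
    using z greater by (intro mult_left_mono pen1_mono) auto
  with z(3) show ?thesis
    by (simp add: algebra_simps)
qed simp

lemma smooth_pen1: "smooth pen1"
  unfolding pen1_def[abs_def]
  by (intro smooth_add smooth_compose[OF smooth_flat] smooth_diff smooth_const smooth_linear bounded_linear_ident)

lemma continuous_pen: "continuous_on UNIV pen" "continuous_on UNIV pen1" "continuous_on UNIV pen2"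
proof -
  show "continuous_on UNIV pen" "continuous_on UNIV pen1"
    using pen_deriv pen1_deriv DERIV_isCont by (blast intro: continuous_at_imp_continuous_on)+
  have "isCont (flat 3) s" for s
    using flat_deriv DERIV_isCont by blast
  then have "continuous_on UNIV (flat 3)"
    by (auto intro: continuous_at_imp_continuous_on)
  then show "continuous_on UNIV pen2"
    unfolding pen2_def[abs_def] by (rule continuous_on_compose2) (auto intro!: continuous_intros)
qed

lemma borel_measurable_pen [measurable]:
  "pen \<in> borel_measurable borel" "pen1 \<in> borel_measurable borel" "pen2 \<in> borel_measurable borel"
  by (auto intro: borel_measurable_continuous_onI continuous_pen)

section \<open>Translations in \<open>L\<^sup>1\<close> and \<open>L\<^sup>2\<close>\<close>

definition L1_translation_continuous :: "('b::euclidean_space \<Rightarrow> 'c::euclidean_space) \<Rightarrow> bool" where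
  "L1_translation_continuous f \<longleftrightarrow>
     (\<forall>e>0. \<exists>d>0. \<forall>y. norm y < d \<longrightarrow> (LBINT z. norm (f (z - y) - f z)) < e)"

lemma integrable_translation_diff:
  fixes f :: "'b::euclidean_space \<Rightarrow> 'c::euclidean_space"
  assumes f: "integrable lborel f"
  shows "integrable lborel (\<lambda>z. f (z - y) - f z)"
  using lborel_translation(1)[of f y] f by auto

lemma L1_translation_continuous_limit:
  fixes f :: "'b::euclidean_space \<Rightarrow> 'c::euclidean_space"
  assumes f: "integrable lborel f" and s: "\<And>i. integrable lborel (s i)" "\<And>i. L1_translation_continuous (s i)"
    and lim: "(\<lambda>i. LBINT z. norm (s i z - f z)) \<longlonglongrightarrow> 0"
  shows "L1_translation_continuous f"
  unfolding L1_translation_continuous_def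
proof (intro allI impI)
  fix e :: real assume e: "e > 0"
  then obtain i where i: "(LBINT z. norm (s i z - f z)) < e / 3"
    using order_tendstoD(2)[OF lim, of "e / 3"] by (auto simp: eventually_sequentially)
  obtain d where d: "d > 0" "\<And>y. norm y < d \<Longrightarrow> (LBINT z. norm (s i (z - y) - s i z)) < e / 3"
    using s(2)[of i] e unfolding L1_translation_continuous_def by (metis divide_pos_pos zero_less_numeral)
  have "(LBINT z. norm (f (z - y) - f z)) < e" if y: "norm y < d" for y
  proof -
    define g where "g z = norm (s i z - f z)" for z
    have g: "integrable lborel g"
      unfolding g_def[abs_def] using f s(1)[of i] by auto
    then have g': "integrable lborel (\<lambda>z. g (z - y))" "(LBINT z. g (z - y)) = (LBINT z. g z)"
      using lborel_translation[of g y] by auto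
    have d2: "integrable lborel (\<lambda>z. norm (s i (z - y) - s i z))"
      using integrable_translation_diff[OF s(1)] by auto
    have "(LBINT z. norm (f (z - y) - f z)) \<le> (LBINT z. g (z - y) + (norm (s i (z - y) - s i z) + g z))"
    proof (rule integral_mono)
      show "norm (f (z - y) - f z) \<le> g (z - y) + (norm (s i (z - y) - s i z) + g z)" for z
      proof -
        have "f (z - y) - f z = - (s i (z - y) - f (z - y)) + ((s i (z - y) - s i z) + (s i z - f z))"
          by simp
        also have "norm \<dots> \<le> norm (- (s i (z - y) - f (z - y))) + norm ((s i (z - y) - s i z) + (s i z - f z))"
          by (rule norm_triangle_ineq)
        also have "\<dots> \<le> norm (s i (z - y) - f (z - y)) + (norm (s i (z - y) - s i z) + norm (s i z - f z))"
          unfolding norm_minus_cancel by (intro add_mono norm_triangle_ineq order_refl)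
        finally show ?thesis
          by (simp add: g_def)
      qed
    qed (use g g' d2 integrable_translation_diff[OF f] in auto)
    also have "\<dots> = (LBINT z. g (z - y)) + ((LBINT z. norm (s i (z - y) - s i z)) + (LBINT z. g z))"
      using g g' d2 by simp
    also have "\<dots> < e / 3 + (e / 3 + e / 3)"
      using g'(2) i d(2)[OF y] unfolding g_def by simp
    finally show ?thesis by simp
  qed
  with d(1) show "\<exists>d>0. \<forall>y. norm y < d \<longrightarrow> (LBINT z. norm (f (z - y) - f z)) < e"
    by blast
qed

text \<open>
  Squeeze \<open>A\<close> between a compact set \<open>C\<close> and an open set \<open>V\<close> with \<open>V - C\<close> small. A small translation moves \<open>C\<close> within
  \<open>V\<close>, so that the indicators of \<open>A\<close> and of its translate differ only on \<open>V - C\<close> and on its translate.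
\<close>

lemma L1_translation_continuous_bounded_set:
  fixes A :: "'b::euclidean_space set" and c :: "'c::euclidean_space"
  assumes A: "A \<in> sets borel" "bounded A"
  shows "L1_translation_continuous (\<lambda>z. indicator A z *\<^sub>R c)"
  unfolding L1_translation_continuous_def
proof (intro allI impI)
  fix e :: real assume e: "e > 0"
  define X where "X = e / (norm c + 1)"
  have "X > 0"
    using e by (simp add: X_def add_nonneg_pos)
  define e' where "e' = X / 4"
  have e': "e' > 0"
    using \<open>X > 0\<close> by (simp add: e'_def)
  have AL: "A \<in> sets lebesgue"
    using A by simp
  obtain C where C: "closed C" "C \<subseteq> A" "emeasure lebesgue (A - C) < ennreal e'"
    by (rule sets_lebesgue_inner_closed[OF AL e'])
  obtain V where V: "open V" "A \<subseteq> V" "emeasure lebesgue (V - A) < ennreal e'"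
    by (rule sets_lebesgue_outer_open[OF AL e'])
  have "compact C"
    using C(1) bounded_subset[OF A(2) C(2)] by (simp add: compact_eq_bounded_closed)
  then obtain d where d: "d > 0" "(\<Union>x\<in>C. ball x d) \<subseteq> V"
    by (rule compact_subset_open_imp_ball_epsilon_subset[of C V]) (use V C in auto)
  have [measurable]: "C \<in> sets borel" "V \<in> sets borel" "A \<in> sets borel"
    using C V A by auto
  have VC: "V - C = (V - A) \<union> (A - C)"
    using C V by auto
  have em: "emeasure lborel (V - C) \<le> emeasure lborel (V - A) + emeasure lborel (A - C)"
    unfolding VC by (rule emeasure_subadditive) auto
  have fin: "emeasure lborel (V - A) < ennreal e'" "emeasure lborel (A - C) < ennreal e'"
    using C V by (simp_all add: emeasure_completion)
  have lt: "emeasure lborel (V - C) < ennreal (2 * e')"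
  proof -
    have "emeasure lborel (V - A) + emeasure lborel (A - C) < ennreal e' + ennreal e'"
      using fin by (rule add_strict_mono)
    then show ?thesis
      using em e' by (simp flip: ennreal_plus)
  qed
  then have finV: "emeasure lborel (V - C) < \<infinity>"
    using less_trans ennreal_less_top by (metis infinity_ennreal_def)
  have meas: "measure lborel (V - C) < 2 * e'"
  proof -
    have "ennreal (measure lborel (V - C)) < ennreal (2 * e')"
      using lt finV by (simp add: emeasure_eq_ennreal_measure)
    then show ?thesis
      by (simp add: ennreal_less_iff)
  qed
  let ?g = "\<lambda>z. indicator (V - C) z :: real"
  have g: "integrable lborel ?g" "(LBINT z. ?g z) = measure lborel (V - C)"
    using finV by (auto intro: integrable_real_indicator)
  have g': "integrable lborel (\<lambda>z. ?g (z - y))" "(LBINT z. ?g (z - y)) = measure lborel (V - C)" for y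
    using lborel_translation[of ?g y] g by auto
  have "(LBINT z. norm (indicator A (z - y) *\<^sub>R c - indicator A z *\<^sub>R c)) < e" if y: "norm y < d" for y
  proof -
    have mv: "z \<in> V" if "z - y \<in> C" for z
    proof -
      have "z \<in> ball (z - y) d"
        using y by (simp add: dist_norm)
      then show ?thesis
        using d(2) that by blast
    qed
    have mv': "z - y \<in> V" if "z \<in> C" for z
    proof -
      have "z - y \<in> ball z d"
        using y by (simp add: dist_norm)
      then show ?thesis
        using d(2) that by blast
    qed
    have intA: "integrable lborel (\<lambda>z. indicator A z *\<^sub>R c)"
      using A emeasure_bounded_finite[of A] by (intro integrable_scaleR_left integrable_real_indicator) auto
    have "(LBINT z. norm (indicator A (z - y) *\<^sub>R c - indicator A z *\<^sub>R c))
        \<le> (LBINT z. (?g (z - y) + ?g z) * norm c)"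
    proof (rule integral_mono)
      show "norm (indicator A (z - y) *\<^sub>R c - indicator A z *\<^sub>R c) \<le> (?g (z - y) + ?g z) * norm c" for z
        using mv[of z] mv'[of z] C(2) V(2) by (auto simp: indicator_def)
      show "integrable lborel (\<lambda>z. norm (indicator A (z - y) *\<^sub>R c - indicator A z *\<^sub>R c))"
        using integrable_translation_diff[OF intA] by auto
    qed (use g g' in auto)
    also have "\<dots> = 2 * measure lborel (V - C) * norm c"
      using g g' by simp
    also have "\<dots> \<le> 2 * (2 * e') * norm c"
      using meas by (intro mult_right_mono mult_left_mono) auto
    also have "\<dots> = X * norm c"
      by (simp add: e'_def)
    also have "\<dots> = e * (norm c / (norm c + 1))"
      by (simp add: X_def)
    also have "\<dots> < e * 1"
      using e by (intro mult_strict_left_mono) (auto simp: divide_less_eq add_nonneg_pos)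
    also have "\<dots> = e"
      by simp
    finally show ?thesis .
  qed
  with d(1) show "\<exists>d>0. \<forall>y. norm y < d \<longrightarrow> (LBINT z. norm (indicator A (z - y) *\<^sub>R c - indicator A z *\<^sub>R c)) < e"
    by blast
qed

theorem integrable_imp_L1_translation_continuous:
  fixes f :: "'b::euclidean_space \<Rightarrow> 'c::euclidean_space"
  assumes "integrable lborel f"
  shows "L1_translation_continuous f"
  using assms
proof (induction rule: integrable_induct)
  case (base A c)
  then have [measurable]: "A \<in> sets borel"
    by simp
  show ?case
  proof (rule L1_translation_continuous_limit[where s = "\<lambda>i z. indicator (A \<inter> cball 0 (real i)) z *\<^sub>R c"])
    show int: "integrable lborel (\<lambda>z. indicator A z *\<^sub>R c)"
      using base by (intro integrable_scaleR_left integrable_real_indicator) auto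
    show "integrable lborel (\<lambda>z. indicator (A \<inter> cball 0 (real i)) z *\<^sub>R c)" for i
      using base by (intro integrable_scaleR_left integrable_real_indicator)
        (auto intro: le_less_trans[OF emeasure_mono])
    show "L1_translation_continuous (\<lambda>z. indicator (A \<inter> cball 0 (real i)) z *\<^sub>R c)" for i
      by (rule L1_translation_continuous_bounded_set) auto
    have "(\<lambda>i. LBINT z. norm (indicator (A \<inter> cball 0 (real i)) z *\<^sub>R c - indicator A z *\<^sub>R c))
        \<longlonglongrightarrow> (LINT z|(lborel :: 'b measure). 0)"
    proof (rule integral_dominated_convergence[where w = "\<lambda>z. norm (indicator A z *\<^sub>R c)"])
      show "AE z in lborel. (\<lambda>i. norm (indicator (A \<inter> cball 0 (real i)) z *\<^sub>R c - indicator A z *\<^sub>R c)) \<longlonglongrightarrow> 0"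
      proof (intro AE_I2 tendsto_eventually)
        fix z :: 'b
        have "eventually (\<lambda>i. norm z \<le> real i) sequentially"
          using filterlim_real_sequentially by (auto simp: filterlim_at_top)
        then show "eventually (\<lambda>i. norm (indicator (A \<inter> cball 0 (real i)) z *\<^sub>R c - indicator A z *\<^sub>R c) = 0) sequentially"
          by eventually_elim (auto simp: indicator_def)
      qed
      show "AE z in lborel. norm (norm (indicator (A \<inter> cball 0 (real i)) z *\<^sub>R c - indicator A z *\<^sub>R c))
          \<le> norm (indicator A z *\<^sub>R c)" for i
        by (auto simp: indicator_def)
      show "integrable lborel (\<lambda>z. norm (indicator A z *\<^sub>R c))"
        by (rule integrable_norm[OF int])
      show "(\<lambda>z. norm (indicator (A \<inter> cball 0 (real i)) z *\<^sub>R c - indicator A z *\<^sub>R c)) \<in> borel_measurable lborel" for i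
      proof -
        have [measurable]: "A \<inter> cball 0 (real i) \<in> sets borel"
          by auto
        show ?thesis by measurable
      qed
    qed simp
    then show "(\<lambda>i. LBINT z. norm (indicator (A \<inter> cball 0 (real i)) z *\<^sub>R c - indicator A z *\<^sub>R c)) \<longlonglongrightarrow> 0"
      by simp
  qed
next
  case (add f g)
  show ?case
    unfolding L1_translation_continuous_def
  proof (intro allI impI)
    fix e :: real assume "e > 0"
    then have e2: "e / 2 > 0" by simp
    obtain d1 where d1: "d1 > 0" "\<And>y. norm y < d1 \<Longrightarrow> (LBINT z. norm (f (z - y) - f z)) < e / 2"
      using add(3) e2 unfolding L1_translation_continuous_def by metis
    obtain d2 where d2: "d2 > 0" "\<And>y. norm y < d2 \<Longrightarrow> (LBINT z. norm (g (z - y) - g z)) < e / 2"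
      using add(4) e2 unfolding L1_translation_continuous_def by metis
    have "(LBINT z. norm (f (z - y) + g (z - y) - (f z + g z))) < e" if y: "norm y < min d1 d2" for y
    proof -
      note fd = integrable_translation_diff[OF add(1), of y] and gd = integrable_translation_diff[OF add(2), of y]
      have "(LBINT z. norm (f (z - y) + g (z - y) - (f z + g z)))
          \<le> (LBINT z. norm (f (z - y) - f z) + norm (g (z - y) - g z))"
      proof (rule integral_mono)
        show "norm (f (z - y) + g (z - y) - (f z + g z)) \<le> norm (f (z - y) - f z) + norm (g (z - y) - g z)" for z
          by (simp add: add_diff_add norm_triangle_ineq)
        show "integrable lborel (\<lambda>z. norm (f (z - y) + g (z - y) - (f z + g z)))"
          using integrable_norm[OF Bochner_Integration.integrable_add[OF fd gd]] by (simp add: add_diff_add)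
      qed (use fd gd in auto)
      also have "\<dots> = (LBINT z. norm (f (z - y) - f z)) + (LBINT z. norm (g (z - y) - g z))"
        using fd gd by simp
      also have "\<dots> < e / 2 + e / 2"
        using d1(2)[of y] d2(2)[of y] y by (intro add_strict_mono) auto
      finally show ?thesis by simp
    qed
    then show "\<exists>d>0. \<forall>y. norm y < d \<longrightarrow> (LBINT z. norm (f (z - y) + g (z - y) - (f z + g z))) < e"
      using d1(1) d2(1) by (intro exI[of _ "min d1 d2"]) auto
  qed
next
  case (lim f s)
  show ?case
  proof (rule L1_translation_continuous_limit[OF lim(4,1,5)])
    have [measurable]: "f \<in> borel_measurable borel" "s i \<in> borel_measurable borel" for i
      using lim(4) lim(1)[of i] by auto
    have "(\<lambda>i. LBINT z. norm (s i z - f z)) \<longlonglongrightarrow> (LINT z|(lborel :: 'b measure). 0)"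
    proof (rule integral_dominated_convergence[where w = "\<lambda>z. 3 * norm (f z)"])
      show "AE z in lborel. (\<lambda>i. norm (s i z - f z)) \<longlonglongrightarrow> 0"
        using lim(2) by (intro AE_I2) (auto intro!: tendsto_norm_zero simp: LIM_zero)
      show "AE z in lborel. norm (norm (s i z - f z)) \<le> 3 * norm (f z)" for i
      proof (intro AE_I2)
        fix z
        have "norm (s i z - f z) \<le> norm (s i z) + norm (f z)"
          by (rule norm_triangle_ineq4)
        then show "norm (norm (s i z - f z)) \<le> 3 * norm (f z)"
          using lim(3)[of z i] by simp
      qed
    qed (use lim(4) in auto)
    then show "(\<lambda>i. LBINT z. norm (s i z - f z)) \<longlonglongrightarrow> 0"
      by simp
  qed
qed

text \<open>
  Pairing with a bounded function only needs continuity of translations in \<open>L\<^sup>1\<close>.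
\<close>

lemma translation_pairing_bounded:
  fixes f k :: "'b::euclidean_space \<Rightarrow> 'c::euclidean_space"
  assumes f: "integrable lborel f" and k: "k \<in> borel_measurable borel" "\<And>z. norm (k z) \<le> C"
  shows "((\<lambda>y. LBINT z. k z \<bullet> f (z - y)) \<longlongrightarrow> (LBINT z. k z \<bullet> f z)) (at 0)"
proof (rule tendstoI)
  fix e :: real assume e: "e > 0"
  have C: "C \<ge> 0"
    using k(2)[of 0] norm_ge_zero order_trans by blast
  have [measurable]: "f \<in> borel_measurable borel"
    using f by auto
  have int: "integrable lborel (\<lambda>z. k z \<bullet> h z)" if h: "integrable lborel h" for h :: "'b \<Rightarrow> 'c"
  proof (rule Bochner_Integration.integrable_bound)
    show "integrable lborel (\<lambda>z. C * norm (h z))"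
      using h by simp
    show "AE z in lborel. norm (k z \<bullet> h z) \<le> norm (C * norm (h z))"
    proof (intro AE_I2)
      fix z
      have "\<bar>k z \<bullet> h z\<bar> \<le> norm (k z) * norm (h z)"
        by (rule Cauchy_Schwarz_ineq2)
      also have "\<dots> \<le> C * norm (h z)"
        using k(2) by (rule mult_right_mono) simp
      finally show "norm (k z \<bullet> h z) \<le> norm (C * norm (h z))"
        using C by (simp add: abs_mult)
    qed
  qed (use k h in auto)
  obtain d where d: "d > 0" "\<And>y. norm y < d \<Longrightarrow> (LBINT z. norm (f (z - y) - f z)) < e / (C + 1)"
    using integrable_imp_L1_translation_continuous[OF f] e C unfolding L1_translation_continuous_def
    by (metis add_nonneg_pos divide_pos_pos zero_less_one)
  have "dist (LBINT z. k z \<bullet> f (z - y)) (LBINT z. k z \<bullet> f z) < e" if y: "norm y < d" for y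
  proof -
    have fy: "integrable lborel (\<lambda>z. f (z - y))"
      using lborel_translation(1)[of f y] f by simp
    note fd = integrable_translation_diff[OF f, of y]
    have "(LBINT z. k z \<bullet> f (z - y)) - (LBINT z. k z \<bullet> f z) = (LBINT z. k z \<bullet> (f (z - y) - f z))"
      using int[OF fy] int[OF f] by (simp add: inner_diff_right)
    also have "norm \<dots> \<le> (LBINT z. norm (k z \<bullet> (f (z - y) - f z)))"
      by (rule integral_norm_bound)
    also have "\<dots> \<le> (LBINT z. C * norm (f (z - y) - f z))"
    proof (rule integral_mono)
      show "norm (k z \<bullet> (f (z - y) - f z)) \<le> C * norm (f (z - y) - f z)" for z
        using Cauchy_Schwarz_ineq2[of "k z" "f (z - y) - f z"] mult_right_mono[OF k(2)[of z], of "norm (f (z - y) - f z)"]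
        by simp
    qed (use fd int[OF fd] in auto)
    also have "\<dots> \<le> C * (e / (C + 1))"
      unfolding integral_mult_right_zero by (rule mult_left_mono[OF less_imp_le[OF d(2)[OF y]] C])
    also have "\<dots> < e"
      using e C by (simp add: field_simps)
    finally show ?thesis
      by (simp add: dist_norm)
  qed
  then show "eventually (\<lambda>y. dist (LBINT z. k z \<bullet> f (z - y)) (LBINT z. k z \<bullet> f z) < e) (at 0)"
    using d(1) by (auto simp: eventually_at intro!: exI[of _ d])
qed

lemma L2_translation:
  fixes f :: "'b::euclidean_space \<Rightarrow> 'c::euclidean_space"
  assumes "L2 lborel f"
  shows "L2 lborel (\<lambda>z. f (z - y))" "(LBINT z. (norm (f (z - y)))\<^sup>2) = (LBINT z. (norm (f z))\<^sup>2)"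
proof -
  have [measurable]: "f \<in> borel_measurable borel"
    using assms by (simp add: L2_def)
  show "L2 lborel (\<lambda>z. f (z - y))" "(LBINT z. (norm (f (z - y)))\<^sup>2) = (LBINT z. (norm (f z))\<^sup>2)"
    using lborel_translation[of "\<lambda>z. (norm (f z))\<^sup>2" y] assms by (auto simp: L2_def)
qed

text \<open>
  Truncating \<open>g\<close> reduces the claim to a bounded factor. The error is small uniformly in \<open>y\<close> because translations preserve
  the \<open>L\<^sup>2\<close> norm of \<open>f\<close>.
\<close>

theorem translation_pairing_L2:
  fixes f g :: "'b::euclidean_space \<Rightarrow> 'c::euclidean_space"
  assumes f: "integrable lborel f" "L2 lborel f" and g: "L2 lborel g"
  shows "((\<lambda>y. LBINT z. g z \<bullet> f (z - y)) \<longlongrightarrow> (LBINT z. g z \<bullet> f z)) (at 0)"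
proof (rule tendstoI)
  fix e :: real assume e: "e > 0"
  have [measurable]: "g \<in> borel_measurable borel"
    using g by (simp add: L2_def)
  define m where "m k z = (indicator {z. norm (g z) \<le> real k} z :: real)" for k :: nat and z
  have [measurable]: "m k \<in> borel_measurable borel" for k
    unfolding m_def[abs_def] by measurable
  have m_lim: "(\<lambda>k. m k z) \<longlonglongrightarrow> 1" for z
  proof (rule tendsto_eventually)
    have "eventually (\<lambda>k. norm (g z) \<le> real k) sequentially"
      using filterlim_real_sequentially by (auto simp: filterlim_at_top)
    then show "eventually (\<lambda>k. m k z = 1) sequentially"
      by eventually_elim (simp add: m_def)
  qed
  have "L2_lim lborel (\<lambda>k z. m k z *\<^sub>R g z) (\<lambda>z. 1 *\<^sub>R g z)"
    by (rule L2_lim_dominated[OF g, where C = 1]) (auto simp: m_lim, simp add: m_def indicator_def)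
  then have gk: "L2 lborel (\<lambda>z. m k z *\<^sub>R g z)" and glim: "(\<lambda>k. LBINT z. (norm (m k z *\<^sub>R g z - g z))\<^sup>2) \<longlonglongrightarrow> 0" for k
    by (auto simp: L2_lim_def)
  define N where "N = sqrt (LBINT z. (norm (f z))\<^sup>2)"
  have "(\<lambda>k. sqrt (LBINT z. (norm (m k z *\<^sub>R g z - g z))\<^sup>2) * N) \<longlonglongrightarrow> 0"
    using tendsto_mult_right[OF tendsto_real_sqrt[OF glim], of N] by simp
  from order_tendstoD(2)[OF this, of "e / 3"] e
  obtain k where k: "sqrt (LBINT z. (norm (m k z *\<^sub>R g z - g z))\<^sup>2) * N < e / 3"
    by (auto simp: eventually_sequentially)
  define G where "G z = m k z *\<^sub>R g z" for z
  have G: "L2 lborel G"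
    using gk by (simp add: G_def[abs_def])
  have Gg: "L2 lborel (\<lambda>z. G z - g z)"
    using G g by (rule L2_diff)
  have close: "\<bar>(LBINT z. G z \<bullet> f (z - y)) - (LBINT z. g z \<bullet> f (z - y))\<bar> < e / 3" for y
  proof -
    note fy = L2_translation[OF f(2), of y]
    have "(LBINT z. G z \<bullet> f (z - y)) - (LBINT z. g z \<bullet> f (z - y)) = (LBINT z. (G z - g z) \<bullet> f (z - y))"
      using L2_inner_integrable[OF G fy(1)] L2_inner_integrable[OF g fy(1)] by (simp add: inner_diff_left)
    also have "\<bar>\<dots>\<bar> \<le> (LBINT z. norm ((G z - g z) \<bullet> f (z - y)))"
      using integral_norm_bound[of lborel "\<lambda>z. (G z - g z) \<bullet> f (z - y)"] by simp
    also have "\<dots> \<le> (LBINT z. norm (G z - g z) * norm (f (z - y)))"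
      by (intro integral_mono integrable_norm L2_inner_integrable[OF Gg fy(1)] L2_norm_mult_integrable[OF Gg fy(1)])
        (simp add: Cauchy_Schwarz_ineq2)
    also have "\<dots> \<le> sqrt (LBINT z. (norm (G z - g z))\<^sup>2) * N"
      using L2_Cauchy_Schwarz[OF Gg fy(1)] by (simp add: N_def fy(2))
    finally show ?thesis
      using k by (simp add: G_def)
  qed
  have "((\<lambda>y. LBINT z. G z \<bullet> f (z - y)) \<longlongrightarrow> (LBINT z. G z \<bullet> f z)) (at 0)"
  proof (rule translation_pairing_bounded[OF f(1), where C = "real k"])
    show "norm (G z) \<le> real k" for z
      by (simp add: G_def m_def indicator_def)
    show "G \<in> borel_measurable borel"
      unfolding G_def[abs_def] by measurable
  qed
  from tendstoD[OF this, of "e / 3"] e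
  have "eventually (\<lambda>y. dist (LBINT z. G z \<bullet> f (z - y)) (LBINT z. G z \<bullet> f z) < e / 3) (at 0)"
    by simp
  then show "eventually (\<lambda>y. dist (LBINT z. g z \<bullet> f (z - y)) (LBINT z. g z \<bullet> f z) < e) (at 0)"
  proof eventually_elim
    case (elim y)
    have "\<bar>(LBINT z. G z \<bullet> f z) - (LBINT z. g z \<bullet> f z)\<bar> < e / 3"
      using close[of 0] by simp
    then show ?case
      using elim close[of y] unfolding dist_real_def by arith
  qed
qed

section \<open>Functions on cylinders\<close>

lemma borel_measurable_fst_snd [measurable]:
  "(fst :: 'a::euclidean_space \<times> 'b::euclidean_space \<Rightarrow> 'a) \<in> borel_measurable borel"
  "(snd :: 'a \<times> 'b \<Rightarrow> 'b) \<in> borel_measurable borel"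
  by (auto intro!: borel_measurable_continuous_onI continuous_intros)

lemma cylinder_integral:
  fixes f :: "'a::euclidean_space \<Rightarrow> real"
  assumes \<Omega>: "\<Omega> \<in> sets borel" and f: "f \<in> borel_measurable borel" "integrable (lebesgue_on \<Omega>) f" and h: "h \<ge> 0"
  shows "integrable lborel (\<lambda>z::real \<times> 'a. indicator {0<..<h} (fst z) * indicator \<Omega> (snd z) * f (snd z))"
    "(LBINT z. indicator {0<..<h} (fst z) * indicator \<Omega> (snd z) * f (snd z :: 'a)) = h * (LINT x|lebesgue_on \<Omega>. f x)"
proof -
  have [measurable]: "f \<in> borel_measurable borel" "\<Omega> \<in> sets borel"
    using f \<Omega> by auto
  have i: "integrable lborel (\<lambda>x. indicator \<Omega> x * f x)"
    and e: "(LINT x|lebesgue_on \<Omega>. f x) = (LBINT x. indicator \<Omega> x * f x)"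
    using integral_lebesgue_on_borel[OF \<Omega> f(1)] f(2) by auto
  have int: "integrable (lborel \<Otimes>\<^sub>M lborel) (\<lambda>(s::real, x). indicator {0<..<h} s * (indicator \<Omega> x * f x))"
  proof (rule lborel_pair.Fubini_integrable)
    show "AE s in lborel. integrable lborel (\<lambda>x. case (s::real, x) of (s, x) \<Rightarrow> indicator {0<..<h} s * (indicator \<Omega> x * f x))"
      using i by auto
    show "integrable lborel (\<lambda>s::real. LBINT x. norm (case (s, x) of (s, x) \<Rightarrow> indicator {0<..<h} s * (indicator \<Omega> x * f x)))"
      using h by (simp add: abs_mult integrable_mult_left)
  qed measurable
  then show "integrable lborel (\<lambda>z::real \<times> 'a. indicator {0<..<h} (fst z) * indicator \<Omega> (snd z) * f (snd z))"
    unfolding lborel_prod by (simp add: case_prod_unfold mult.assoc)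
  have "(LBINT z. indicator {0<..<h} (fst z) * indicator \<Omega> (snd z) * f (snd z :: 'a))
      = (LINT z|(lborel \<Otimes>\<^sub>M lborel). (\<lambda>(s::real, x). indicator {0<..<h} s * (indicator \<Omega> x * f x)) z)"
    unfolding lborel_prod by (simp add: case_prod_unfold mult.assoc)
  also have "\<dots> = (LBINT s. LBINT x. indicator {0<..<h} (s::real) * (indicator \<Omega> x * f x))"
    by (rule lborel_pair.integral_fst[OF int, symmetric])
  also have "\<dots> = h * (LINT x|lebesgue_on \<Omega>. f x)"
    using h by (simp add: e)
  finally show "(LBINT z. indicator {0<..<h} (fst z) * indicator \<Omega> (snd z) * f (snd z :: 'a)) = h * (LINT x|lebesgue_on \<Omega>. f x)" .
qed

lemma cylinder_L2:
  fixes V :: "'a::euclidean_space \<Rightarrow> 'b::euclidean_space"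
  assumes \<Omega>: "\<Omega> \<in> sets borel" and V: "L2 (lebesgue_on \<Omega>) V" "V \<in> borel_measurable borel" and h: "h \<ge> 0"
  shows "L2 lborel (\<lambda>z::real \<times> 'a. (indicator {0<..<h} (fst z) * indicator \<Omega> (snd z)) *\<^sub>R V (snd z))"
    "(LBINT z. (norm ((indicator {0<..<h} (fst (z::real \<times> 'a)) * indicator \<Omega> (snd z)) *\<^sub>R V (snd z)))\<^sup>2)
      = h * (LINT x|lebesgue_on \<Omega>. (norm (V x))\<^sup>2)"
proof -
  have [measurable]: "V \<in> borel_measurable borel" "\<Omega> \<in> sets borel"
    using V \<Omega> by auto
  have eq: "(norm ((indicator {0<..<h} (fst z) * indicator \<Omega> (snd z)) *\<^sub>R V (snd z)))\<^sup>2
      = indicator {0<..<h} (fst z) * indicator \<Omega> (snd z) * (norm (V (snd z)))\<^sup>2" for z :: "real \<times> 'a"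
    by (auto simp: indicator_def)
  note c = cylinder_integral[OF \<Omega>, of "\<lambda>x. (norm (V x))\<^sup>2", OF _ _ h]
  show "L2 lborel (\<lambda>z::real \<times> 'a. (indicator {0<..<h} (fst z) * indicator \<Omega> (snd z)) *\<^sub>R V (snd z))"
    unfolding L2_def eq using c(1) V(1) by (auto simp: L2_def)
  show "(LBINT z. (norm ((indicator {0<..<h} (fst (z::real \<times> 'a)) * indicator \<Omega> (snd z)) *\<^sub>R V (snd z)))\<^sup>2)
      = h * (LINT x|lebesgue_on \<Omega>. (norm (V x))\<^sup>2)"
    unfolding eq using c(2) V(1) by (auto simp: L2_def)
qed

lemma cylinder_L2_lim:
  fixes V :: "'a::euclidean_space \<Rightarrow> 'b::euclidean_space"
  assumes \<Omega>: "\<Omega> \<in> sets borel" and lim: "L2_lim (lebesgue_on \<Omega>) W V" and h: "h \<ge> 0"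
    and m: "V \<in> borel_measurable borel" "\<And>k. W k \<in> borel_measurable borel"
  shows "L2_lim lborel (\<lambda>k z::real \<times> 'a. (indicator {0<..<h} (fst z) * indicator \<Omega> (snd z)) *\<^sub>R W k (snd z))
    (\<lambda>z. (indicator {0<..<h} (fst z) * indicator \<Omega> (snd z)) *\<^sub>R V (snd z))"
  unfolding L2_lim_def
proof (intro conjI allI)
  have W: "L2 (lebesgue_on \<Omega>) (W k)" and V: "L2 (lebesgue_on \<Omega>) V"
    and l: "(\<lambda>k. LINT x|lebesgue_on \<Omega>. (norm (W k x - V x))\<^sup>2) \<longlonglongrightarrow> 0" for k
    using lim by (auto simp: L2_lim_def)
  show "L2 lborel (\<lambda>z::real \<times> 'a. (indicator {0<..<h} (fst z) * indicator \<Omega> (snd z)) *\<^sub>R W k (snd z))" for k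
    by (rule cylinder_L2[OF \<Omega> W m(2) h])
  show "L2 lborel (\<lambda>z::real \<times> 'a. (indicator {0<..<h} (fst z) * indicator \<Omega> (snd z)) *\<^sub>R V (snd z))"
    by (rule cylinder_L2[OF \<Omega> V m(1) h])
  have "(LBINT z. (norm ((indicator {0<..<h} (fst (z::real \<times> 'a)) * indicator \<Omega> (snd z)) *\<^sub>R W k (snd z)
        - (indicator {0<..<h} (fst z) * indicator \<Omega> (snd z)) *\<^sub>R V (snd z)))\<^sup>2)
      = h * (LINT x|lebesgue_on \<Omega>. (norm (W k x - V x))\<^sup>2)" for k
    using cylinder_L2(2)[OF \<Omega> L2_diff[OF W V] _ h] m by (simp flip: scaleR_diff_right)
  then show "(\<lambda>k. LBINT z. (norm ((indicator {0<..<h} (fst (z::real \<times> 'a)) * indicator \<Omega> (snd z)) *\<^sub>R W k (snd z)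
        - (indicator {0<..<h} (fst z) * indicator \<Omega> (snd z)) *\<^sub>R V (snd z)))\<^sup>2) \<longlonglongrightarrow> 0"
    using tendsto_mult_right_zero[OF l, of h] by simp
qed

text \<open>
  Passage to the limit in \<open>D h / h + (1/h) \<integral>\<^sub>0\<^sup>h J \<le> 0\<close>.
\<close>

lemma average_tendsto_le:
  fixes J D :: "real \<Rightarrow> real"
  assumes J: "\<And>h. h > 0 \<Longrightarrow> integrable lborel (\<lambda>\<sigma>. indicator {0<..<h} \<sigma> * J \<sigma>)" "(J \<longlongrightarrow> J0) (at_right 0)"
    and h: "\<And>n. h n > 0" "h \<longlonglongrightarrow> 0" and D: "(\<lambda>n. D (h n) / h n) \<longlonglongrightarrow> d"
    and le: "\<And>n. D (h n) + (LBINT \<sigma>. indicator {0<..<h n} \<sigma> * J \<sigma>) \<le> 0"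
  shows "d + J0 \<le> 0"
proof -
  have "d \<le> - J0 + e" if e: "e > 0" for e
  proof -
    have "eventually (\<lambda>\<sigma>. J0 - e < J \<sigma>) (at_right 0)"
      using order_tendstoD(1)[OF J(2), of "J0 - e"] e by simp
    then obtain b where b: "b > 0" "\<And>\<sigma>. 0 < \<sigma> \<Longrightarrow> \<sigma> < b \<Longrightarrow> J0 - e < J \<sigma>"
      by (auto simp: eventually_at_right_field)
    have "eventually (\<lambda>n. h n < b) sequentially"
      using order_tendstoD(2)[OF h(2) b(1)] .
    then have "eventually (\<lambda>n. D (h n) / h n \<le> - J0 + e) sequentially"
    proof eventually_elim
      case (elim n)
      have "(LBINT \<sigma>. indicator {0<..<h n} \<sigma> * (J0 - e)) \<le> (LBINT \<sigma>. indicator {0<..<h n} \<sigma> * J \<sigma>)"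
      proof (rule integral_mono[OF _ J(1)[OF h(1)]])
        show "integrable lborel (\<lambda>\<sigma>. indicator {0<..<h n} \<sigma> * (J0 - e))"
          using h(1)[of n] by (intro integrable_mult_left integrable_real_indicator) auto
        show "indicator {0<..<h n} \<sigma> * (J0 - e) \<le> indicator {0<..<h n} \<sigma> * J \<sigma>" for \<sigma>
          using b(2)[of \<sigma>] elim by (auto simp: indicator_def less_imp_le)
      qed
      then have "D (h n) \<le> h n * (- J0 + e)"
        using le[of n] h(1)[of n] by (simp add: algebra_simps less_imp_le)
      then show ?case
        using h(1)[of n] by (simp add: field_simps)
    qed
    with D show ?thesis
      by (intro tendsto_upperbound[OF D]) auto
  qed
  then have "d \<le> - J0"
    by (rule field_le_epsilon)
  then show ?thesis by simp
qed

section \<open>Borel data of a solution\<close>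

lemma measurable_lborel_prod:
  fixes f :: "'a::euclidean_space \<times> 'b::euclidean_space \<Rightarrow> 'c::topological_space"
  shows "f \<in> borel_measurable borel \<Longrightarrow> f \<in> borel_measurable (lborel \<Otimes>\<^sub>M lborel)"
  by (simp add: lborel_prod)

text \<open>
  Reversal of time about \<open>t\<close>: it parametrises the past of \<open>t\<close> by the elapsed time \<open>fst y\<close>.
\<close>

lemma reflected_integrable:
  fixes f :: "real \<times> 'a::euclidean_space \<Rightarrow> 'b::euclidean_space"
  assumes f: "integrable lborel f"
  shows "integrable lborel (\<lambda>y. f (t - fst y, snd y))"
proof -
  have [measurable]: "f \<in> borel_measurable borel"
    using f by auto
  have "(\<integral>\<^sup>+y. ennreal (norm (f (t - fst y, snd y))) \<partial>lborel) = (\<integral>\<^sup>+x. \<integral>\<^sup>+s. ennreal (norm (f (t - s, x))) \<partial>lborel \<partial>lborel)"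
    unfolding lborel_prod[symmetric] by (subst lborel_pair.nn_integral_snd[symmetric]) (auto intro!: measurable_lborel_prod simp: case_prod_unfold)
  also have "\<dots> = (\<integral>\<^sup>+x. \<integral>\<^sup>+s. ennreal (norm (f (s, x))) \<partial>lborel \<partial>lborel)"
  proof (rule nn_integral_cong)
    fix x :: 'a
    show "(\<integral>\<^sup>+s. ennreal (norm (f (t - s, x))) \<partial>lborel) = (\<integral>\<^sup>+s. ennreal (norm (f (s, x))) \<partial>lborel)"
      using nn_integral_real_affine[of "\<lambda>s. ennreal (norm (f (s, x)))" "-1" t] by simp
  qed
  also have "\<dots> = (\<integral>\<^sup>+y. ennreal (norm (f y)) \<partial>lborel)"
    unfolding lborel_prod[symmetric] by (subst lborel_pair.nn_integral_snd[symmetric]) (auto intro!: measurable_lborel_prod simp: case_prod_unfold)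
  also have "\<dots> < \<infinity>"
    using f by (simp add: integrable_iff_bounded)
  finally show ?thesis
    by (intro integrableI_bounded) auto
qed

lemma reflected_L2:
  fixes f :: "real \<times> 'a::euclidean_space \<Rightarrow> 'b::euclidean_space"
  assumes f: "L2 lborel f"
  shows "L2 lborel (\<lambda>y. f (t - fst y, snd y))"
proof -
  have [measurable]: "f \<in> borel_measurable borel"
    using f by (simp add: L2_def)
  show ?thesis
    using reflected_integrable[of "\<lambda>z. (norm (f z))\<^sup>2" t] f by (simp add: L2_def)
qed

text \<open>
  The terms without derivatives pair \<open>\<eta>\<close> with functions that are merely integrable. They pass to the limit by dominated
  convergence, using the uniform bound on \<open>\<eta>\<^sub>k\<close>; the gradient term uses convergence in \<open>L\<^sup>2\<close>.
\<close>

lemma weak_identity_extends: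
  fixes \<Omega> :: "'a::euclidean_space set" and \<GG> :: "real \<times> 'a \<Rightarrow> 'a" and \<gg> :: "real \<times> 'a \<Rightarrow> real"
  assumes \<Omega>: "open \<Omega>" "bounded \<Omega>" and h: "h \<ge> 0"
    and k: "integrable (lebesgue_on \<Omega>) k" and \<GG>: "L2 lborel \<GG>" "\<And>y. snd y \<notin> \<Omega> \<Longrightarrow> \<GG> y = 0"
    and \<gg>: "integrable lborel \<gg>" "\<And>y. snd y \<notin> \<Omega> \<Longrightarrow> \<gg> y = 0"
    and eq: "\<And>\<eta>. \<eta> \<in> test_functions \<Omega> \<Longrightarrow> (LINT x|lebesgue_on \<Omega>. k x * \<eta> x)
       + (LBINT y. indicator {0<..<h} (fst y) * (\<GG> y \<bullet> grad \<eta> (snd y) + \<gg> y * \<eta> (snd y))) = 0"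
    and \<eta>: "\<And>k. \<eta> k \<in> test_functions \<Omega>" "L2_lim (lebesgue_on \<Omega>) (\<lambda>k. grad (\<eta> k)) V"
      "AE x in lebesgue_on \<Omega>. (\<lambda>k. \<eta> k x) \<longlonglongrightarrow> v x"
      "\<And>k x. x \<in> \<Omega> \<Longrightarrow> \<bar>\<eta> k x\<bar> \<le> S"
    and v: "v \<in> borel_measurable borel" "V \<in> borel_measurable borel"
  shows "integrable lborel (\<lambda>y. indicator {0<..<h} (fst y) * (\<GG> y \<bullet> V (snd y) + \<gg> y * v (snd y)))"
    "(LINT x|lebesgue_on \<Omega>. k x * v x)
       + (LBINT y. indicator {0<..<h} (fst y) * (\<GG> y \<bullet> V (snd y) + \<gg> y * v (snd y))) = 0"
proof -
  let ?D = "lebesgue_on \<Omega>"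
  have [measurable]: "\<Omega> \<in> sets borel"
    using \<Omega> by simp
  have [measurable]: "v \<in> borel_measurable borel" "V \<in> borel_measurable borel"
    "\<eta> j \<in> borel_measurable borel" "grad (\<eta> j) \<in> borel_measurable borel"
    "\<GG> \<in> borel_measurable borel" "\<gg> \<in> borel_measurable borel" for j
    using v \<GG> \<gg> borel_measurable_smooth[OF test_functions_smooth[OF \<eta>(1)]]
      borel_measurable_grad[OF test_functions_smooth[OF \<eta>(1)]] by (auto simp: L2_def)
  have kD: "k \<in> borel_measurable ?D" "v \<in> borel_measurable ?D" "\<eta> j \<in> borel_measurable ?D" for j
    using k by (auto intro: measurable_lebesgue_on)
  note kD[measurable]
  let ?i = "\<lambda>y::real \<times> 'a. indicator {0<..<h} (fst y) :: real"
  have lim1: "(\<lambda>j. LINT x|?D. k x * \<eta> j x) \<longlonglongrightarrow> (LINT x|?D. k x * v x)"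
  proof (rule integral_dominated_convergence[where w = "\<lambda>x. \<bar>k x\<bar> * S"])
    show "AE x in ?D. norm (k x * \<eta> j x) \<le> \<bar>k x\<bar> * S" for j
      using \<eta>(4) by (intro AE_I2) (auto simp: abs_mult mult_left_mono)
    show "AE x in ?D. (\<lambda>j. k x * \<eta> j x) \<longlonglongrightarrow> k x * v x"
      using \<eta>(3) by eventually_elim (intro tendsto_intros)
  qed (use k in auto)
  have ind_inner: "(indicator {0<..<h} (fst y) * indicator \<Omega> (snd y)) *\<^sub>R W \<bullet> \<GG> y = ?i y * (\<GG> y \<bullet> W)" for y W
    using \<GG>(2)[of y] by (auto simp: indicator_def inner_commute)
  have L: "L2_lim lborel (\<lambda>j y::real \<times> 'a. (indicator {0<..<h} (fst y) * indicator \<Omega> (snd y)) *\<^sub>R grad (\<eta> j) (snd y))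
      (\<lambda>y. (indicator {0<..<h} (fst y) * indicator \<Omega> (snd y)) *\<^sub>R V (snd y))"
    by (rule cylinder_L2_lim[OF _ \<eta>(2) h]) auto
  have lim2: "(\<lambda>j. LBINT y. ?i y * (\<GG> y \<bullet> grad (\<eta> j) (snd y))) \<longlonglongrightarrow> (LBINT y. ?i y * (\<GG> y \<bullet> V (snd y)))"
    using L2_lim_inner[OF L \<GG>(1)] by (simp only: ind_inner)
  have int2: "integrable lborel (\<lambda>y. ?i y * (\<GG> y \<bullet> V (snd y)))"
    "integrable lborel (\<lambda>y. ?i y * (\<GG> y \<bullet> grad (\<eta> j) (snd y)))" for j
    using L2_inner_integrable[of lborel _ \<GG>, OF _ \<GG>(1)] L unfolding L2_lim_def by (simp_all only: ind_inner flip: ind_inner)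
  have vS: "AE x in ?D. \<bar>v x\<bar> \<le> S"
    using \<eta>(3) AE_space
  proof eventually_elim
    case (elim x)
    then show ?case
      using \<eta>(4)[of x] by (intro LIMSEQ_le_const2[OF tendsto_rabs[OF elim(1)]]) auto
  qed
  then have vS': "AE x in lborel. x \<in> \<Omega> \<longrightarrow> \<bar>v x\<bar> \<le> S"
    by (simp add: AE_lebesgue_on_iff)
  have lift: "AE y in (lborel :: (real \<times> 'a) measure). P (snd y)" if P: "AE x in lborel. P x" and [measurable]: "Measurable.pred borel P" for P :: "'a \<Rightarrow> bool"
  proof -
    have "AE y in (lborel :: real measure) \<Otimes>\<^sub>M (lborel :: 'a measure). P (snd y)"
    proof (rule lborel_pair.AE_pair_measure)
      have "Measurable.pred (borel \<Otimes>\<^sub>M borel) (\<lambda>y::real \<times> 'a. P (snd y))"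
        by measurable
      then show "{y \<in> space ((lborel :: real measure) \<Otimes>\<^sub>M (lborel :: 'a measure)). P (snd y)} \<in> sets (lborel \<Otimes>\<^sub>M lborel)"
        by (auto simp: pred_def space_pair_measure)
    qed (use P in auto)
    then show ?thesis
      unfolding lborel_prod .
  qed
  have vS'': "AE y in (lborel :: (real \<times> 'a) measure). snd y \<in> \<Omega> \<longrightarrow> \<bar>v (snd y)\<bar> \<le> S"
    by (rule lift[OF vS']) measurable
  have "AE x in lborel. x \<in> \<Omega> \<longrightarrow> (\<lambda>k. \<eta> k x) \<longlonglongrightarrow> v x"
    using \<eta>(3) by (simp add: AE_lebesgue_on_iff)
  then have lim_ae: "AE y in (lborel :: (real \<times> 'a) measure). snd y \<in> \<Omega> \<longrightarrow> (\<lambda>k. \<eta> k (snd y)) \<longlonglongrightarrow> v (snd y)"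
    by (rule lift) measurable
  have Sg: "integrable lborel (\<lambda>y. \<bar>\<gg> y\<bar> * S)"
    using \<gg> by auto
  have b: "AE y in lborel. norm (?i y * (\<gg> y * \<eta> j (snd y))) \<le> \<bar>\<gg> y\<bar> * S" for j
  proof (intro AE_I2)
    fix y :: "real \<times> 'a"
    show "norm (?i y * (\<gg> y * \<eta> j (snd y))) \<le> \<bar>\<gg> y\<bar> * S"
      using \<eta>(4)[of "snd y" j] \<gg>(2)[of y]
      by (cases "snd y \<in> \<Omega>") (auto simp: abs_mult indicator_def intro: mult_left_mono order_trans[OF abs_ge_zero])
  qed
  have int3: "integrable lborel (\<lambda>y. ?i y * (\<gg> y * v (snd y)))"
  proof (rule Bochner_Integration.integrable_bound[OF Sg])
    show "AE y in lborel. norm (?i y * (\<gg> y * v (snd y))) \<le> norm (\<bar>\<gg> y\<bar> * S)"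
      using vS''
    proof eventually_elim
      case (elim y)
      then show ?case
        using \<gg>(2)[of y]
        by (cases "snd y \<in> \<Omega>") (auto simp: abs_mult indicator_def intro!: mult_left_mono)
    qed
  qed measurable
  have int3': "integrable lborel (\<lambda>y. ?i y * (\<gg> y * \<eta> j (snd y)))" for j
    by (rule Bochner_Integration.integrable_bound[OF Sg]) (use b[of j] in \<open>auto elim!: eventually_mono\<close>)
  have lim3: "(\<lambda>j. LBINT y. ?i y * (\<gg> y * \<eta> j (snd y))) \<longlonglongrightarrow> (LBINT y. ?i y * (\<gg> y * v (snd y)))"
  proof (rule integral_dominated_convergence[OF _ _ Sg _ b])
    show "AE y in lborel. (\<lambda>j. ?i y * (\<gg> y * \<eta> j (snd y))) \<longlonglongrightarrow> ?i y * (\<gg> y * v (snd y))"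
      using lim_ae
    proof eventually_elim
      case (elim y)
      then show ?case
        using \<gg>(2)[of y] by (cases "snd y \<in> \<Omega>") (auto intro!: tendsto_intros)
    qed
  qed measurable
  show "integrable lborel (\<lambda>y. ?i y * (\<GG> y \<bullet> V (snd y) + \<gg> y * v (snd y)))"
    using Bochner_Integration.integrable_add[OF int2(1) int3] by (simp add: distrib_left)
  have "(\<lambda>j. (LINT x|?D. k x * \<eta> j x) + ((LBINT y. ?i y * (\<GG> y \<bullet> grad (\<eta> j) (snd y))) + (LBINT y. ?i y * (\<gg> y * \<eta> j (snd y)))))
     \<longlonglongrightarrow> (LINT x|?D. k x * v x) + ((LBINT y. ?i y * (\<GG> y \<bullet> V (snd y))) + (LBINT y. ?i y * (\<gg> y * v (snd y))))"
    by (intro tendsto_add lim1 lim2 lim3)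
  moreover have "(LINT x|?D. k x * \<eta> j x) + ((LBINT y. ?i y * (\<GG> y \<bullet> grad (\<eta> j) (snd y))) + (LBINT y. ?i y * (\<gg> y * \<eta> j (snd y)))) = 0" for j
    using eq[OF \<eta>(1)[of j]] Bochner_Integration.integral_add[OF int2(2) int3'] by (simp add: distrib_left)
  ultimately show "(LINT x|?D. k x * v x) + (LBINT y. ?i y * (\<GG> y \<bullet> V (snd y) + \<gg> y * v (snd y))) = 0"
    using Bochner_Integration.integral_add[OF int2(1) int3] by (simp add: distrib_left LIMSEQ_const_iff)
qed

text \<open>
  \<open>U\<close> and \<open>G\<close> are Borel representatives of a solution and of its space gradient. The value \<open>1\<close> off the cylinder agrees with the initial
  value, so that \<open>U (t - h, x)\<close> is the correct earlier value also for \<open>t \<le> h\<close>; the value \<open>0\<close> of \<open>G\<close> makes the equation empty at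
  negative times.
\<close>

locale cylinder_data =
  fixes \<Omega> :: "'a::euclidean_space set" and T B c :: real
    and U :: "real \<times> 'a \<Rightarrow> real" and G :: "real \<times> 'a \<Rightarrow> 'a"
  assumes \<Omega>: "open \<Omega>" "bounded \<Omega>" and T: "T > 0" and B: "B \<ge> 1" and c: "c > 0"
    and U_meas [measurable]: "U \<in> borel_measurable borel"
    and G_meas [measurable]: "G \<in> borel_measurable borel"
    and U_ge: "\<And>z. U z \<ge> c" and U_off: "\<And>z. z \<notin> cyl T \<Omega> \<Longrightarrow> U z = 1"
    and G_off: "\<And>z. z \<notin> cyl T \<Omega> \<Longrightarrow> G z = 0"
begin

abbreviation "Q \<equiv> cyl T \<Omega>"

definition absorb :: "real \<times> 'a \<Rightarrow> real" where
  "absorb z = B * ((norm (G z))\<^sup>2 / U z)"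

lemma Q_borel [measurable]: "Q \<in> sets borel"
  using \<Omega> by (simp add: cyl_def open_Times borel_open)

lemma mem_Q: "z \<in> Q \<longleftrightarrow> 0 < fst z \<and> fst z < T \<and> snd z \<in> \<Omega>"
  by (auto simp: cyl_def mem_Times_iff)

lemma \<Omega>_borel [measurable]: "\<Omega> \<in> sets borel"
  using \<Omega> by simp

lemma Q_finite: "emeasure lborel Q < \<infinity>"
  using \<Omega> by (intro emeasure_bounded_finite) (auto simp: cyl_def intro!: bounded_Times)

lemma U_pos: "U z > 0"
  using U_ge[of z] c by linarith

lemma absorb_measurable [measurable]: "absorb \<in> borel_measurable borel"
  unfolding absorb_def[abs_def] by measurable

lemma absorb_nonneg: "absorb z \<ge> 0"
  using U_pos[of z] B by (simp add: absorb_def)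

lemma absorb_off: "z \<notin> Q \<Longrightarrow> absorb z = 0"
  by (simp add: absorb_def G_off)

end

locale energy_class = cylinder_data +
  assumes G_L2: "L2 lborel G"
    and U_int: "integrable lborel (\<lambda>z. indicator (cyl T \<Omega>) z * U z)"
begin

lemma absorb_integrable: "integrable lborel absorb"
proof (rule Bochner_Integration.integrable_bound)
  show "integrable lborel (\<lambda>z. B / c * (norm (G z))\<^sup>2)"
    using G_L2 by (simp add: L2_def)
  show "AE z in lborel. norm (absorb z) \<le> norm (B / c * (norm (G z))\<^sup>2)"
  proof (intro AE_I2)
    fix z
    have "(norm (G z))\<^sup>2 / U z \<le> (norm (G z))\<^sup>2 / c"
      using U_ge[of z] c by (intro divide_left_mono) auto
    then have "B * ((norm (G z))\<^sup>2 / U z) \<le> B * ((norm (G z))\<^sup>2 / c)"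
      using B by (intro mult_left_mono) auto
    then show "norm (absorb z) \<le> norm (B / c * (norm (G z))\<^sup>2)"
      using absorb_nonneg[of z] B c by (simp add: absorb_def)
  qed
qed measurable

lemma L2_on_Q:
  assumes "f \<in> borel_measurable borel" "\<And>z. z \<notin> Q \<Longrightarrow> f z = 0" "\<And>z. z \<in> Q \<Longrightarrow> norm (f z) \<le> C * (norm (G z) + 1)"
  shows "L2 lborel (f :: real \<times> 'a \<Rightarrow> 'b::euclidean_space)"
proof (rule L2_bound[where w = "\<lambda>z. 2 * C\<^sup>2 * ((norm (G z))\<^sup>2 + indicator Q z)"])
  show "integrable lborel (\<lambda>z. 2 * C\<^sup>2 * ((norm (G z))\<^sup>2 + indicator Q z))"
    using G_L2 Q_finite by (intro integrable_mult_right Bochner_Integration.integrable_add integrable_real_indicator) (auto simp: L2_def)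
  show "AE z in lborel. (norm (f z))\<^sup>2 \<le> 2 * C\<^sup>2 * ((norm (G z))\<^sup>2 + indicator Q z)"
  proof (intro AE_I2)
    fix z
    show "(norm (f z))\<^sup>2 \<le> 2 * C\<^sup>2 * ((norm (G z))\<^sup>2 + indicator Q z)"
    proof (cases "z \<in> Q")
      case True
      have "(norm (f z))\<^sup>2 \<le> (C * (norm (G z) + 1))\<^sup>2"
        using assms(3)[OF True] by (intro power_mono) auto
      also have "\<dots> = C\<^sup>2 * (norm (G z) + 1)\<^sup>2"
        by (simp add: power_mult_distrib)
      also have "\<dots> \<le> C\<^sup>2 * (2 * (norm (G z))\<^sup>2 + 2)"
        using sum_squares_bound[of "norm (G z)" 1] by (intro mult_left_mono) (auto simp: power2_sum)
      finally show ?thesis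
        using True by (simp add: algebra_simps)
    qed (simp add: assms(2))
  qed
qed (use assms in simp)

lemma G_integrable: "integrable lborel G"
proof -
  have "L2 lborel (\<lambda>z. indicator Q z :: real)"
    by (rule L2_on_Q[where C = 1]) auto
  from L2_norm_mult_integrable[OF G_L2 this]
  have "integrable lborel (\<lambda>z. norm (G z) * norm (indicator Q z :: real))" .
  also have "(\<lambda>z. norm (G z) * norm (indicator Q z :: real)) = (\<lambda>z. norm (G z))"
    using G_off by (intro ext) (auto simp: indicator_def)
  finally show ?thesis
    by (rule integrable_norm_cancel) simp
qed

end

text \<open>
  All that the comparison uses of the equation: almost every slice has boundary value \<open>c\<close>, and the equation integrated
  from \<open>t - h\<close> to \<open>t\<close> holds against test functions of the space variable. The exceptional times depend on \<open>h\<close> but not on \<open>\<eta>\<close>,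
  hence \<open>\<eta>\<close> may later be adapted to the slice at time \<open>t\<close>.
\<close>

locale weak_data = energy_class +
  assumes slices: "AE t in lborel. 0 < t \<and> t < T \<longrightarrow> (\<exists>\<phi>. (\<forall>k. \<phi> k \<in> test_functions \<Omega>) \<and>
        L2_lim (lebesgue_on \<Omega>) \<phi> (\<lambda>x. U (t, x) - c) \<and> L2_lim (lebesgue_on \<Omega>) (\<lambda>k. grad (\<phi> k)) (\<lambda>x. G (t, x)))"
    and increments: "\<And>h. h > 0 \<Longrightarrow> AE t in lborel. 0 < t \<and> t < T \<longrightarrow>
        integrable (lebesgue_on \<Omega>) (\<lambda>x. U (t, x) - U (t - h, x)) \<and> (\<forall>\<eta>\<in>test_functions \<Omega>.
        (LINT x|lebesgue_on \<Omega>. (U (t, x) - U (t - h, x)) * \<eta> x)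
        + (LBINT y. indicator {0<..<h} (fst y) * (G (t - fst y, snd y) \<bullet> grad \<eta> (snd y)
            + absorb (t - fst y, snd y) * \<eta> (snd y))) = 0)"


section \<open>The barrier\<close>

definition heat :: "real \<Rightarrow> 'a::euclidean_space \<Rightarrow> real \<times> 'a \<Rightarrow> real" where
  "heat \<mu> e z = exp (\<mu> * (snd z \<bullet> e) + \<mu>\<^sup>2 * fst z)"

text \<open>
  The first condition keeps \<open>c E \<le> 1\<close>, so that \<open>U E\<close> is at most \<open>1\<close> on the lateral boundary. The second one keeps \<open>E \<le> 1\<close> not
  only initially but up to the positive time \<open>\<tau>\<^sub>0\<close>; this leaves room for a shift in time by \<open>h \<le> \<tau>\<^sub>0\<close>.
\<close>

locale barrier = weak_data \<Omega> T B c U G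
  for \<Omega> :: "'a::euclidean_space set" and T B c :: real
    and U :: "real \<times> 'a \<Rightarrow> real" and G :: "real \<times> 'a \<Rightarrow> 'a" +
  fixes \<kappa> \<mu> A \<tau>\<^sub>0 :: real and e :: 'a
  assumes e: "norm e = 1" and \<kappa>: "\<kappa> \<ge> 0" and \<tau>\<^sub>0: "\<tau>\<^sub>0 > 0"
    and boundary: "\<And>z. fst z \<le> T \<Longrightarrow> snd z \<in> \<Omega> \<Longrightarrow> c * exp (\<kappa> * (heat \<mu> e z - A)) \<le> 1"
    and initial: "\<And>z. fst z \<le> \<tau>\<^sub>0 \<Longrightarrow> snd z \<in> \<Omega> \<Longrightarrow> exp (\<kappa> * (heat \<mu> e z - A)) \<le> 1"
begin

text \<open>
  \<open>E\<close> is the reciprocal of a supersolution and \<open>\<beta> e\<close> is the gradient of \<open>ln E\<close>. \<open>Dr\<close> and \<open>V\<close> are the space gradients of \<open>r\<close> and of the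
  test function \<open>v\<close> when \<open>G\<close> is that of \<open>U\<close>. The weight \<open>\<zeta>\<close> vanishes at time \<open>T\<close> and has slope \<open>-1\<close> before.
\<close>

definition E :: "real \<times> 'a \<Rightarrow> real" where "E z = exp (\<kappa> * (heat \<mu> e z - A))"
definition \<beta> :: "real \<times> 'a \<Rightarrow> real" where "\<beta> z = \<kappa> * \<mu> * heat \<mu> e z"
definition r :: "real \<times> 'a \<Rightarrow> real" where "r z = U z * E z"
definition Dr :: "real \<times> 'a \<Rightarrow> 'a" where "Dr z = E z *\<^sub>R G z + (r z * \<beta> z) *\<^sub>R e"
definition v :: "real \<times> 'a \<Rightarrow> real" where "v z = indicator Q z * (pen1 (r z) * E z)"
definition V :: "real \<times> 'a \<Rightarrow> 'a" where
  "V z = indicator Q z *\<^sub>R ((pen2 (r z) * E z) *\<^sub>R Dr z + (pen1 (r z) * (\<beta> z * E z)) *\<^sub>R e)"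
definition \<zeta> :: "real \<Rightarrow> real" where "\<zeta> t = max 0 (T - t)"

lemma heat_measurable [measurable]: "heat \<mu> e \<in> borel_measurable borel"
  unfolding heat_def[abs_def] by measurable

lemma measurables [measurable]:
  "E \<in> borel_measurable borel" "\<beta> \<in> borel_measurable borel" "r \<in> borel_measurable borel"
  "Dr \<in> borel_measurable borel" "v \<in> borel_measurable borel" "V \<in> borel_measurable borel"
  "\<zeta> \<in> borel_measurable borel"
proof -
  show [measurable]: "E \<in> borel_measurable borel" "\<beta> \<in> borel_measurable borel" "\<zeta> \<in> borel_measurable borel"
    unfolding E_def[abs_def] \<beta>_def[abs_def] \<zeta>_def[abs_def] by measurable
  show [measurable]: "r \<in> borel_measurable borel"
    unfolding r_def[abs_def] by measurable
  show [measurable]: "Dr \<in> borel_measurable borel"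
    unfolding Dr_def[abs_def] by measurable
  show "v \<in> borel_measurable borel" "V \<in> borel_measurable borel"
    unfolding v_def[abs_def] V_def[abs_def] by measurable
qed

lemma E_pos: "E z > 0"
  by (simp add: E_def)

lemma E_le: "fst z \<le> T \<Longrightarrow> snd z \<in> \<Omega> \<Longrightarrow> E z \<le> 1 / c"
  using boundary[of z] c by (simp add: E_def field_simps)

lemma E_le_1: "fst z \<le> \<tau>\<^sub>0 \<Longrightarrow> snd z \<in> \<Omega> \<Longrightarrow> E z \<le> 1"
  using initial[of z] by (simp add: E_def)

lemma r_pos: "r z > 0"
  using U_pos E_pos by (simp add: r_def)

lemma heat_bound: obtains H where "H > 0" "\<And>z. fst z \<le> T \<Longrightarrow> snd z \<in> \<Omega> \<Longrightarrow> heat \<mu> e z \<le> H"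
proof -
  obtain R where R: "\<And>x. x \<in> \<Omega> \<Longrightarrow> norm x \<le> R"
    using \<Omega>(2) unfolding bounded_iff by blast
  have "heat \<mu> e z \<le> exp (\<bar>\<mu>\<bar> * R + \<mu>\<^sup>2 * T)" if z: "fst z \<le> T" "snd z \<in> \<Omega>" for z
  proof -
    have "\<mu> * (snd z \<bullet> e) \<le> \<bar>\<mu>\<bar> * \<bar>snd z \<bullet> e\<bar>"
      by (metis abs_ge_self abs_mult)
    also have "\<dots> \<le> \<bar>\<mu>\<bar> * R"
      using Cauchy_Schwarz_ineq2[of "snd z" e] R[OF z(2)] e by (intro mult_left_mono) auto
    finally show ?thesis
      using z(1) by (simp add: heat_def add_mono mult_left_mono)
  qed
  then show ?thesis
    by (intro that[of "exp (\<bar>\<mu>\<bar> * R + \<mu>\<^sup>2 * T)"]) auto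
qed

lemma \<beta>_bound: obtains C where "C > 0" "\<And>z. fst z \<le> T \<Longrightarrow> snd z \<in> \<Omega> \<Longrightarrow> \<bar>\<beta> z\<bar> \<le> C"
proof -
  obtain H where H: "H > 0" "\<And>z. fst z \<le> T \<Longrightarrow> snd z \<in> \<Omega> \<Longrightarrow> heat \<mu> e z \<le> H"
    using heat_bound by metis
  have h0: "heat \<mu> e z \<ge> 0" for z :: "real \<times> 'a"
    by (simp add: heat_def)
  have "\<bar>\<beta> z\<bar> \<le> \<kappa> * \<bar>\<mu>\<bar> * H + 1" if "fst z \<le> T" "snd z \<in> \<Omega>" for z
  proof -
    have "\<bar>\<beta> z\<bar> = \<kappa> * \<bar>\<mu>\<bar> * heat \<mu> e z"
      using \<kappa> h0[of z] by (simp add: \<beta>_def abs_mult)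
    also have "\<dots> \<le> \<kappa> * \<bar>\<mu>\<bar> * H"
      using H(2)[OF that] \<kappa> by (intro mult_left_mono) auto
    finally show ?thesis by simp
  qed
  moreover have "\<kappa> * \<bar>\<mu>\<bar> * H + 1 > 0"
    using \<kappa> H(1) by (simp add: add_nonneg_pos)
  ultimately show ?thesis
    using that by blast
qed

lemma smooth_heat: "smooth (\<lambda>x. heat \<mu> e (t, x))"
  unfolding heat_def fst_conv snd_conv
  by (intro smooth_compose[OF smooth_exp] smooth_add smooth_mult smooth_const smooth_linear bounded_linear_inner_left)

lemma grad_heat: "grad (\<lambda>x. heat \<mu> e (t, x)) x = (\<mu> * heat \<mu> e (t, x)) *\<^sub>R e"
proof (rule gradI)
  have "((\<lambda>x. \<mu> * (x \<bullet> e) + \<mu>\<^sup>2 * t) has_derivative (\<lambda>h. (\<mu> *\<^sub>R e) \<bullet> h)) (at x)"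
    by (auto intro!: derivative_eq_intros simp: inner_commute)
  from has_derivative_real_compose[OF DERIV_exp this]
  show "((\<lambda>x. heat \<mu> e (t, x)) has_derivative (\<lambda>h. ((\<mu> * heat \<mu> e (t, x)) *\<^sub>R e) \<bullet> h)) (at x)"
    by (simp add: heat_def mult_ac)
qed

lemma smooth_\<beta>: "smooth (\<lambda>x. \<beta> (t, x))"
  unfolding \<beta>_def by (intro smooth_mult smooth_const smooth_heat)

lemma grad_\<beta>: "grad (\<lambda>x. \<beta> (t, x)) x = (\<mu> * \<beta> (t, x)) *\<^sub>R e"
  unfolding \<beta>_def grad_mult[OF smooth_const smooth_heat] grad_heat
  using gradI[of "\<lambda>_. \<kappa> * \<mu>" 0 x] by (simp add: mult_ac)

lemma smooth_E: "smooth (\<lambda>x. E (t, x))"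
  unfolding E_def
  by (intro smooth_compose[OF smooth_exp] smooth_mult smooth_diff smooth_const smooth_heat)

lemma grad_E: "grad (\<lambda>x. E (t, x)) x = (\<beta> (t, x) * E (t, x)) *\<^sub>R e"
proof (rule gradI)
  have "((\<lambda>x. \<kappa> * (heat \<mu> e (t, x) - A)) has_derivative (\<lambda>h. (\<kappa> *\<^sub>R ((\<mu> * heat \<mu> e (t, x)) *\<^sub>R e)) \<bullet> h)) (at x)"
    using smooth_has_gradient[OF smooth_heat, of t x] unfolding grad_heat
    by (auto intro!: derivative_eq_intros)
  from has_derivative_real_compose[OF DERIV_exp this]
  show "((\<lambda>x. E (t, x)) has_derivative (\<lambda>h. ((\<beta> (t, x) * E (t, x)) *\<^sub>R e) \<bullet> h)) (at x)"
    by (simp add: E_def \<beta>_def mult_ac)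
qed

lemma E_time_derivative:
  "((\<lambda>s. E (s, x)) has_real_derivative (\<mu> * \<beta> (s, x) * E (s, x))) (at s)"
  unfolding E_def \<beta>_def heat_def
  by (auto intro!: derivative_eq_intros simp: power2_eq_square)

lemma v_bounds: "0 \<le> v z" "v z \<le> 1 / c"
proof -
  show "0 \<le> v z"
    using pen1_bounds E_pos[of z] by (simp add: v_def)
  show "v z \<le> 1 / c"
  proof (cases "z \<in> Q")
    case True
    then have "pen1 (r z) * E z \<le> 1 * (1 / c)"
      using pen1_bounds E_le[of z] E_pos[of z] by (intro mult_mono) (auto simp: mem_Q)
    then show ?thesis
      using True by (simp add: v_def)
  qed (use c in \<open>simp add: v_def\<close>)
qed

lemma V_L2: "L2 lborel V"
proof -
  obtain C where C: "C > 0" "\<And>z. fst z \<le> T \<Longrightarrow> snd z \<in> \<Omega> \<Longrightarrow> \<bar>\<beta> z\<bar> \<le> C"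
    using \<beta>_bound by metis
  show ?thesis
  proof (rule L2_on_Q[where C = "6 / c * (1 / c) + 8 * (1 / c) * C + C * (1 / c)"])
    fix z assume z: "z \<in> Q"
    have E: "0 \<le> E z" "E z \<le> 1 / c" and \<beta>: "\<bar>\<beta> z\<bar> \<le> C"
      using E_le[of z] E_pos[of z] C(2)[of z] z by (auto simp: mem_Q)
    have Vz: "V z = (pen2 (r z) * E z * E z) *\<^sub>R G z + (r z * pen2 (r z) * E z * \<beta> z + pen1 (r z) * (\<beta> z * E z)) *\<^sub>R e"
      using z by (simp add: V_def Dr_def scaleR_add_right scaleR_add_left mult_ac)
    have "norm (V z) \<le> \<bar>pen2 (r z) * E z * E z\<bar> * norm (G z) + \<bar>r z * pen2 (r z) * E z * \<beta> z + pen1 (r z) * (\<beta> z * E z)\<bar> * 1"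
      unfolding Vz by (rule order_trans[OF norm_triangle_ineq]) (simp add: e)
    also have "\<dots> \<le> (6 * (1 / c) * (1 / c)) * norm (G z) + (8 * (1 / c) * C + 1 * (C * (1 / c))) * 1"
    proof (intro add_mono mult_right_mono)
      show "\<bar>pen2 (r z) * E z * E z\<bar> \<le> 6 * (1 / c) * (1 / c)"
        unfolding abs_mult using pen2_bounds(1,2)[of "r z"] E c by (intro mult_mono) auto
      have "\<bar>r z * pen2 (r z) * E z * \<beta> z\<bar> \<le> 8 * (1 / c) * C"
        unfolding abs_mult using pen2_bounds(3,4)[of "r z"] E c \<beta> r_pos[of z] pen2_bounds(1)[of "r z"]
        by (intro mult_mono) auto
      moreover have "\<bar>pen1 (r z) * (\<beta> z * E z)\<bar> \<le> 1 * (C * (1 / c))"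
        unfolding abs_mult using pen1_bounds[of "r z"] E c \<beta> C by (intro mult_mono) auto
      ultimately show "\<bar>r z * pen2 (r z) * E z * \<beta> z + pen1 (r z) * (\<beta> z * E z)\<bar> \<le> 8 * (1 / c) * C + 1 * (C * (1 / c))"
        by linarith
    qed auto
    also have "\<dots> = (6 / c * (1 / c)) * norm (G z) + (8 * (1 / c) * C + C * (1 / c)) * 1"
      by simp
    also have "\<dots> \<le> (6 / c * (1 / c) + 8 * (1 / c) * C + C * (1 / c)) * (norm (G z) + 1)"
    proof -
      have "a * g + b * 1 \<le> (a + b) * (g + 1)" if "a \<ge> 0" "b \<ge> 0" "g \<ge> 0" for a b g :: real
        using that by (simp add: distrib_left distrib_right)
      from this[of "6 / c * (1 / c)" "8 * (1 / c) * C + C * (1 / c)" "norm (G z)"] show ?thesis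
        using c C(1) by (simp add: add.assoc)
    qed
    finally show "norm (V z) \<le> (6 / c * (1 / c) + 8 * (1 / c) * C + C * (1 / c)) * (norm (G z) + 1)" .
  qed (auto simp: V_def)
qed

lemma \<zeta>_bounds: "0 \<le> \<zeta> t" "0 < t \<Longrightarrow> \<zeta> t \<le> T"
  using T by (auto simp: \<zeta>_def)

lemma barrier_on_slice:
  assumes "0 < t" "t < T"
  shows "smooth (\<lambda>x. E (t, x))" "x \<in> \<Omega> \<Longrightarrow> \<bar>E (t, x)\<bar> \<le> 1 / c" "x \<in> \<Omega> \<Longrightarrow> c * E (t, x) \<le> 1"
  using E_le[of "(t, x)"] E_pos[of "(t, x)"] assms c smooth_E by (auto simp: field_simps)

lemma grad_E_bound:
  obtains C where "C \<ge> 1 / c" "\<And>t x. 0 < t \<Longrightarrow> t < T \<Longrightarrow> x \<in> \<Omega> \<Longrightarrow> norm (grad (\<lambda>x. E (t, x)) x) \<le> C"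
proof -
  obtain C where C: "C > 0" "\<And>z. fst z \<le> T \<Longrightarrow> snd z \<in> \<Omega> \<Longrightarrow> \<bar>\<beta> z\<bar> \<le> C"
    using \<beta>_bound by metis
  have "norm (grad (\<lambda>x. E (t, x)) x) \<le> max (1 / c) (C * (1 / c))" if "0 < t" "t < T" "x \<in> \<Omega>" for t x
  proof -
    have "\<bar>\<beta> (t, x)\<bar> * \<bar>E (t, x)\<bar> \<le> C * (1 / c)"
      using C(2)[of "(t, x)"] barrier_on_slice(2)[OF that] that C(1) by (intro mult_mono) auto
    then have "norm (grad (\<lambda>x. E (t, x)) x) \<le> C * (1 / c)"
      by (simp add: grad_E abs_mult e)
    then show ?thesis by simp
  qed
  then show ?thesis
    by (intro that[of "max (1 / c) (C * (1 / c))"]) auto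
qed

text \<open>
  The two uses are \<open>\<sigma> = pen1\<close> with \<open>m = E\<close>, which gives \<open>v\<close>, and \<open>\<sigma> r = r pen1 r\<close> with \<open>m = 1\<close>, which is paired with the heat flux of
  the barrier.
\<close>

lemma slice_composition:
  fixes \<sigma> \<sigma>' :: "real \<Rightarrow> real"
  assumes t: "0 < t" "t < T"
    and \<phi>: "\<And>k. \<phi> k \<in> test_functions \<Omega>" "L2_lim (lebesgue_on \<Omega>) \<phi> (\<lambda>x. U (t, x) - c)"
      "L2_lim (lebesgue_on \<Omega>) (\<lambda>k. grad (\<phi> k)) (\<lambda>x. G (t, x))"
    and \<sigma>: "smooth \<sigma>" "\<And>r. (\<sigma> has_real_derivative \<sigma>' r) (at r)" "continuous_on UNIV \<sigma>'"
      "\<And>r. \<bar>\<sigma>' r\<bar> \<le> C" "\<And>r. r \<le> 1 \<Longrightarrow> \<sigma> r = 0"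
    and m: "smooth m" "\<And>x. x \<in> \<Omega> \<Longrightarrow> \<bar>m x\<bar> \<le> C2" "\<And>x. x \<in> \<Omega> \<Longrightarrow> norm (grad m x) \<le> C2"
  obtains \<eta> where "\<And>k. \<eta> k \<in> test_functions \<Omega>"
    "L2_lim (lebesgue_on \<Omega>) \<eta> (\<lambda>x. \<sigma> (r (t, x)) * m x)"
    "L2_lim (lebesgue_on \<Omega>) (\<lambda>k. grad (\<eta> k)) (\<lambda>x. (\<sigma>' (r (t, x)) * m x) *\<^sub>R Dr (t, x) + \<sigma> (r (t, x)) *\<^sub>R grad m x)"
    "AE x in lebesgue_on \<Omega>. (\<lambda>k. \<eta> k x) \<longlonglongrightarrow> \<sigma> (r (t, x)) * m x"
    "\<And>k x S. x \<in> \<Omega> \<Longrightarrow> (\<And>r. \<bar>\<sigma> r\<bar> \<le> S) \<Longrightarrow> \<bar>\<eta> k x\<bar> \<le> S * C2"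
proof -
  obtain C1 where C1: "C1 \<ge> 1 / c" "\<And>x. x \<in> \<Omega> \<Longrightarrow> norm (grad (\<lambda>x. E (t, x)) x) \<le> C1"
    using grad_E_bound t by metis
  have E1: "\<bar>E (t, x)\<bar> \<le> C1" if "x \<in> \<Omega>" for x
    using barrier_on_slice(2)[OF t that] C1(1) by linarith
  show ?thesis
  proof (rule chain_rule_approximation[OF \<Omega> \<phi> \<sigma> barrier_on_slice(1)[OF t] E1 C1(2) barrier_on_slice(3)[OF t] m])
    fix \<eta> assume \<eta>: "\<And>k. \<eta> k \<in> test_functions \<Omega>"
      "L2_lim (lebesgue_on \<Omega>) \<eta> (\<lambda>x. \<sigma> ((U (t, x) - c + c) * E (t, x)) * m x)"
      "L2_lim (lebesgue_on \<Omega>) (\<lambda>k. grad (\<eta> k)) (\<lambda>x. (\<sigma>' ((U (t, x) - c + c) * E (t, x)) * m x) *\<^sub>R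
         (E (t, x) *\<^sub>R G (t, x) + (U (t, x) - c + c) *\<^sub>R grad (\<lambda>x. E (t, x)) x)
         + \<sigma> ((U (t, x) - c + c) * E (t, x)) *\<^sub>R grad m x)"
      "AE x in lebesgue_on \<Omega>. (\<lambda>k. \<eta> k x) \<longlonglongrightarrow> \<sigma> ((U (t, x) - c + c) * E (t, x)) * m x"
      "\<And>k x S. x \<in> \<Omega> \<Longrightarrow> (\<And>r. \<bar>\<sigma> r\<bar> \<le> S) \<Longrightarrow> \<bar>\<eta> k x\<bar> \<le> S * C2"
    have eq: "(U (t, x) - c + c) * E (t, x) = r (t, x)"
      "E (t, x) *\<^sub>R G (t, x) + (U (t, x) - c + c) *\<^sub>R grad (\<lambda>x. E (t, x)) x = Dr (t, x)" for x
      by (simp_all add: r_def Dr_def grad_E mult_ac)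
    show ?thesis
      by (rule that[OF \<eta>(1) \<eta>(2,3,4)[unfolded eq] \<eta>(5)])
  qed auto
qed

text \<open>
  The slice of \<open>v\<close> at time \<open>t\<close> is a limit of test functions, bounded because \<open>pen1 \<le> 1\<close>, so it may be inserted for \<open>\<eta>\<close>.
\<close>

lemma tested_increment:
  assumes h: "h > 0"
  shows "AE t in lborel. 0 < t \<and> t < T \<longrightarrow>
     integrable lborel (\<lambda>y. indicator {0<..<h} (fst y) *
        (G (t - fst y, snd y) \<bullet> V (t, snd y) + absorb (t - fst y, snd y) * v (t, snd y))) \<and>
     (LBINT x. (U (t, x) - U (t - h, x)) * v (t, x))
     + (LBINT y. indicator {0<..<h} (fst y) *
        (G (t - fst y, snd y) \<bullet> V (t, snd y) + absorb (t - fst y, snd y) * v (t, snd y))) = 0"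
  using slices increments[OF h]
proof eventually_elim
  case (elim t)
  show ?case
  proof (intro impI)
    assume t: "0 < t \<and> t < T"
    then obtain \<phi> where \<phi>: "\<And>k. \<phi> k \<in> test_functions \<Omega>"
      "L2_lim (lebesgue_on \<Omega>) \<phi> (\<lambda>x. U (t, x) - c)" "L2_lim (lebesgue_on \<Omega>) (\<lambda>k. grad (\<phi> k)) (\<lambda>x. G (t, x))"
      using elim(1) by blast
    obtain C1 where C1: "C1 \<ge> 1 / c" "\<And>x. x \<in> \<Omega> \<Longrightarrow> norm (grad (\<lambda>x. E (t, x)) x) \<le> C1"
      using grad_E_bound t by metis
    have E1: "\<bar>E (t, x)\<bar> \<le> C1" if "x \<in> \<Omega>" for x
      using barrier_on_slice(2)[OF _ _ that, of t] t C1(1) by force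
    obtain \<eta> where \<eta>: "\<And>k. \<eta> k \<in> test_functions \<Omega>"
      "L2_lim (lebesgue_on \<Omega>) (\<lambda>k. grad (\<eta> k))
        (\<lambda>x. (pen2 (r (t, x)) * E (t, x)) *\<^sub>R Dr (t, x) + pen1 (r (t, x)) *\<^sub>R grad (\<lambda>x. E (t, x)) x)"
      "AE x in lebesgue_on \<Omega>. (\<lambda>k. \<eta> k x) \<longlonglongrightarrow> pen1 (r (t, x)) * E (t, x)"
      "\<And>k x S. x \<in> \<Omega> \<Longrightarrow> (\<And>r. \<bar>pen1 r\<bar> \<le> S) \<Longrightarrow> \<bar>\<eta> k x\<bar> \<le> S * C1"
    proof (rule slice_composition[where C = 6 and m = "\<lambda>x. E (t, x)" and ?C2.0 = C1,
          OF _ _ \<phi> smooth_pen1 pen1_deriv continuous_pen(3)])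
      show "\<bar>pen2 r\<bar> \<le> 6" for r
        using pen2_bounds(1,2)[of r] by simp
    qed (use t pen1_eq_0 smooth_E E1 C1 in blast)+
    have inQ: "(t, x) \<in> Q \<longleftrightarrow> x \<in> \<Omega>" for x
      using t by (auto simp: mem_Q)
    have Vt: "V (t, x) = (pen2 (r (t, x)) * E (t, x)) *\<^sub>R Dr (t, x) + pen1 (r (t, x)) *\<^sub>R grad (\<lambda>x. E (t, x)) x"
      and vt: "v (t, x) = pen1 (r (t, x)) * E (t, x)" if "x \<in> \<Omega>" for x
      using that by (simp_all add: V_def v_def inQ grad_E)
    have L: "L2_lim (lebesgue_on \<Omega>) (\<lambda>k. grad (\<eta> k)) (\<lambda>x. V (t, x))"
    proof (rule L2_lim_cong_limit_AE[OF \<eta>(2)])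
      show "(\<lambda>x. V (t, x)) \<in> borel_measurable (lebesgue_on \<Omega>)"
        by (rule measurable_lebesgue_on) measurable
    qed (auto simp: Vt)
    have ae: "AE x in lebesgue_on \<Omega>. (\<lambda>k. \<eta> k x) \<longlonglongrightarrow> v (t, x)"
      using \<eta>(3) AE_space by eventually_elim (simp add: vt)
    have bd: "\<bar>\<eta> k x\<bar> \<le> 1 * C1" if "x \<in> \<Omega>" for k x
      using \<eta>(4)[OF that, of 1] pen1_bounds by simp
    have GL: "L2 lborel (\<lambda>y. G (t - fst y, snd y))" "integrable lborel (\<lambda>y. absorb (t - fst y, snd y))"
      using reflected_L2[OF G_L2] reflected_integrable[OF absorb_integrable] by auto
    have off: "G (t - fst y, snd y) = 0" "absorb (t - fst y, snd y) = 0" if "snd y \<notin> \<Omega>" for y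
      using that G_off[of "(t - fst y, snd y)"] by (auto simp: absorb_def mem_Q)
    have k: "integrable (lebesgue_on \<Omega>) (\<lambda>x. U (t, x) - U (t - h, x))"
      and eq: "\<And>\<eta>. \<eta> \<in> test_functions \<Omega> \<Longrightarrow> (LINT x|lebesgue_on \<Omega>. (U (t, x) - U (t - h, x)) * \<eta> x)
        + (LBINT y. indicator {0<..<h} (fst y) * (G (t - fst y, snd y) \<bullet> grad \<eta> (snd y)
            + absorb (t - fst y, snd y) * \<eta> (snd y))) = 0"
      using elim(2) t by blast+
    note ext = weak_identity_extends[OF \<Omega> less_imp_le[OF h] k GL(1) off(1) GL(2) off(2) eq \<eta>(1) L ae bd]
    have "(LINT x|lebesgue_on \<Omega>. (U (t, x) - U (t - h, x)) * v (t, x)) = (LBINT x. (U (t, x) - U (t - h, x)) * v (t, x))"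
      by (subst integral_lebesgue_on_borel)
        (auto simp: v_def inQ indicator_def intro!: Bochner_Integration.integral_cong)
    then show "integrable lborel (\<lambda>y. indicator {0<..<h} (fst y) *
        (G (t - fst y, snd y) \<bullet> V (t, snd y) + absorb (t - fst y, snd y) * v (t, snd y))) \<and>
     (LBINT x. (U (t, x) - U (t - h, x)) * v (t, x))
     + (LBINT y. indicator {0<..<h} (fst y) *
        (G (t - fst y, snd y) \<bullet> V (t, snd y) + absorb (t - fst y, snd y) * v (t, snd y))) = 0"
      using ext by simp
  qed
qed

text \<open>
  The heat flux \<open>\<beta> e\<close> has divergence \<open>\<mu> \<beta>\<close>, which is the time derivative of \<open>ln E\<close>. Integrating it by parts against
  \<open>r pen1 r\<close>, which vanishes on the lateral boundary, trades that time derivative for a gradient term.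
\<close>

lemma flux_identity:
  "AE t in lborel. 0 < t \<and> t < T \<longrightarrow>
     (LBINT x. indicator Q (t, x) * (\<mu> * \<beta> (t, x) * (r (t, x) * pen1 (r (t, x)))
        + \<beta> (t, x) * ((pen1 (r (t, x)) + r (t, x) * pen2 (r (t, x))) * (Dr (t, x) \<bullet> e)))) = 0"
  using slices
proof eventually_elim
  case (elim t)
  show ?case
  proof (intro impI)
    assume t: "0 < t \<and> t < T"
    then obtain \<phi> where \<phi>: "\<And>k. \<phi> k \<in> test_functions \<Omega>"
      "L2_lim (lebesgue_on \<Omega>) \<phi> (\<lambda>x. U (t, x) - c)" "L2_lim (lebesgue_on \<Omega>) (\<lambda>k. grad (\<phi> k)) (\<lambda>x. G (t, x))"
      using elim by blast
    interpret D: finite_measure "lebesgue_on \<Omega>"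
      by (rule finite_measure_lebesgue_on[OF \<Omega>])
    obtain C where C: "C > 0" "\<And>z. fst z \<le> T \<Longrightarrow> snd z \<in> \<Omega> \<Longrightarrow> \<bar>\<beta> z\<bar> \<le> C"
      using \<beta>_bound by metis
    have grad1: "grad (\<lambda>_. 1) x = 0" for x :: 'a
      by (rule gradI) simp
    obtain \<eta> where \<eta>: "\<And>k. \<eta> k \<in> test_functions \<Omega>"
      "L2_lim (lebesgue_on \<Omega>) \<eta> (\<lambda>x. r (t, x) * pen1 (r (t, x)) * 1)"
      "L2_lim (lebesgue_on \<Omega>) (\<lambda>k. grad (\<eta> k))
        (\<lambda>x. ((pen1 (r (t, x)) + r (t, x) * pen2 (r (t, x))) * 1) *\<^sub>R Dr (t, x) + (r (t, x) * pen1 (r (t, x))) *\<^sub>R grad (\<lambda>_. 1) x)"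
    proof (rule slice_composition[where \<sigma> = "\<lambda>r. r * pen1 r" and \<sigma>' = "\<lambda>r. pen1 r + r * pen2 r"
          and C = 9 and m = "\<lambda>_. 1" and ?C2.0 = 1, OF _ _ \<phi>])
      show "smooth (\<lambda>r. r * pen1 r)"
        by (intro smooth_mult smooth_pen1 smooth_linear bounded_linear_ident)
      show "((\<lambda>r. r * pen1 r) has_real_derivative pen1 r + r * pen2 r) (at r)" for r
        using DERIV_mult'[OF DERIV_ident pen1_deriv, of r] by (simp add: add.commute)
      show "continuous_on UNIV (\<lambda>r. pen1 r + r * pen2 r)"
        by (intro continuous_intros continuous_pen)
      show "\<bar>pen1 r + r * pen2 r\<bar> \<le> 9" for r
        using pen1_bounds[of r] pen2_bounds(3,4)[of r] by simp
      show "norm (grad (\<lambda>_. 1) x) \<le> 1" for x :: 'a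
        by (simp add: grad1)
    qed (use t pen1_eq_0 in \<open>auto intro: smooth_const\<close>)
    have \<beta>_L2: "L2 (lebesgue_on \<Omega>) (\<lambda>x. \<mu> * \<beta> (t, x))" "L2 (lebesgue_on \<Omega>) (\<lambda>x. \<beta> (t, x) *\<^sub>R e)"
    proof -
      have [measurable]: "(\<lambda>x. \<beta> (t, x)) \<in> borel_measurable (lebesgue_on \<Omega>)"
        by (rule measurable_lebesgue_on) measurable
      have "\<bar>\<beta> (t, x)\<bar> \<le> C" if "x \<in> \<Omega>" for x
        using C(2)[of "(t, x)"] that t by simp
      then have ae: "AE x in lebesgue_on \<Omega>. \<bar>\<beta> (t, x)\<bar> \<le> C"
        by (intro AE_I2) simp
      show "L2 (lebesgue_on \<Omega>) (\<lambda>x. \<mu> * \<beta> (t, x))"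
      proof (rule D.L2_bounded)
        show "AE x in lebesgue_on \<Omega>. norm (\<mu> * \<beta> (t, x)) \<le> \<bar>\<mu>\<bar> * C"
          using ae by eventually_elim (simp add: abs_mult mult_left_mono)
      qed measurable
      show "L2 (lebesgue_on \<Omega>) (\<lambda>x. \<beta> (t, x) *\<^sub>R e)"
      proof (rule D.L2_bounded)
        show "AE x in lebesgue_on \<Omega>. norm (\<beta> (t, x) *\<^sub>R e) \<le> C"
          using ae by eventually_elim (simp add: e)
      qed measurable
    qed
    have "(\<lambda>k. (LINT x|lebesgue_on \<Omega>. \<eta> k x \<bullet> (\<mu> * \<beta> (t, x))) + (LINT x|lebesgue_on \<Omega>. grad (\<eta> k) x \<bullet> (\<beta> (t, x) *\<^sub>R e)))
        \<longlonglongrightarrow> (LINT x|lebesgue_on \<Omega>. (r (t, x) * pen1 (r (t, x)) * 1) \<bullet> (\<mu> * \<beta> (t, x)))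
          + (LINT x|lebesgue_on \<Omega>. (((pen1 (r (t, x)) + r (t, x) * pen2 (r (t, x))) * 1) *\<^sub>R Dr (t, x)
              + (r (t, x) * pen1 (r (t, x))) *\<^sub>R grad (\<lambda>_. 1) x) \<bullet> (\<beta> (t, x) *\<^sub>R e))"
      by (intro tendsto_add L2_lim_inner[OF \<eta>(2) \<beta>_L2(1)] L2_lim_inner[OF \<eta>(3) \<beta>_L2(2)])
    moreover have "(LINT x|lebesgue_on \<Omega>. \<eta> k x \<bullet> (\<mu> * \<beta> (t, x))) + (LINT x|lebesgue_on \<Omega>. grad (\<eta> k) x \<bullet> (\<beta> (t, x) *\<^sub>R e)) = 0" for k
    proof -
      have [measurable]: "\<eta> k \<in> borel_measurable borel" "grad (\<eta> k) \<in> borel_measurable borel"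
        using \<eta>(1) by (auto intro: borel_measurable_smooth borel_measurable_grad test_functions_smooth)
      obtain K where K: "K \<subseteq> \<Omega>" "\<And>x. x \<notin> K \<Longrightarrow> \<eta> k x = 0" "\<And>x. x \<notin> K \<Longrightarrow> grad (\<eta> k) x = 0"
        using test_functionsE[OF \<eta>(1)[of k]] by metis
      have off: "\<eta> k x = 0" "grad (\<eta> k) x = 0" if "x \<notin> \<Omega>" for x
        using K that by auto
      have "(LINT x|lebesgue_on \<Omega>. \<eta> k x \<bullet> (\<mu> * \<beta> (t, x))) = (LBINT x. (grad (\<lambda>x. \<beta> (t, x)) x \<bullet> e) * \<eta> k x)"
        by (subst integral_lebesgue_on_borel)
          (auto simp: grad_\<beta> dot_square_norm e indicator_def off intro!: Bochner_Integration.integral_cong)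
      moreover have "(LINT x|lebesgue_on \<Omega>. grad (\<eta> k) x \<bullet> (\<beta> (t, x) *\<^sub>R e)) = (LBINT x. \<beta> (t, x) * (grad (\<eta> k) x \<bullet> e))"
        by (subst integral_lebesgue_on_borel)
          (auto simp: indicator_def off intro!: Bochner_Integration.integral_cong)
      ultimately show ?thesis
        using integration_by_parts[OF \<eta>(1)[of k] smooth_\<beta> e, of t] by simp
    qed
    ultimately have lim: "(LINT x|lebesgue_on \<Omega>. (r (t, x) * pen1 (r (t, x)) * 1) \<bullet> (\<mu> * \<beta> (t, x)))
          + (LINT x|lebesgue_on \<Omega>. (((pen1 (r (t, x)) + r (t, x) * pen2 (r (t, x))) * 1) *\<^sub>R Dr (t, x)
              + (r (t, x) * pen1 (r (t, x))) *\<^sub>R grad (\<lambda>_. 1) x) \<bullet> (\<beta> (t, x) *\<^sub>R e)) = 0"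
      by (simp add: LIMSEQ_const_iff)
    have inQ: "(t, x) \<in> Q \<longleftrightarrow> x \<in> \<Omega>" for x
      using t by (auto simp: mem_Q)
    have "(LBINT x. indicator Q (t, x) * (\<mu> * \<beta> (t, x) * (r (t, x) * pen1 (r (t, x)))
        + \<beta> (t, x) * ((pen1 (r (t, x)) + r (t, x) * pen2 (r (t, x))) * (Dr (t, x) \<bullet> e))))
      = (LINT x|lebesgue_on \<Omega>. (r (t, x) * pen1 (r (t, x)) * 1) \<bullet> (\<mu> * \<beta> (t, x))
          + (((pen1 (r (t, x)) + r (t, x) * pen2 (r (t, x))) * 1) *\<^sub>R Dr (t, x)
              + (r (t, x) * pen1 (r (t, x))) *\<^sub>R grad (\<lambda>_. 1) x) \<bullet> (\<beta> (t, x) *\<^sub>R e))"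
      by (subst integral_lebesgue_on_borel)
        (auto simp: grad1 inQ indicator_def intro!: Bochner_Integration.integral_cong)
    also have "\<dots> = (LINT x|lebesgue_on \<Omega>. (r (t, x) * pen1 (r (t, x)) * 1) \<bullet> (\<mu> * \<beta> (t, x)))
          + (LINT x|lebesgue_on \<Omega>. (((pen1 (r (t, x)) + r (t, x) * pen2 (r (t, x))) * 1) *\<^sub>R Dr (t, x)
              + (r (t, x) * pen1 (r (t, x))) *\<^sub>R grad (\<lambda>_. 1) x) \<bullet> (\<beta> (t, x) *\<^sub>R e))"
      using \<eta>(2,3) \<beta>_L2 by (intro Bochner_Integration.integral_add L2_inner_integrable) (auto simp: L2_lim_def)
    finally show "(LBINT x. indicator Q (t, x) * (\<mu> * \<beta> (t, x) * (r (t, x) * pen1 (r (t, x)))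
        + \<beta> (t, x) * ((pen1 (r (t, x)) + r (t, x) * pen2 (r (t, x))) * (Dr (t, x) \<bullet> e)))) = 0"
      using lim by simp
  qed
qed

text \<open>
  With \<open>a = G / U\<close> and \<open>b = \<beta> e\<close> one has \<open>Dr = r (a + b)\<close>, and the mixed products complete the square \<open>|a + b|\<^sup>2\<close>. What remains is
  \<open>(B - 1) |a|\<^sup>2\<close>; here \<open>B \<ge> 1\<close> enters.
\<close>

lemma dissipation_nonneg:
  "0 \<le> \<beta> z * ((pen1 (r z) + r z * pen2 (r z)) * (Dr z \<bullet> e)) + pen1 (r z) * E z * absorb z
     + ((pen2 (r z) * E z) *\<^sub>R Dr z + (pen1 (r z) * (\<beta> z * E z)) *\<^sub>R e) \<bullet> G z"
proof -
  define a where "a = (1 / U z) *\<^sub>R G z"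
  define b where "b = \<beta> z *\<^sub>R e"
  have U: "U z > 0"
    by (rule U_pos)
  have G: "G z = U z *\<^sub>R a"
    using U by (simp add: a_def)
  have EG: "E z *\<^sub>R G z = r z *\<^sub>R a"
    by (simp add: G r_def mult.commute)
  have Dr: "Dr z = r z *\<^sub>R (a + b)"
    unfolding Dr_def EG by (simp add: b_def algebra_simps)
  have "E z * absorb z = r z * (B * (a \<bullet> a))"
    using U by (simp add: absorb_def G r_def power_mult_distrib power2_eq_square dot_square_norm)
  then have 1: "pen1 (r z) * E z * absorb z = pen1 (r z) * (r z * (B * (a \<bullet> a)))"
    by simp
  have 2: "((pen2 (r z) * E z) *\<^sub>R Dr z + (pen1 (r z) * (\<beta> z * E z)) *\<^sub>R e) \<bullet> G z
     = pen2 (r z) * (r z * ((a + b) \<bullet> (r z *\<^sub>R a))) + pen1 (r z) * (b \<bullet> (r z *\<^sub>R a))"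
    unfolding Dr EG[symmetric] b_def by (simp add: inner_add_left algebra_simps)
  have 3: "\<beta> z * ((pen1 (r z) + r z * pen2 (r z)) * (Dr z \<bullet> e)) = (pen1 (r z) + r z * pen2 (r z)) * (r z * ((a + b) \<bullet> b))"
    unfolding Dr by (simp add: b_def algebra_simps)
  have "\<beta> z * ((pen1 (r z) + r z * pen2 (r z)) * (Dr z \<bullet> e)) + pen1 (r z) * E z * absorb z
     + ((pen2 (r z) * E z) *\<^sub>R Dr z + (pen1 (r z) * (\<beta> z * E z)) *\<^sub>R e) \<bullet> G z
     = r z * (r z * pen2 (r z) * ((a + b) \<bullet> (a + b)) + pen1 (r z) * ((a + b) \<bullet> (a + b) + (B - 1) * (a \<bullet> a)))"
    unfolding 1 2 3 by (simp add: inner_add_left inner_add_right inner_commute algebra_simps)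
  also have "\<dots> \<ge> 0"
    using r_pos[of z] pen1_bounds[of "r z"] pen2_bounds(1,3)[of "r z"] B
    by (intro mult_nonneg_nonneg add_nonneg_nonneg) auto
  finally show ?thesis .
qed

section \<open>The energy inequality\<close>

text \<open>
  The space terms of the equation at time \<open>t - \<sigma>\<close>, tested with \<open>v\<close> at time \<open>t\<close>. Only the value at \<open>\<sigma> = 0\<close> has a sign; the other
  values enter through their average over \<open>0 < \<sigma> < h\<close>.
\<close>

definition response :: "real \<Rightarrow> real" where
  "response \<sigma> = (LBINT z. \<zeta> (fst z) * (V z \<bullet> G (z - (\<sigma>, 0)) + v z * absorb (z - (\<sigma>, 0))))"

lemma off_Q: "z \<notin> Q \<Longrightarrow> v z = 0" "z \<notin> Q \<Longrightarrow> V z = 0"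
  by (simp_all add: v_def V_def)

lemma \<zeta>_on_Q: "z \<in> Q \<Longrightarrow> 0 \<le> \<zeta> (fst z) \<and> \<zeta> (fst z) \<le> T"
  using \<zeta>_bounds[of "fst z"] by (auto simp: mem_Q)

lemma response_integrand_le:
  "\<bar>\<zeta> (fst z) * (V z \<bullet> a + v z * b)\<bar> \<le> T * ((norm (V z))\<^sup>2 + (norm a)\<^sup>2 + (1 / c) * \<bar>b\<bar>)"
proof (cases "z \<in> Q")
  case True
  have "\<bar>V z \<bullet> a\<bar> \<le> norm (V z) * norm a"
    by (rule Cauchy_Schwarz_ineq2)
  also have "\<dots> \<le> (norm (V z))\<^sup>2 + (norm a)\<^sup>2"
    using sum_squares_bound[of "norm (V z)" "norm a"] mult_nonneg_nonneg[OF norm_ge_zero[of "V z"] norm_ge_zero[of a]]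
    by linarith
  finally have 1: "\<bar>V z \<bullet> a\<bar> \<le> (norm (V z))\<^sup>2 + (norm a)\<^sup>2" .
  have "\<bar>v z * b\<bar> \<le> (1 / c) * \<bar>b\<bar>"
    unfolding abs_mult using v_bounds[of z] by (intro mult_right_mono) auto
  with 1 have "\<bar>V z \<bullet> a + v z * b\<bar> \<le> (norm (V z))\<^sup>2 + (norm a)\<^sup>2 + (1 / c) * \<bar>b\<bar>"
    by linarith
  then show ?thesis
    unfolding abs_mult using \<zeta>_on_Q[OF True] T by (intro mult_mono) auto
next
  case False
  then show ?thesis
    using T c by (simp add: off_Q)
qed

lemma response_measurable [measurable]:
  "(\<lambda>(\<sigma>, z). \<zeta> (fst z) * (V z \<bullet> G (z - (\<sigma>, 0)) + v z * absorb (z - (\<sigma>, 0))))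
     \<in> borel_measurable (lborel \<Otimes>\<^sub>M lborel)"
  by measurable

lemma response_Fubini:
  assumes h: "h > 0"
  shows "integrable (lborel \<Otimes>\<^sub>M lborel)
     (\<lambda>(\<sigma>, z). indicator {0<..<h} \<sigma> * (\<zeta> (fst z) * (V z \<bullet> G (z - (\<sigma>, 0)) + v z * absorb (z - (\<sigma>, 0)))))"
proof (rule Bochner_Integration.integrable_bound)
  let ?W = "\<lambda>(\<sigma>, z). indicator {0<..<h} \<sigma> *
     (T * ((norm (V z))\<^sup>2 + (norm (G (z - (\<sigma>, 0))))\<^sup>2 + (1 / c) * \<bar>absorb (z - (\<sigma>, 0))\<bar>))"
  have V2: "integrable lborel (\<lambda>z. (norm (V z))\<^sup>2)"
    using V_L2 by (simp add: L2_def)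
  have G2: "integrable lborel (\<lambda>z. (norm (G (z - y)))\<^sup>2)"
    "(LBINT z. (norm (G (z - y)))\<^sup>2) = (LBINT z. (norm (G z))\<^sup>2)" for y
    using L2_translation[OF G_L2, of y] by (auto simp: L2_def)
  have ab: "integrable lborel (\<lambda>z. \<bar>absorb (z - y)\<bar>)"
    "(LBINT z. \<bar>absorb (z - y)\<bar>) = (LBINT z. \<bar>absorb z\<bar>)" for y
    using lborel_translation[of "\<lambda>z. \<bar>absorb z\<bar>" y] integrable_abs[OF absorb_integrable] by auto
  let ?C = "T * ((LBINT z. (norm (V z))\<^sup>2) + (LBINT z. (norm (G z))\<^sup>2) + (1 / c) * (LBINT z. \<bar>absorb z\<bar>))"
  show "integrable (lborel \<Otimes>\<^sub>M lborel) ?W"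
  proof (rule lborel_pair.Fubini_integrable)
    show "?W \<in> borel_measurable (lborel \<Otimes>\<^sub>M lborel)"
      by measurable
    show "AE \<sigma> in lborel. integrable lborel (\<lambda>z. ?W (\<sigma>, z))"
      using V2 G2(1) ab(1) by (intro AE_I2) simp
    have "(LBINT z. norm (?W (\<sigma>, z))) = indicator {0<..<h} \<sigma> * ?C" for \<sigma>
    proof -
      have "(LBINT z. norm (?W (\<sigma>, z))) = (LBINT z. ?W (\<sigma>, z))"
        using T c by (intro Bochner_Integration.integral_cong) (auto simp: abs_mult)
      also have "\<dots> = indicator {0<..<h} \<sigma> * ?C"
        using V2 G2 ab by simp
      finally show ?thesis .
    qed
    then show "integrable lborel (\<lambda>\<sigma>. LBINT z. norm (?W (\<sigma>, z)))"
      using h by (simp add: integrable_mult_left)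
  qed
  show "AE x in lborel \<Otimes>\<^sub>M lborel. norm ((\<lambda>(\<sigma>, z). indicator {0<..<h} \<sigma> *
      (\<zeta> (fst z) * (V z \<bullet> G (z - (\<sigma>, 0)) + v z * absorb (z - (\<sigma>, 0))))) x) \<le> norm (?W x)"
  proof (intro AE_I2)
    fix x :: "real \<times> real \<times> 'a"
    obtain \<sigma> z where x: "x = (\<sigma>, z)"
      by (cases x) auto
    show "norm ((\<lambda>(\<sigma>, z). indicator {0<..<h} \<sigma> *
      (\<zeta> (fst z) * (V z \<bullet> G (z - (\<sigma>, 0)) + v z * absorb (z - (\<sigma>, 0))))) x) \<le> norm (?W x)"
      using order_trans[OF response_integrand_le[of z "G (z - (\<sigma>, 0))" "absorb (z - (\<sigma>, 0))"] abs_ge_self]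
      unfolding x by (cases "\<sigma> \<in> {0<..<h}") (auto simp del: abs_mult)
  qed
qed measurable

lemma shifted_U_bound: "indicator Q z * U (z - (h, 0)) \<le> indicator Q (z - (h, 0)) * U (z - (h, 0)) + indicator Q z"
  using U_off[of "z - (h, 0)"] less_imp_le[OF U_pos[of "z - (h, 0)"]] by (auto simp: indicator_def)

lemma shifted_U_integrable:
  "integrable lborel (\<lambda>z. indicator Q (z - (h, 0)) * U (z - (h, 0)) + indicator Q z)"
  using lborel_translation(1)[of "\<lambda>z. indicator Q z * U z" "(h, 0)"] U_int Q_finite
  by (intro Bochner_Integration.integrable_add integrable_real_indicator) auto

lemma integrable_by_shifted_U:
  assumes "f \<in> borel_measurable borel"
    "\<And>z. \<bar>f z\<bar> \<le> C * (indicator Q z * U z + indicator Q z * U (z - (h, 0)))" "C \<ge> 0"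
  shows "integrable lborel f"
proof (rule Bochner_Integration.integrable_bound)
  show "integrable lborel (\<lambda>z. C * (indicator Q z * U z + (indicator Q (z - (h, 0)) * U (z - (h, 0)) + indicator Q z)))"
    by (intro integrable_mult_right Bochner_Integration.integrable_add[OF U_int shifted_U_integrable])
  show "AE z in lborel. norm (f z) \<le> norm (C * (indicator Q z * U z + (indicator Q (z - (h, 0)) * U (z - (h, 0)) + indicator Q z)))"
  proof (intro AE_I2)
    fix z
    have "C * (indicator Q z * U z + indicator Q z * U (z - (h, 0)))
       \<le> C * (indicator Q z * U z + (indicator Q (z - (h, 0)) * U (z - (h, 0)) + indicator Q z))"
      using shifted_U_bound[of z h] assms(3) by (intro mult_left_mono) auto
    then show "norm (f z) \<le> norm (C * (indicator Q z * U z + (indicator Q (z - (h, 0)) * U (z - (h, 0)) + indicator Q z)))"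
      using assms(2)[of z] by simp
  qed
qed (use assms in simp)

lemma increment_integrable:
  "integrable lborel (\<lambda>z. \<zeta> (fst z) * ((U z - U (z - (h, 0))) * v z))"
proof (rule integrable_by_shifted_U[where C = "T * (1 / c)" and h = h])
  fix z
  show "\<bar>\<zeta> (fst z) * ((U z - U (z - (h, 0))) * v z)\<bar> \<le> T * (1 / c) * (indicator Q z * U z + indicator Q z * U (z - (h, 0)))"
  proof (cases "z \<in> Q")
    case True
    have "\<bar>\<zeta> (fst z) * ((U z - U (z - (h, 0))) * v z)\<bar> \<le> T * ((U z + U (z - (h, 0))) * (1 / c))"
      unfolding abs_mult using \<zeta>_on_Q[OF True] v_bounds[of z] U_pos[of z] U_pos[of "z - (h, 0)"] T
      by (intro mult_mono) auto
    then show ?thesis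
      using True by (simp add: mult_ac)
  qed (simp add: off_Q)
qed (use T c in auto)

text \<open>
  Integrate \<open>tested_increment\<close> against \<open>\<zeta>\<close> and exchange the integration over the elapsed time \<open>\<sigma>\<close> with that over the
  cylinder.
\<close>

lemma integrated_increment:
  assumes h: "h > 0"
  shows "(LBINT z. \<zeta> (fst z) * ((U z - U (z - (h, 0))) * v z))
    + (LBINT \<sigma>. indicator {0<..<h} \<sigma> * response \<sigma>) = 0"
proof -
  let ?R = "\<lambda>\<sigma> z. \<zeta> (fst z) * (V z \<bullet> G (z - (\<sigma>, 0)) + v z * absorb (z - (\<sigma>, 0)))"
  let ?F = "\<lambda>\<sigma> z. indicator {0<..<h} \<sigma> * ?R \<sigma> z"
  let ?I = "\<lambda>z. \<zeta> (fst z) * ((U z - U (z - (h, 0))) * v z)"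
  note F = response_Fubini[OF h]
  have Fz: "integrable lborel (\<lambda>z. LBINT \<sigma>. ?F \<sigma> z)"
    by (rule lborel_pair.integrable_snd[OF F])
  have "(LBINT \<sigma>. indicator {0<..<h} \<sigma> * response \<sigma>) = (LBINT \<sigma>. LBINT z. ?F \<sigma> z)"
    by (simp add: response_def)
  also have "\<dots> = (LBINT z. LBINT \<sigma>. ?F \<sigma> z)"
    by (rule lborel_pair.Fubini_integral[OF F, symmetric])
  finally have "(LBINT z. ?I z) + (LBINT \<sigma>. indicator {0<..<h} \<sigma> * response \<sigma>)
      = (LBINT z. ?I z + (LBINT \<sigma>. ?F \<sigma> z))"
    using Fz increment_integrable[of h] by simp
  also have "\<dots> = (LBINT t. LBINT x. ?I (t, x) + (LBINT \<sigma>. ?F \<sigma> (t, x)))"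
  proof -
    have "integrable (lborel \<Otimes>\<^sub>M lborel) (\<lambda>(t, x). ?I (t, x) + (LBINT \<sigma>. ?F \<sigma> (t, x)))"
      unfolding lborel_prod using Bochner_Integration.integrable_add[OF increment_integrable[of h] Fz]
      by (simp add: case_prod_unfold del: diff_Pair)
    from lborel_pair.integral_fst[OF this] show ?thesis
      unfolding lborel_prod by (simp add: case_prod_unfold del: diff_Pair)
  qed
  also have "\<dots> = (LINT t|(lborel :: real measure). 0)"
  proof (rule integral_cong_AE)
    have pair: "integrable (lborel \<Otimes>\<^sub>M lborel) (\<lambda>(t, x). ?I (t, x) + (LBINT \<sigma>. ?F \<sigma> (t, x)))"
      unfolding lborel_prod using Bochner_Integration.integrable_add[OF increment_integrable[of h] Fz]
      by (simp add: case_prod_unfold del: diff_Pair)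
    show "(\<lambda>t. LBINT x. ?I (t, x) + (LBINT \<sigma>. ?F \<sigma> (t, x))) \<in> borel_measurable lborel"
      using lborel_pair.integrable_fst[OF pair] by auto
    have int_I: "integrable (lborel \<Otimes>\<^sub>M lborel) (\<lambda>(t, x). ?I (t, x))"
      unfolding lborel_prod using increment_integrable[of h] by (simp add: case_prod_unfold del: diff_Pair)
    have int_F: "integrable (lborel \<Otimes>\<^sub>M lborel) (\<lambda>(t, x). LBINT \<sigma>. ?F \<sigma> (t, x))"
      unfolding lborel_prod using Fz by (simp add: case_prod_unfold del: diff_Pair)
    show "AE t in lborel. (LBINT x. ?I (t, x) + (LBINT \<sigma>. ?F \<sigma> (t, x))) = 0"
      using tested_increment[OF h] lborel_pair.AE_integrable_fst[OF int_I] lborel_pair.AE_integrable_fst[OF int_F]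
    proof eventually_elim
      case (elim t)
      show "(LBINT x. ?I (t, x) + (LBINT \<sigma>. ?F \<sigma> (t, x))) = 0"
      proof (cases "0 < t \<and> t < T")
        case False
        then have "(t, x) \<notin> Q" for x
          by (auto simp: mem_Q)
        then show ?thesis
          by (simp add: off_Q)
      next
        case True
        let ?y = "\<lambda>y. indicator {0<..<h} (fst y) *
          (G (t - fst y, snd y) \<bullet> V (t, snd y) + absorb (t - fst y, snd y) * v (t, snd y))"
        have int_y: "integrable lborel ?y"
          and eq: "(LBINT x. (U (t, x) - U (t - h, x)) * v (t, x)) + (LBINT y. ?y y) = 0"
          using elim(1) True by blast+
        have yp: "integrable (lborel \<Otimes>\<^sub>M lborel) (\<lambda>(\<sigma>, x). ?y (\<sigma>, x))"
          unfolding lborel_prod using int_y by (simp add: case_prod_unfold del: diff_Pair)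
        have F_eq: "?F \<sigma> (t, x) = \<zeta> t * ?y (\<sigma>, x)" for \<sigma> x
          by (simp add: inner_commute mult_ac)
        have "(LBINT x. ?I (t, x) + (LBINT \<sigma>. ?F \<sigma> (t, x)))
            = (LBINT x. ?I (t, x)) + (LBINT x. LBINT \<sigma>. ?F \<sigma> (t, x))"
          using elim(2,3) by (rule Bochner_Integration.integral_add)
        also have "(LBINT x. ?I (t, x)) = \<zeta> t * (LBINT x. (U (t, x) - U (t - h, x)) * v (t, x))"
          by simp
        also have "(LBINT x. LBINT \<sigma>. ?F \<sigma> (t, x)) = \<zeta> t * (LBINT x. LBINT \<sigma>. ?y (\<sigma>, x))"
          unfolding F_eq by (simp only: integral_mult_right_zero)
        also have "(LBINT x. LBINT \<sigma>. ?y (\<sigma>, x)) = (LBINT y. ?y y)"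
          using lborel_pair.integral_snd[OF yp] unfolding lborel_prod by (simp add: case_prod_unfold del: diff_Pair)
        finally show ?thesis
          using eq by (simp flip: distrib_left)
      qed
    qed
  qed simp
  finally show ?thesis
    by simp
qed

text \<open>
  The energy at which \<open>U\<close> is frozen while weight and barrier are advanced by \<open>h\<close>.
\<close>

definition energy :: "real \<Rightarrow> real" where
  "energy h = (LBINT z. indicator Q z * (\<zeta> (fst z + h) * pen (U z * E (z + (h, 0)))))"

lemma pen_UE_le:
  assumes "fst z \<le> T" "snd z \<in> \<Omega>" "u \<ge> 0"
  shows "pen (u * E z) \<le> u / c"
proof -
  have "pen (u * E z) \<le> \<bar>u * E z\<bar>"
    by (rule pen_le)
  also have "\<dots> = u * E z"
    using assms(3) E_pos[of z] by simp
  also have "\<dots> \<le> u * (1 / c)"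
    using E_le[OF assms(1,2)] assms(3) by (intro mult_left_mono) auto
  finally show ?thesis by simp
qed

text \<open>
  A translation in time by \<open>h\<close>. It brings in points at times \<open>t \<le> 0\<close>, where \<open>U = 1\<close> and the barrier is still at most \<open>1\<close>, and
  loses points beyond \<open>T\<close>, where the weight is \<open>0\<close>: neither contributes.
\<close>

lemma energy_shift:
  assumes h: "0 < h" "h \<le> \<tau>\<^sub>0"
  shows "(LBINT z. indicator Q z * (\<zeta> (fst z) * pen (U (z - (h, 0)) * E z))) = energy h"
proof -
  let ?f = "\<lambda>z. indicator Q z * (\<zeta> (fst z) * pen (U (z - (h, 0)) * E z)) :: real"
  have "(LBINT z. ?f z) = (LBINT z. ?f (z - (- h, 0)))"
    by (rule lborel_translation(2)[symmetric]) measurable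
  also have "\<dots> = energy h"
    unfolding energy_def
  proof (intro Bochner_Integration.integral_cong refl)
    fix z :: "real \<times> 'a"
    have s: "z - (- h, 0) = z + (h, 0)" "z + (h, 0) - (h, 0) = z"
      by (auto simp: prod_eq_iff)
    show "?f (z - (- h, 0)) = indicator Q z * (\<zeta> (fst z + h) * pen (U z * E (z + (h, 0))))"
    proof (cases "z \<in> Q")
      case True
      then show ?thesis
        unfolding s by (cases "fst z + h < T") (use h in \<open>auto simp: indicator_def mem_Q \<zeta>_def\<close>)
    next
      case False
      have "pen (U z * E (z + (h, 0))) = 0" if "z + (h, 0) \<in> Q"
      proof -
        have "fst (z + (h, 0)) \<le> \<tau>\<^sub>0" "snd (z + (h, 0)) \<in> \<Omega>"
          using that False h by (auto simp: mem_Q)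
        then have "E (z + (h, 0)) \<le> 1"
          by (rule E_le_1)
        then show ?thesis
          using U_off[OF False] by (simp add: pen_eq_0)
      qed
      then show ?thesis
        unfolding s using False by (auto simp: indicator_def)
    qed
  qed
  finally show ?thesis .
qed

lemma pen_integrable:
  "integrable lborel (\<lambda>z. indicator Q z * (\<zeta> (fst z) * pen (U (z - (h, 0)) * E z)))"
proof (rule integrable_by_shifted_U[where C = "T * (1 / c)" and h = h])
  fix z
  show "\<bar>indicator Q z * (\<zeta> (fst z) * pen (U (z - (h, 0)) * E z))\<bar> \<le> T * (1 / c) * (indicator Q z * U z + indicator Q z * U (z - (h, 0)))"
  proof (cases "z \<in> Q")
    case True
    have "\<zeta> (fst z) * pen (U (z - (h, 0)) * E z) \<le> T * (U (z - (h, 0)) / c)"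
      using \<zeta>_on_Q[OF True] pen_UE_le[of z "U (z - (h, 0))"] True U_pos[of "z - (h, 0)"] T
      by (intro mult_mono) (auto simp: mem_Q pen_nonneg)
    moreover have "0 \<le> \<zeta> (fst z) * pen (U (z - (h, 0)) * E z)"
      using \<zeta>_on_Q[OF True] pen_nonneg by simp
    moreover have "0 \<le> T * (1 / c) * U z"
      using T c U_pos[of z] by simp
    ultimately show ?thesis
      using True by (simp add: distrib_left)
  qed simp
qed (use T c in auto)

text \<open>
  By convexity \<open>(U - U') pen1 (U E) E \<ge> pen (U E) - pen (U' E)\<close>, where \<open>U'\<close> is the value at the earlier time. The barrier is taken at
  the same, later time in both terms; its own change in time appears after the shift, inside \<open>energy h\<close>.
\<close>

lemma energy_inequality:
  assumes h: "0 < h" "h \<le> \<tau>\<^sub>0"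
  shows "(energy 0 - energy h) + (LBINT \<sigma>. indicator {0<..<h} \<sigma> * response \<sigma>) \<le> 0"
proof -
  have "energy 0 - energy h = (LBINT z. indicator Q z * (\<zeta> (fst z) * pen (U z * E z))
      - indicator Q z * (\<zeta> (fst z) * pen (U (z - (h, 0)) * E z)))"
    using pen_integrable[of 0] pen_integrable[of h]
    by (simp add: energy_shift[OF h] energy_def zero_prod_def[symmetric])
  also have "\<dots> \<le> (LBINT z. \<zeta> (fst z) * ((U z - U (z - (h, 0))) * v z))"
  proof (rule integral_mono[OF _ increment_integrable])
    show "integrable lborel (\<lambda>z. indicator Q z * (\<zeta> (fst z) * pen (U z * E z))
      - indicator Q z * (\<zeta> (fst z) * pen (U (z - (h, 0)) * E z)))"
      using pen_integrable[of 0] pen_integrable[of h] by (simp add: zero_prod_def[symmetric])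
    fix z
    show "indicator Q z * (\<zeta> (fst z) * pen (U z * E z)) - indicator Q z * (\<zeta> (fst z) * pen (U (z - (h, 0)) * E z))
        \<le> \<zeta> (fst z) * ((U z - U (z - (h, 0))) * v z)"
    proof (cases "z \<in> Q")
      case True
      have "pen (U z * E z) - pen (U (z - (h, 0)) * E z) \<le> pen1 (U z * E z) * (U z * E z - U (z - (h, 0)) * E z)"
        by (rule pen_convex)
      also have "\<dots> = (U z - U (z - (h, 0))) * v z"
        using True by (simp add: v_def r_def algebra_simps)
      finally have "\<zeta> (fst z) * (pen (U z * E z) - pen (U (z - (h, 0)) * E z)) \<le> \<zeta> (fst z) * ((U z - U (z - (h, 0))) * v z)"
        using \<zeta>_on_Q[OF True] by (intro mult_left_mono) auto
      then show ?thesis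
        using True by (simp add: right_diff_distrib)
    qed (simp add: off_Q)
  qed
  finally show ?thesis
    using integrated_increment[OF h(1)] by simp
qed

text \<open>
  For almost every point only \<open>\<zeta>\<close> and \<open>E\<close> vary with \<open>h\<close>, and both are explicit. The difference quotients are dominated
  by a multiple of \<open>U\<close>.
\<close>

lemma energy_derivative:
  assumes h: "\<And>n. 0 < h n" "h \<longlonglongrightarrow> 0"
  shows "(\<lambda>n. (energy 0 - energy (h n)) / h n) \<longlonglongrightarrow>
    (LBINT z. indicator Q z * (pen (r z) - \<zeta> (fst z) * (pen1 (r z) * (r z * (\<mu> * \<beta> z)))))"
    and "integrable lborel (\<lambda>z. indicator Q z * (pen (r z) - \<zeta> (fst z) * (pen1 (r z) * (r z * (\<mu> * \<beta> z)))))"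
proof -
  obtain C where C: "C > 0" "\<And>z. fst z \<le> T \<Longrightarrow> snd z \<in> \<Omega> \<Longrightarrow> \<bar>\<beta> z\<bar> \<le> C"
    using \<beta>_bound by metis
  let ?k = "\<lambda>s z. \<zeta> (fst z + s) * pen (U z * E (z + (s, 0)))"
  let ?d = "\<lambda>z. pen (r z) - \<zeta> (fst z) * (pen1 (r z) * (r z * (\<mu> * \<beta> z)))"
  let ?q = "\<lambda>n z. indicator Q z * ((?k 0 z - ?k (h n) z) / h n)"
  let ?w = "\<lambda>z. (1 / c + T * (\<bar>\<mu>\<bar> * C * (1 / c))) * (indicator Q z * U z)"
  have w: "integrable lborel ?w"
    using U_int by (rule integrable_mult_right)
  have E_diff: "\<bar>E (z + (s, 0)) - E z\<bar> \<le> s * (\<bar>\<mu>\<bar> * C * (1 / c))"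
    if z: "z \<in> Q" and s: "0 < s" "fst z + s \<le> T" for z s
  proof -
    obtain \<xi> where \<xi>: "fst z < \<xi>" "\<xi> < fst z + s"
      "E (fst z + s, snd z) - E (fst z, snd z) = (fst z + s - fst z) * (\<mu> * \<beta> (\<xi>, snd z) * E (\<xi>, snd z))"
      using MVT2[of "fst z" "fst z + s" "\<lambda>s. E (s, snd z)" "\<lambda>s. \<mu> * \<beta> (s, snd z) * E (s, snd z)"]
        E_time_derivative[of "snd z"] s(1) by auto
    have "\<bar>\<mu> * \<beta> (\<xi>, snd z) * E (\<xi>, snd z)\<bar> \<le> \<bar>\<mu>\<bar> * C * (1 / c)"
      unfolding abs_mult using C E_le[of "(\<xi>, snd z)"] E_pos[of "(\<xi>, snd z)"] \<xi> s z
      by (intro mult_mono) (auto simp: mem_Q)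
    then have "\<bar>(fst z + s - fst z) * (\<mu> * \<beta> (\<xi>, snd z) * E (\<xi>, snd z))\<bar> \<le> s * (\<bar>\<mu>\<bar> * C * (1 / c))"
      using s(1) unfolding abs_mult[of "fst z + s - fst z"] by (intro mult_mono) auto
    then show ?thesis
      using \<xi>(3) by (cases z) simp
  qed
  have lim: "(\<lambda>n. ?q n z) \<longlonglongrightarrow> indicator Q z * ?d z" for z
  proof (cases "z \<in> Q")
    case True
    have "((\<lambda>s. (T - (fst z + s)) * pen (U z * E (fst z + s, snd z))) has_real_derivative
        (T - (fst z + 0)) * (pen1 (U z * E (fst z + 0, snd z)) * (U z * ((\<mu> * \<beta> (fst z + 0, snd z) * E (fst z + 0, snd z)) * (0 + 1))))
        + (0 - (0 + 1)) * pen (U z * E (fst z + 0, snd z))) (at 0)"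
      by (intro DERIV_mult' DERIV_diff DERIV_add DERIV_const DERIV_ident DERIV_cmult
          DERIV_chain2[of pen] pen_deriv DERIV_chain2[of "\<lambda>s. E (s, snd z)"] E_time_derivative)
    then have "((\<lambda>s. (T - (fst z + s)) * pen (U z * E (fst z + s, snd z))) has_real_derivative - ?d z) (at 0)"
      using True by (simp add: r_def \<zeta>_def mem_Q algebra_simps)
    then have "((\<lambda>s. ((T - (fst z + s)) * pen (U z * E (fst z + s, snd z)) - (T - fst z) * pen (U z * E z)) / s)
        \<longlongrightarrow> - ?d z) (at 0)"
      by (simp add: DERIV_def)
    moreover have "filterlim h (at 0) sequentially"
      unfolding filterlim_at using h by (auto intro!: always_eventually simp: less_imp_neq[symmetric])
    ultimately have "(\<lambda>n. ((T - (fst z + h n)) * pen (U z * E (fst z + h n, snd z)) - (T - fst z) * pen (U z * E z)) / h n) \<longlonglongrightarrow> - ?d z"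
      by (rule filterlim_compose)
    from tendsto_minus[OF this]
    have "(\<lambda>n. - (((T - (fst z + h n)) * pen (U z * E (fst z + h n, snd z)) - (T - fst z) * pen (U z * E z)) / h n)) \<longlonglongrightarrow> ?d z"
      by simp
    moreover have "eventually (\<lambda>n. - (((T - (fst z + h n)) * pen (U z * E (fst z + h n, snd z)) - (T - fst z) * pen (U z * E z)) / h n)
        = (?k 0 z - ?k (h n) z) / h n) sequentially"
    proof -
      have "eventually (\<lambda>n. h n < T - fst z) sequentially"
        using order_tendstoD(2)[OF h(2), of "T - fst z"] True by (auto simp: mem_Q)
      then show ?thesis
      proof eventually_elim
        case (elim n)
        have "z + (h n, 0) = (fst z + h n, snd z)" "z + (0, 0) = z"
          by (auto simp: prod_eq_iff)
        then show ?case
          using elim True h(1)[of n] by (simp add: \<zeta>_def mem_Q field_simps)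
      qed
    qed
    ultimately have "(\<lambda>n. (?k 0 z - ?k (h n) z) / h n) \<longlonglongrightarrow> ?d z"
      by (rule Lim_transform_eventually)
    then show ?thesis
      using True by simp
  qed simp
  have bound: "\<bar>?q n z\<bar> \<le> ?w z" for n z
  proof (cases "z \<in> Q")
    case True
    have z0: "z + (0, 0) = z"
      by (auto simp: prod_eq_iff)
    have p: "0 \<le> pen (U z * E z)" "pen (U z * E z) \<le> U z / c"
      using pen_nonneg pen_UE_le[of z "U z"] U_pos[of z] True by (auto simp: mem_Q)
    have U: "U z > 0"
      by (rule U_pos)
    have \<zeta>: "0 \<le> \<zeta> (fst z)" "\<zeta> (fst z) \<le> T"
      using \<zeta>_on_Q[OF True] by auto
    have "\<bar>?k 0 z - ?k (h n) z\<bar> \<le> h n * ((1 / c + T * (\<bar>\<mu>\<bar> * C * (1 / c))) * U z)"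
    proof (cases "fst z + h n < T")
      case le: True
      have "\<bar>pen (U z * E z) - pen (U z * E (z + (h n, 0)))\<bar> \<le> \<bar>U z * E z - U z * E (z + (h n, 0))\<bar>"
        by (rule pen_Lipschitz)
      also have "\<dots> = U z * \<bar>E (z + (h n, 0)) - E z\<bar>"
        using U by (simp add: abs_mult abs_minus_commute flip: right_diff_distrib)
      also have "\<dots> \<le> U z * (h n * (\<bar>\<mu>\<bar> * C * (1 / c)))"
        using E_diff[OF True h(1)[of n]] le U by (intro mult_left_mono) auto
      finally have pd: "\<bar>pen (U z * E z) - pen (U z * E (z + (h n, 0)))\<bar> \<le> U z * (h n * (\<bar>\<mu>\<bar> * C * (1 / c)))" .
      have "?k 0 z - ?k (h n) z = (\<zeta> (fst z) - \<zeta> (fst z + h n)) * pen (U z * E z)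
          + \<zeta> (fst z + h n) * (pen (U z * E z) - pen (U z * E (z + (h n, 0))))"
        by (simp add: z0 algebra_simps)
      also have "\<bar>\<dots>\<bar> \<le> \<bar>\<zeta> (fst z) - \<zeta> (fst z + h n)\<bar> * \<bar>pen (U z * E z)\<bar>
          + \<bar>\<zeta> (fst z + h n)\<bar> * \<bar>pen (U z * E z) - pen (U z * E (z + (h n, 0)))\<bar>"
        using abs_triangle_ineq by (simp only: abs_mult[symmetric])
      also have "\<dots> \<le> h n * (U z / c) + T * (U z * (h n * (\<bar>\<mu>\<bar> * C * (1 / c))))"
        using p pd le True h(1)[of n] T U C(1) c by (intro add_mono mult_mono) (auto simp: \<zeta>_def mem_Q)
      also have "\<dots> = h n * ((1 / c + T * (\<bar>\<mu>\<bar> * C * (1 / c))) * U z)"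
        by (simp add: algebra_simps)
      finally show ?thesis .
    next
      case False
      then have "\<zeta> (fst z + h n) = 0" "\<zeta> (fst z) \<le> h n"
        using h(1)[of n] by (auto simp: \<zeta>_def)
      moreover have "\<zeta> (fst z) * pen (U z * E z) \<le> h n * (U z / c)"
        using calculation(2) p h(1)[of n] by (intro mult_mono) auto
      ultimately have "\<bar>?k 0 z - ?k (h n) z\<bar> \<le> h n * (U z / c)"
        using p \<zeta> by (simp add: z0 abs_mult)
      also have "\<dots> \<le> h n * ((1 / c + T * (\<bar>\<mu>\<bar> * C * (1 / c))) * U z)"
        using T c C U h(1)[of n] by (intro mult_left_mono) (auto simp: distrib_right)
      finally show ?thesis .
    qed
    then have "\<bar>?k 0 z - ?k (h n) z\<bar> / h n \<le> (1 / c + T * (\<bar>\<mu>\<bar> * C * (1 / c))) * U z"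
      using h(1)[of n] by (simp add: pos_divide_le_eq mult.commute)
    then show ?thesis
      using True h(1)[of n] by (simp add: abs_divide)
  qed simp
  have meas: "?q n \<in> borel_measurable lborel" "(\<lambda>z. indicator Q z * ?d z) \<in> borel_measurable lborel" for n
    by measurable
  have "(\<lambda>n. LBINT z. ?q n z) \<longlonglongrightarrow> (LBINT z. indicator Q z * ?d z)"
    by (rule integral_dominated_convergence[OF meas(2,1) w]) (use lim bound in auto)
  moreover have q_eq: "(LBINT z. ?q n z) = (energy 0 - energy (h n)) / h n" for n
  proof -
    have k_int: "integrable lborel (\<lambda>z. indicator Q z * ?k 0 z)"
      using pen_integrable[of 0] by (simp add: zero_prod_def[symmetric])
    have q_int: "integrable lborel (?q n)"
      by (rule Bochner_Integration.integrable_bound[OF w meas(1)])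
        (use bound in \<open>auto intro!: AE_I2 order_trans[OF _ abs_ge_self]\<close>)
    have eq: "(\<lambda>z. indicator Q z * ?k (h n) z) = (\<lambda>z. indicator Q z * ?k 0 z - h n * ?q n z)"
      using h(1)[of n] by (auto simp: field_simps)
    have "energy (h n) = (LBINT z. indicator Q z * ?k 0 z - h n * ?q n z)"
      unfolding energy_def by (simp only: eq)
    also have "\<dots> = (LBINT z. indicator Q z * ?k 0 z) - h n * (LBINT z. ?q n z)"
      by (simp only: Bochner_Integration.integral_diff[OF k_int integrable_mult_right[OF q_int]] integral_mult_right_zero)
    finally have "energy (h n) = energy 0 - h n * (LBINT z. ?q n z)"
      unfolding energy_def .
    then show ?thesis
      using h(1)[of n] by simp
  qed
  ultimately show "(\<lambda>n. (energy 0 - energy (h n)) / h n) \<longlonglongrightarrow> (LBINT z. indicator Q z * ?d z)"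
    by (simp only: q_eq)
  show "integrable lborel (\<lambda>z. indicator Q z * ?d z)"
  proof (rule integrable_dominated_convergence[where s = ?q, OF meas(2,1) w])
    show "AE z in lborel. (\<lambda>n. ?q n z) \<longlonglongrightarrow> indicator Q z * ?d z"
      by (intro AE_I2 lim)
    show "AE z in lborel. norm (?q n z) \<le> ?w z" for n
      unfolding real_norm_def by (intro AE_I2 bound)
  qed
qed

lemma response_tendsto: "(response \<longlongrightarrow> response 0) (at_right 0)"
proof -
  have shift: "filterlim (\<lambda>\<sigma>::real. (\<sigma>, 0 :: 'a)) (at 0) (at_right 0)"
  proof -
    have "((\<lambda>\<sigma>::real. (\<sigma>, 0 :: 'a)) \<longlongrightarrow> (0, 0)) (at_right 0)"
      by (intro tendsto_intros)
    then show ?thesis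
      unfolding filterlim_at by (auto simp: zero_prod_def eventually_at_right_less intro: eventually_mono[OF eventually_at_right_less[of 0]])
  qed
  have \<zeta>V: "L2 lborel (\<lambda>z. \<zeta> (fst z) *\<^sub>R V z)"
  proof (rule L2_bound[where w = "\<lambda>z. T\<^sup>2 * (norm (V z))\<^sup>2"])
    show "AE z in lborel. (norm (\<zeta> (fst z) *\<^sub>R V z))\<^sup>2 \<le> T\<^sup>2 * (norm (V z))\<^sup>2"
    proof (intro AE_I2)
      fix z
      show "(norm (\<zeta> (fst z) *\<^sub>R V z))\<^sup>2 \<le> T\<^sup>2 * (norm (V z))\<^sup>2"
      proof (cases "z \<in> Q")
        case True
        have "norm (\<zeta> (fst z) *\<^sub>R V z) \<le> T * norm (V z)"
          using \<zeta>_on_Q[OF True] by (auto intro!: mult_right_mono)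
        then have "(norm (\<zeta> (fst z) *\<^sub>R V z))\<^sup>2 \<le> (T * norm (V z))\<^sup>2"
          by (intro power_mono) auto
        then show ?thesis
          by (simp add: power_mult_distrib)
      qed (simp add: off_Q)
    qed
  qed (use V_L2 in \<open>auto simp: L2_def\<close>)
  have \<zeta>v: "norm (\<zeta> (fst z) * v z) \<le> T * (1 / c)" for z
  proof (cases "z \<in> Q")
    case True
    have "\<bar>\<zeta> (fst z)\<bar> * \<bar>v z\<bar> \<le> T * (1 / c)"
      using \<zeta>_on_Q[OF True] v_bounds[of z] T by (intro mult_mono) auto
    then show ?thesis
      by (simp add: abs_mult)
  qed (use T c in \<open>simp add: off_Q\<close>)
  note 1 = filterlim_compose[OF translation_pairing_L2[OF G_integrable G_L2 \<zeta>V] shift]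
  have 2: "((\<lambda>\<sigma>. LBINT z. (\<zeta> (fst z) * v z) \<bullet> absorb (z - (\<sigma>, 0))) \<longlongrightarrow> (LBINT z. (\<zeta> (fst z) * v z) \<bullet> absorb z)) (at_right 0)"
    by (rule filterlim_compose[OF translation_pairing_bounded[OF absorb_integrable _ \<zeta>v] shift]) measurable
  have "response \<sigma> = (LBINT z. (\<zeta> (fst z) *\<^sub>R V z) \<bullet> G (z - (\<sigma>, 0))) + (LBINT z. (\<zeta> (fst z) * v z) \<bullet> absorb (z - (\<sigma>, 0)))" for \<sigma>
  proof -
    have i1: "integrable lborel (\<lambda>z. (\<zeta> (fst z) *\<^sub>R V z) \<bullet> G (z - (\<sigma>, 0)))"
      by (intro L2_inner_integrable[OF \<zeta>V] L2_translation(1)[OF G_L2])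
    have i2: "integrable lborel (\<lambda>z. (\<zeta> (fst z) * v z) \<bullet> absorb (z - (\<sigma>, 0)))"
    proof (rule Bochner_Integration.integrable_bound)
      show "integrable lborel (\<lambda>z. T * (1 / c) * absorb (z - (\<sigma>, 0)))"
        using absorb_integrable lborel_translation(1)[of absorb "(\<sigma>, 0)"] by (intro integrable_mult_right) simp
      show "AE z in lborel. norm ((\<zeta> (fst z) * v z) \<bullet> absorb (z - (\<sigma>, 0))) \<le> norm (T * (1 / c) * absorb (z - (\<sigma>, 0)))"
        using \<zeta>v T c by (intro AE_I2) (simp only: inner_real_def norm_mult, intro mult_right_mono, auto)
    qed measurable
    show ?thesis
      unfolding response_def Bochner_Integration.integral_add[OF i1 i2, symmetric]
      by (simp add: distrib_left mult.assoc)
  qed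
  then have "response = (\<lambda>\<sigma>. (LBINT z. (\<zeta> (fst z) *\<^sub>R V z) \<bullet> G (z - (\<sigma>, 0)))
      + (LBINT z. (\<zeta> (fst z) * v z) \<bullet> absorb (z - (\<sigma>, 0))))"
    by (rule ext)
  then show ?thesis
    using tendsto_add[OF 1 2] by (simp add: zero_prod_def[symmetric])
qed

lemma flux_integrable:
  "integrable lborel (\<lambda>z. \<zeta> (fst z) * (indicator Q z * (\<mu> * \<beta> z * (r z * pen1 (r z))
        + \<beta> z * ((pen1 (r z) + r z * pen2 (r z)) * (Dr z \<bullet> e)))))"
proof -
  obtain C where C: "C > 0" "\<And>z. fst z \<le> T \<Longrightarrow> snd z \<in> \<Omega> \<Longrightarrow> \<bar>\<beta> z\<bar> \<le> C"
    using \<beta>_bound by metis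
  let ?w = "\<lambda>z. T * (\<bar>\<mu>\<bar> * C * (1 / c) * (indicator Q z * U z) + C * (9 * ((1 / c) * norm (G z) + (1 / c * C) * (indicator Q z * U z))))"
  show ?thesis
  proof (rule Bochner_Integration.integrable_bound)
    show "integrable lborel ?w"
      using U_int G_integrable by (intro integrable_mult_right Bochner_Integration.integrable_add) auto
    show "AE z in lborel. norm (\<zeta> (fst z) * (indicator Q z * (\<mu> * \<beta> z * (r z * pen1 (r z))
        + \<beta> z * ((pen1 (r z) + r z * pen2 (r z)) * (Dr z \<bullet> e))))) \<le> norm (?w z)"
    proof (intro AE_I2)
      fix z
      show "norm (\<zeta> (fst z) * (indicator Q z * (\<mu> * \<beta> z * (r z * pen1 (r z))
        + \<beta> z * ((pen1 (r z) + r z * pen2 (r z)) * (Dr z \<bullet> e))))) \<le> norm (?w z)"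
      proof (cases "z \<in> Q")
        case True
        have \<beta>: "\<bar>\<beta> z\<bar> \<le> C" and E: "E z \<le> 1 / c" "E z > 0" and U: "U z > 0"
          using C(2)[of z] E_le[of z] E_pos U_pos True by (auto simp: mem_Q)
        have r: "0 < r z" "r z \<le> (1 / c) * U z"
          using r_pos mult_right_mono[OF E(1), of "U z"] U by (auto simp: r_def mult.commute)
        have D: "\<bar>Dr z \<bullet> e\<bar> \<le> (1 / c) * norm (G z) + (1 / c * C) * U z"
        proof -
          have "\<bar>Dr z \<bullet> e\<bar> \<le> norm (Dr z)"
            using Cauchy_Schwarz_ineq2[of "Dr z" e] e by simp
          also have "\<dots> \<le> \<bar>E z\<bar> * norm (G z) + \<bar>r z * \<beta> z\<bar>"
            unfolding Dr_def by (rule order_trans[OF norm_triangle_ineq]) (simp add: e)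
          also have "\<dots> \<le> (1 / c) * norm (G z) + ((1 / c) * U z) * C"
            unfolding abs_mult[of "r z"] using E r \<beta> C(1) c U by (intro add_mono mult_mono) auto
          finally show ?thesis
            by (simp add: mult_ac)
        qed
        have 1: "\<bar>\<mu> * \<beta> z * (r z * pen1 (r z))\<bar> \<le> \<bar>\<mu>\<bar> * C * (((1 / c) * U z) * 1)"
          unfolding abs_mult using \<beta> r pen1_bounds[of "r z"] C(1) by (intro mult_mono) auto
        have 2: "\<bar>\<beta> z * ((pen1 (r z) + r z * pen2 (r z)) * (Dr z \<bullet> e))\<bar> \<le> C * (9 * ((1 / c) * norm (G z) + (1 / c * C) * U z))"
          unfolding abs_mult using \<beta> D pen1_bounds[of "r z"] pen2_bounds(3,4)[of "r z"] C(1) by (intro mult_mono) auto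
        have "\<bar>\<mu> * \<beta> z * (r z * pen1 (r z)) + \<beta> z * ((pen1 (r z) + r z * pen2 (r z)) * (Dr z \<bullet> e))\<bar>
            \<le> \<bar>\<mu>\<bar> * C * (((1 / c) * U z) * 1) + C * (9 * ((1 / c) * norm (G z) + (1 / c * C) * U z))"
          using 1 2 by linarith
        then have "\<bar>\<zeta> (fst z) * (\<mu> * \<beta> z * (r z * pen1 (r z)) + \<beta> z * ((pen1 (r z) + r z * pen2 (r z)) * (Dr z \<bullet> e)))\<bar>
            \<le> T * (\<bar>\<mu>\<bar> * C * (((1 / c) * U z) * 1) + C * (9 * ((1 / c) * norm (G z) + (1 / c * C) * U z)))"
          unfolding abs_mult[of "\<zeta> (fst z)"] using \<zeta>_on_Q[OF True] T by (intro mult_mono) auto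
        also have "\<dots> = ?w z"
          using True by simp
        finally show ?thesis
          using True by simp
      qed simp
    qed
  qed measurable
qed

text \<open>
  In the limit \<open>h \<longlonglongrightarrow> 0\<close> the energy inequality, to which the integrated \<open>flux_identity\<close> is added, bounds the integral of \<open>pen r\<close>
  plus the nonnegative dissipation by \<open>0\<close>.
\<close>

theorem comparison: "AE z in lborel. z \<in> Q \<longrightarrow> U z * E z \<le> 1"
proof -
  let ?d = "\<lambda>z. indicator Q z * (pen (r z) - \<zeta> (fst z) * (pen1 (r z) * (r z * (\<mu> * \<beta> z))))"
  let ?j = "\<lambda>z. \<zeta> (fst z) * (V z \<bullet> G z + v z * absorb z)"
  let ?f = "\<lambda>z. \<zeta> (fst z) * (indicator Q z * (\<mu> * \<beta> z * (r z * pen1 (r z))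
        + \<beta> z * ((pen1 (r z) + r z * pen2 (r z)) * (Dr z \<bullet> e))))"
  define h where "h n = \<tau>\<^sub>0 * inverse (real (Suc n))" for n
  have h: "0 < h n" "h n \<le> \<tau>\<^sub>0" for n
    using \<tau>\<^sub>0 by (auto simp: h_def field_simps)
  have h0: "h \<longlonglongrightarrow> 0"
    using tendsto_mult_right_zero[OF LIMSEQ_inverse_real_of_nat, of \<tau>\<^sub>0] by (simp add: h_def[abs_def])
  have j_int: "integrable lborel ?j"
  proof (rule Bochner_Integration.integrable_bound)
    show "integrable lborel (\<lambda>z. T * ((norm (V z))\<^sup>2 + (norm (G z))\<^sup>2 + (1 / c) * \<bar>absorb z\<bar>))"
      using V_L2 G_L2 absorb_integrable by (auto simp: L2_def)
    show "AE z in lborel. norm (?j z) \<le> norm (T * ((norm (V z))\<^sup>2 + (norm (G z))\<^sup>2 + (1 / c) * \<bar>absorb z\<bar>))"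
      using order_trans[OF response_integrand_le abs_ge_self] by (intro AE_I2) (simp only: real_norm_def)
  qed measurable
  have r0: "response 0 = (LBINT z. ?j z)"
    by (simp add: response_def zero_prod_def[symmetric])
  have "(LBINT z. ?d z) + response 0 \<le> 0"
  proof (rule average_tendsto_le[where J = response and D = "\<lambda>h. energy 0 - energy h" and h = h])
    show "integrable lborel (\<lambda>\<sigma>. indicator {0<..<h} \<sigma> * response \<sigma>)" if "h > 0" for h
      using lborel_pair.integrable_fst[OF response_Fubini[OF that]] by (simp add: response_def)
  qed (use response_tendsto h h0 energy_derivative(1)[OF h(1) h0] energy_inequality in auto)
  moreover have "(LBINT z. ?f z) = 0"
  proof -
    have fp: "integrable (lborel \<Otimes>\<^sub>M lborel) (\<lambda>(t, x). ?f (t, x))"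
      unfolding lborel_prod using flux_integrable by (simp add: case_prod_unfold del: diff_Pair)
    have "(LBINT z. ?f z) = (LBINT t. LBINT x. ?f (t, x))"
      using lborel_pair.integral_fst[OF fp] unfolding lborel_prod by (simp add: case_prod_unfold del: diff_Pair)
    also have "\<dots> = (LINT t|(lborel :: real measure). 0)"
    proof (rule integral_cong_AE)
      show "(\<lambda>t. LBINT x. ?f (t, x)) \<in> borel_measurable lborel"
        using lborel_pair.integrable_fst[OF fp] by auto
      show "AE t in lborel. (LBINT x. ?f (t, x)) = 0"
        using flux_identity
      proof eventually_elim
        case (elim t)
        show ?case
        proof (cases "0 < t \<and> t < T")
          case True
          then show ?thesis
            using elim by simp
        next
          case False
          then have "(t, x) \<notin> Q" for x
            by (auto simp: mem_Q)
          then show ?thesis by simp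
        qed
      qed
    qed simp
    finally show ?thesis by simp
  qed
  ultimately have le: "(LBINT z. ?d z + ?j z + ?f z) \<le> 0"
    using energy_derivative(2)[OF h(1) h0] j_int flux_integrable by (simp add: r0)
  have pw: "indicator Q z * pen (r z) \<le> ?d z + ?j z + ?f z" for z
  proof (cases "z \<in> Q")
    case True
    have "?d z + ?j z + ?f z = pen (r z) + \<zeta> (fst z) * (\<beta> z * ((pen1 (r z) + r z * pen2 (r z)) * (Dr z \<bullet> e))
        + pen1 (r z) * E z * absorb z
        + ((pen2 (r z) * E z) *\<^sub>R Dr z + (pen1 (r z) * (\<beta> z * E z)) *\<^sub>R e) \<bullet> G z)"
      using True by (simp add: v_def V_def algebra_simps)
    also have "\<dots> \<ge> pen (r z)"
      using mult_nonneg_nonneg[OF _ dissipation_nonneg[of z], of "\<zeta> (fst z)"] \<zeta>_on_Q[OF True] by simp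
    finally show ?thesis
      using True by simp
  qed (simp add: off_Q)
  have sum_int: "integrable lborel (\<lambda>z. ?d z + ?j z + ?f z)"
    using energy_derivative(2)[OF h(1) h0] j_int flux_integrable by (intro Bochner_Integration.integrable_add)
  have nn: "0 \<le> indicator Q z * pen (r z)" for z
    by (simp add: pen_nonneg)
  have pen_int: "integrable lborel (\<lambda>z. indicator Q z * pen (r z))"
    by (rule Bochner_Integration.integrable_bound[OF sum_int]) (use pw nn in \<open>auto intro!: AE_I2 order_trans[OF _ abs_ge_self]\<close>)
  have "(LBINT z. indicator Q z * pen (r z)) \<le> (LBINT z. ?d z + ?j z + ?f z)"
    by (rule integral_mono[OF pen_int sum_int pw])
  then have "(LBINT z. indicator Q z * pen (r z)) = 0"
    using le Bochner_Integration.integral_nonneg[of lborel "\<lambda>z. indicator Q z * pen (r z)"] nn by (intro antisym) auto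
  then have "AE z in lborel. indicator Q z * pen (r z) = 0"
    using integral_nonneg_eq_0_iff_AE[OF pen_int] nn by simp
  then show ?thesis
  proof eventually_elim
    case (elim z)
    show ?case
    proof
      assume "z \<in> Q"
      then have "pen (r z) = 0"
        using elim by simp
      then show "U z * E z \<le> 1"
        using pen_pos[of "r z"] by (force simp: r_def not_le[symmetric])
    qed
  qed
qed

end

section \<open>Weak derivatives in time\<close>

lemma flat_0_tendsto_1: "(flat 0 \<longlongrightarrow> 1) at_top"
proof -
  have "((\<lambda>s::real. exp (- inverse s)) \<longlongrightarrow> exp (- 0)) at_top"
    by (intro tendsto_exp tendsto_minus tendsto_inverse_0_at_top filterlim_ident)
  moreover have "eventually (\<lambda>s::real. exp (- inverse s) = flat 0 s) at_top"
    using eventually_gt_at_top[of 0] by eventually_elim (simp add: flat_def)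
  ultimately show ?thesis
    by (simp add: Lim_transform_eventually)
qed

lemma flat_measurable [measurable]: "flat j \<in> borel_measurable borel"
  by (rule borel_measurable_smooth[OF smooth_flat])

text \<open>
  \<open>flat 2\<close> is the derivative of \<open>flat 0\<close>, which increases from \<open>0\<close> to \<open>1\<close>.
\<close>

lemma flat_2_mass: "integrable lborel (flat 2)" "(LBINT s. flat 2 s) = 1"
proof -
  have d: "(flat 0 has_real_derivative flat 2 s) (at s)" for s
    using flat_deriv[of 0 s] by (simp add: numeral_2_eq_2)
  have "(\<integral>\<^sup>+s. ennreal (flat 2 s) * indicator {0..} s \<partial>lborel) = ennreal (1 - flat 0 0)"
    by (rule nn_integral_FTC_atLeast) (auto simp: d flat_nonneg flat_0_tendsto_1)
  also have "(\<lambda>s. ennreal (flat 2 s) * indicator {0..} s) = (\<lambda>s. ennreal (flat 2 s))"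
    by (auto simp: indicator_def flat_eq_0)
  finally have "(\<integral>\<^sup>+s. ennreal (flat 2 s) \<partial>lborel) = ennreal 1"
    by (simp add: flat_eq_0)
  then have "has_bochner_integral lborel (flat 2) 1"
    by (intro has_bochner_integral_nn_integral) (auto simp: flat_nonneg)
  then show "integrable lborel (flat 2)" "(LBINT s. flat 2 s) = 1"
    by (auto simp: has_bochner_integral_iff)
qed

text \<open>
  \<open>flat 2\<close> has mass \<open>1\<close>, so its rescalings act as an approximate identity. The factor \<open>flat 0\<close> stems from the other
  edge of the bump function and tends to \<open>1\<close>.
\<close>

lemma mollified_limit:
  fixes Y :: "real \<Rightarrow> real"
  assumes Y: "continuous_on UNIV Y" "\<And>s. \<bar>Y s\<bar> \<le> M" and L: "L > 0" and \<epsilon>: "\<epsilon> = 1 \<or> \<epsilon> = - 1"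
  shows "(\<lambda>k. LBINT s. flat 2 s * flat 0 (real (Suc k) * L - s) * Y (a + \<epsilon> * (s / real (Suc k)))) \<longlonglongrightarrow> Y a"
proof -
  have [measurable]: "Y \<in> borel_measurable borel"
    using Y(1) by (rule borel_measurable_continuous_onI)
  have "(\<lambda>k. LBINT s. flat 2 s * flat 0 (real (Suc k) * L - s) * Y (a + \<epsilon> * (s / real (Suc k))))
      \<longlonglongrightarrow> (LBINT s. flat 2 s * 1 * Y a)"
  proof (rule integral_dominated_convergence[where w = "\<lambda>s. flat 2 s * M"])
    show "integrable lborel (\<lambda>s. flat 2 s * M)"
      using flat_2_mass(1) by simp
    show "AE s in lborel. (\<lambda>k. flat 2 s * flat 0 (real (Suc k) * L - s) * Y (a + \<epsilon> * (s / real (Suc k)))) \<longlonglongrightarrow> flat 2 s * 1 * Y a"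
    proof (intro AE_I2 tendsto_mult tendsto_const)
      fix s
      have "filterlim (\<lambda>k. real (Suc k)) at_top sequentially"
        by (rule filterlim_compose[OF filterlim_real_sequentially filterlim_Suc])
      then have "filterlim (\<lambda>k. L * real (Suc k)) at_top sequentially"
        by (rule filterlim_tendsto_pos_mult_at_top[OF tendsto_const L])
      then have "filterlim (\<lambda>k. - s + L * real (Suc k)) at_top sequentially"
        by (rule filterlim_tendsto_add_at_top[OF tendsto_const])
      then have "filterlim (\<lambda>k. real (Suc k) * L - s) at_top sequentially"
        by (simp add: mult.commute)
      then show "(\<lambda>k. flat 0 (real (Suc k) * L - s)) \<longlonglongrightarrow> 1"
        by (rule filterlim_compose[OF flat_0_tendsto_1])
      have "(\<lambda>k. a + \<epsilon> * (s * inverse (real (Suc k)))) \<longlonglongrightarrow> a + \<epsilon> * (s * 0)"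
        by (intro tendsto_intros LIMSEQ_inverse_real_of_nat)
      then have "(\<lambda>k. a + \<epsilon> * (s / real (Suc k))) \<longlonglongrightarrow> a"
        by (simp add: divide_inverse)
      then show "(\<lambda>k. Y (a + \<epsilon> * (s / real (Suc k)))) \<longlonglongrightarrow> Y a"
        by (intro continuous_on_tendsto_compose[OF Y(1)]) auto
    qed
    show "AE s in lborel. norm (flat 2 s * flat 0 (real (Suc k) * L - s) * Y (a + \<epsilon> * (s / real (Suc k)))) \<le> flat 2 s * M" for k
    proof (intro AE_I2)
      fix s
      have "\<bar>flat 0 (real (Suc k) * L - s)\<bar> * \<bar>Y (a + \<epsilon> * (s / real (Suc k)))\<bar> \<le> 1 * M"
        using flat_nonneg[of 0] flat_0_le_1 Y(2) by (intro mult_mono) auto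
      then have "flat 2 s * (\<bar>flat 0 (real (Suc k) * L - s)\<bar> * \<bar>Y (a + \<epsilon> * (s / real (Suc k)))\<bar>) \<le> flat 2 s * M"
        by (intro mult_left_mono) (auto simp: flat_nonneg)
      then show "norm (flat 2 s * flat 0 (real (Suc k) * L - s) * Y (a + \<epsilon> * (s / real (Suc k)))) \<le> flat 2 s * M"
        by (simp add: abs_mult flat_nonneg mult.assoc)
    qed
  qed measurable
  then show ?thesis
    by (simp add: flat_2_mass)
qed

lemma bump_real: "bump a b k x = flat 0 (real k * (x - a)) * flat 0 (real k * (b - x))" for a b x :: real
  by (simp add: bump_def)

lemma grad_bump_real:
  "grad (bump a b k) x = real k * (flat 2 (real k * (x - a)) * flat 0 (real k * (b - x)))
     - real k * (flat 0 (real k * (x - a)) * flat 2 (real k * (b - x)))" for a b x :: real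
proof (rule gradI)
  have d: "(flat 0 has_real_derivative flat 2 s) (at s)" for s
    using flat_deriv[of 0 s] by (simp add: numeral_2_eq_2)
  have "((\<lambda>x. flat 0 (real k * (x - a)) * flat 0 (real k * (b - x))) has_real_derivative
      flat 0 (real k * (x - a)) * (flat 2 (real k * (b - x)) * (real k * (0 - 1)))
      + (flat 2 (real k * (x - a)) * (real k * (1 - 0))) * flat 0 (real k * (b - x))) (at x)"
    by (intro DERIV_mult' DERIV_chain2[of "flat 0"] d DERIV_cmult DERIV_diff DERIV_const DERIV_ident)
  then show "(bump a b k has_derivative (\<lambda>h. (real k * (flat 2 (real k * (x - a)) * flat 0 (real k * (b - x)))
     - real k * (flat 0 (real k * (x - a)) * flat 2 (real k * (b - x)))) \<bullet> h)) (at x)"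
    unfolding has_field_derivative_def bump_real[abs_def]
    by (rule has_derivative_eq_rhs) (auto simp: algebra_simps)
qed

text \<open>
  Test with bump functions that increase to the indicator of the interval: the two edges of the bump have derivatives that
  concentrate, with mass \<open>1\<close> and \<open>-1\<close>, at the end points.
\<close>

lemma weak_derivative_interior:
  fixes Y H :: "real \<Rightarrow> real"
  assumes Y: "continuous_on UNIV Y" "\<And>s. \<bar>Y s\<bar> \<le> M" and H: "integrable lborel H"
    and weak: "\<And>\<theta>. \<theta> \<in> test_functions {0<..<T} \<Longrightarrow> (LBINT t. grad \<theta> t * Y t) = (LBINT t. \<theta> t * H t)"
    and ab: "0 < a" "a < b" "b < T"
  shows "Y a - Y b = (LBINT t. indicator {a<..<b} t * H t)"
proof -
  have [measurable]: "Y \<in> borel_measurable borel" "H \<in> borel_measurable borel"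
    using Y(1) H by (auto intro: borel_measurable_continuous_onI)
  let ?k = "\<lambda>k. real (Suc k)"
  let ?A = "\<lambda>k t. flat 2 (?k k * (t - a)) * flat 0 (?k k * (b - t)) * Y t"
  let ?B = "\<lambda>k t. flat 0 (?k k * (t - a)) * flat 2 (?k k * (b - t)) * Y t"
  have A_eq: "?A k (a + 1 / ?k k * s) = flat 2 s * flat 0 (?k k * (b - a) - s) * Y (a + 1 * (s / ?k k))" for k s
  proof -
    have "?k k * (a + 1 / ?k k * s - a) = s" "?k k * (b - (a + 1 / ?k k * s)) = ?k k * (b - a) - s"
      by (auto simp: field_simps)
    then show ?thesis
      by (simp only: ) simp
  qed
  have B_eq: "?B k (b + - (1 / ?k k) * s) = flat 2 s * flat 0 (?k k * (b - a) - s) * Y (b + - 1 * (s / ?k k))" for k s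
  proof -
    have "?k k * (b - (b + - (1 / ?k k) * s)) = s" "?k k * (b + - (1 / ?k k) * s - a) = ?k k * (b - a) - s"
      by (auto simp: field_simps)
    then show ?thesis
      by (simp only: ) simp
  qed
  have int_g: "integrable lborel (\<lambda>s. flat 2 s * flat 0 (?k k * (b - a) - s) * Y (d + \<epsilon> * (s / ?k k)))" for k d \<epsilon>
  proof (rule Bochner_Integration.integrable_bound)
    show "integrable lborel (\<lambda>s. flat 2 s * M)"
      using flat_2_mass(1) by simp
    have M0: "M \<ge> 0"
      using Y(2)[of 0] by linarith
    show "AE s in lborel. norm (flat 2 s * flat 0 (?k k * (b - a) - s) * Y (d + \<epsilon> * (s / ?k k))) \<le> norm (flat 2 s * M)"
    proof (intro AE_I2)
      fix s
      have "\<bar>flat 0 (?k k * (b - a) - s)\<bar> * \<bar>Y (d + \<epsilon> * (s / ?k k))\<bar> \<le> 1 * M"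
        using flat_nonneg[of 0] flat_0_le_1 Y(2) by (intro mult_mono) auto
      then have "flat 2 s * (\<bar>flat 0 (?k k * (b - a) - s)\<bar> * \<bar>Y (d + \<epsilon> * (s / ?k k))\<bar>) \<le> flat 2 s * M"
        by (intro mult_left_mono) (auto simp: flat_nonneg)
      then show "norm (flat 2 s * flat 0 (?k k * (b - a) - s) * Y (d + \<epsilon> * (s / ?k k))) \<le> norm (flat 2 s * M)"
        using M0 by (simp add: abs_mult flat_nonneg mult.assoc)
    qed
  qed measurable
  have intA: "integrable lborel (?A k)" and A_int: "?k k * (LBINT t. ?A k t) = (LBINT s. flat 2 s * flat 0 (?k k * (b - a) - s) * Y (a + 1 * (s / ?k k)))" for k
  proof -
    show "integrable lborel (?A k)"
      using lborel_integrable_real_affine_iff[of "1 / ?k k" "?A k" a] int_g[of k a 1] unfolding A_eq by simp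
    show "?k k * (LBINT t. ?A k t) = (LBINT s. flat 2 s * flat 0 (?k k * (b - a) - s) * Y (a + 1 * (s / ?k k)))"
      using lborel_integral_real_affine[of "1 / ?k k" "?A k" a] unfolding A_eq by simp
  qed
  have intB: "integrable lborel (?B k)" and B_int: "?k k * (LBINT t. ?B k t) = (LBINT s. flat 2 s * flat 0 (?k k * (b - a) - s) * Y (b + - 1 * (s / ?k k)))" for k
  proof -
    show "integrable lborel (?B k)"
      using lborel_integrable_real_affine_iff[of "- (1 / ?k k)" "?B k" b] int_g[of k b "-1"] unfolding B_eq by simp
    show "?k k * (LBINT t. ?B k t) = (LBINT s. flat 2 s * flat 0 (?k k * (b - a) - s) * Y (b + - 1 * (s / ?k k)))"
      using lborel_integral_real_affine[of "- (1 / ?k k)" "?B k" b] unfolding B_eq by simp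
  qed
  have "(LBINT t. grad (bump a b (Suc k)) t * Y t) = ?k k * (LBINT t. ?A k t) - ?k k * (LBINT t. ?B k t)" for k
  proof -
    have "(\<lambda>t. grad (bump a b (Suc k)) t * Y t) = (\<lambda>t. ?k k * ?A k t - ?k k * ?B k t)"
      unfolding grad_bump_real by (simp add: algebra_simps fun_eq_iff)
    then show ?thesis
      using Bochner_Integration.integral_diff[OF integrable_mult_right[OF intA] integrable_mult_right[OF intB], of "?k k" k "?k k" k]
      by (simp only: integral_mult_right_zero)
  qed
  then have lhs: "(\<lambda>k. LBINT t. grad (bump a b (Suc k)) t * Y t) \<longlonglongrightarrow> Y a - Y b"
    unfolding A_int B_int using ab
    by (simp only:) (intro tendsto_diff mollified_limit[OF Y], auto)
  have rhs: "(\<lambda>k. LBINT t. bump a b (Suc k) t * H t) \<longlonglongrightarrow> (LBINT t. indicator {a<..<b} t * H t)"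
  proof (rule integral_dominated_convergence[where w = "\<lambda>t. \<bar>H t\<bar>"])
    have [measurable]: "bump a b k \<in> borel_measurable borel" for k
      by (rule borel_measurable_smooth[OF smooth_bump])
    show "(\<lambda>t. bump a b (Suc k) t * H t) \<in> borel_measurable lborel" for k
      by measurable
    show "AE t in lborel. (\<lambda>k. bump a b (Suc k) t * H t) \<longlonglongrightarrow> indicator {a<..<b} t * H t"
      using LIMSEQ_Suc[OF bump_tendsto[of a b]] by (intro AE_I2 tendsto_mult tendsto_const) (simp add: box_real)
    show "AE t in lborel. norm (bump a b (Suc k) t * H t) \<le> \<bar>H t\<bar>" for k
      using bump_bounds[of a b "Suc k"] by (intro AE_I2) (auto simp: abs_mult intro!: mult_left_le_one_le)
  qed (use H in auto)
  have "bump a b (Suc k) \<in> test_functions {0<..<T}" for k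
    using ab by (intro bump_test_function) auto
  from weak[OF this] have "(\<lambda>k. LBINT t. grad (bump a b (Suc k)) t * Y t) = (\<lambda>k. LBINT t. bump a b (Suc k) t * H t)"
    by auto
  with lhs rhs show ?thesis
    using LIMSEQ_unique by auto
qed

text \<open>
  The values at \<open>0\<close> and \<open>T\<close> are reached by continuity. This is where the initial value of a solution enters.
\<close>

lemma weak_derivative_increment:
  fixes y H :: "real \<Rightarrow> real"
  assumes T: "T > 0" and y: "continuous_on {0..T} y" and H: "integrable lborel H"
    and weak: "\<And>\<theta>. \<theta> \<in> test_functions {0<..<T} \<Longrightarrow> (LBINT t. grad \<theta> t * y t) = (LBINT t. \<theta> t * H t)"
    and ab: "0 \<le> a" "a < b" "b \<le> T"
  shows "y b - y a = - (LBINT t. indicator {a<..<b} t * H t)"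
proof -
  define Y where "Y s = y (max 0 (min T s))" for s
  have Y_eq: "Y s = y s" if "s \<in> {0..T}" for s
    using that by (simp add: Y_def)
  have Yc: "continuous_on UNIV Y"
    unfolding Y_def[abs_def] by (rule continuous_on_compose2[OF y]) (use T in \<open>auto intro!: continuous_intros\<close>)
  obtain M where "\<forall>x\<in>y ` {0..T}. norm x \<le> M"
    using compact_imp_bounded[OF compact_continuous_image[OF y compact_Icc]] unfolding bounded_iff by blast
  then have M: "\<bar>y s\<bar> \<le> M" if "s \<in> {0..T}" for s
    using that by auto
  have YM: "\<bar>Y s\<bar> \<le> M" for s
    unfolding Y_def using T by (intro M) auto
  have Yw: "(LBINT t. grad \<theta> t * Y t) = (LBINT t. \<theta> t * H t)" if \<theta>: "\<theta> \<in> test_functions {0<..<T}" for \<theta>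
  proof -
    have eq: "grad \<theta> t * Y t = grad \<theta> t * y t" for t
    proof (cases "t \<in> {0<..<T}")
      case False
      then have "grad \<theta> t = 0"
        using test_functionsE[OF \<theta>] by (metis subset_iff)
      then show ?thesis by simp
    qed (simp add: Y_eq)
    show ?thesis
      unfolding eq by (rule weak[OF \<theta>])
  qed
  define d where "d n = (b - a) / 3 * inverse (real (Suc n))" for n
  have d: "d n > 0" "d n \<le> (b - a) / 3" for n
  proof -
    show "d n > 0"
      using ab by (simp add: d_def)
    have "inverse (real (Suc n)) \<le> 1"
      by (simp add: field_simps)
    then show "d n \<le> (b - a) / 3"
      unfolding d_def using ab by (intro mult_left_le) auto
  qed
  have d0: "d \<longlonglongrightarrow> 0"
    unfolding d_def[abs_def] by (rule tendsto_mult_right_zero[OF LIMSEQ_inverse_real_of_nat])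
  have eq: "Y (a + d n) - Y (b - d n) = (LBINT t. indicator {a + d n<..<b - d n} t * H t)" for n
    by (rule weak_derivative_interior[OF Yc YM H Yw]) (use d[of n] ab in auto)
  have "(\<lambda>n. Y (a + d n) - Y (b - d n)) \<longlonglongrightarrow> Y (a + 0) - Y (b - 0)"
    by (intro tendsto_diff continuous_on_tendsto_compose[OF Yc] tendsto_add tendsto_const d0) auto
  moreover have "(\<lambda>n. LBINT t. indicator {a + d n<..<b - d n} t * H t) \<longlonglongrightarrow> (LBINT t. indicator {a<..<b} t * H t)"
  proof (rule integral_dominated_convergence[where w = "\<lambda>t. \<bar>H t\<bar>"])
    show "AE t in lborel. (\<lambda>n. indicator {a + d n<..<b - d n} t * H t) \<longlonglongrightarrow> indicator {a<..<b} t * H t"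
    proof (intro AE_I2 tendsto_mult tendsto_const tendsto_eventually)
      fix t
      show "eventually (\<lambda>n. indicator {a + d n<..<b - d n} t = (indicator {a<..<b} t :: real)) sequentially"
      proof (cases "t \<in> {a<..<b}")
        case True
        then have "eventually (\<lambda>n. d n < min (t - a) (b - t)) sequentially"
          using order_tendstoD(2)[OF d0, of "min (t - a) (b - t)"] by auto
        then show ?thesis
          by eventually_elim (use True in \<open>auto simp: indicator_def\<close>)
      next
        case False
        have "t \<notin> {a + d n<..<b - d n}" for n
          using False d(1)[of n] by auto
        then show ?thesis
          using False by (auto simp: indicator_def)
      qed
    qed
    show "AE t in lborel. norm (indicator {a + d n<..<b - d n} t * H t) \<le> \<bar>H t\<bar>" for n
      by (auto simp: indicator_def)
  qed (use H in auto)
  ultimately have "Y (a + 0) - Y (b - 0) = (LBINT t. indicator {a<..<b} t * H t)"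
    unfolding eq by (rule LIMSEQ_unique)
  then show ?thesis
    using Y_eq ab by simp
qed

section \<open>Borel representatives of weak solutions\<close>

lemma lebesgue_on_borel_representative_vec:
  fixes f :: "'a::euclidean_space \<Rightarrow> 'b::euclidean_space"
  assumes \<Omega>: "\<Omega> \<in> sets borel" and f: "f \<in> borel_measurable (lebesgue_on \<Omega>)"
  obtains f' where "f' \<in> borel_measurable borel" "AE x in lborel. x \<in> \<Omega> \<longrightarrow> f x = f' x"
    "\<And>x. x \<notin> \<Omega> \<Longrightarrow> f' x = 0"
proof -
  have "\<forall>i\<in>Basis. \<exists>g. g \<in> borel_measurable borel \<and> (AE x in lborel. x \<in> \<Omega> \<longrightarrow> f x \<bullet> i = g x) \<and> (\<forall>x. x \<notin> \<Omega> \<longrightarrow> g x = 0)"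
  proof
    fix i :: 'b assume "i \<in> Basis"
    have "(\<lambda>x. f x \<bullet> i) \<in> borel_measurable (lebesgue_on \<Omega>)"
      using f by simp
    from lebesgue_on_borel_representative[OF \<Omega> this]
    show "\<exists>g. g \<in> borel_measurable borel \<and> (AE x in lborel. x \<in> \<Omega> \<longrightarrow> f x \<bullet> i = g x) \<and> (\<forall>x. x \<notin> \<Omega> \<longrightarrow> g x = 0)"
      by metis
  qed
  from bchoice[OF this] obtain g where g0: "\<forall>i\<in>Basis. g i \<in> borel_measurable borel \<and>
      (AE x in lborel. x \<in> \<Omega> \<longrightarrow> f x \<bullet> i = g i x) \<and> (\<forall>x. x \<notin> \<Omega> \<longrightarrow> g i x = 0)"
    by blast
  have g: "\<And>i. i \<in> Basis \<Longrightarrow> g i \<in> borel_measurable borel"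
    "\<And>i. i \<in> Basis \<Longrightarrow> AE x in lborel. x \<in> \<Omega> \<longrightarrow> f x \<bullet> i = g i x"
    "\<And>i x. i \<in> Basis \<Longrightarrow> x \<notin> \<Omega> \<Longrightarrow> g i x = 0"
    using g0 by blast+
  show ?thesis
  proof (rule that[of "\<lambda>x. \<Sum>i\<in>Basis. g i x *\<^sub>R i"])
    show "(\<lambda>x. \<Sum>i\<in>Basis. g i x *\<^sub>R i) \<in> borel_measurable borel"
      using g(1) by (intro borel_measurable_sum borel_measurable_scaleR) auto
    have "AE x in lborel. \<forall>i\<in>Basis. x \<in> \<Omega> \<longrightarrow> f x \<bullet> i = g i x"
      by (intro AE_finite_allI) (auto intro: g)
    then show "AE x in lborel. x \<in> \<Omega> \<longrightarrow> f x = (\<Sum>i\<in>Basis. g i x *\<^sub>R i)"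
    proof eventually_elim
      case (elim x)
      show ?case
      proof
        assume "x \<in> \<Omega>"
        then have "(\<Sum>i\<in>Basis. g i x *\<^sub>R i) = (\<Sum>i\<in>Basis. (f x \<bullet> i) *\<^sub>R i)"
          using elim by (intro sum.cong) auto
        then show "f x = (\<Sum>i\<in>Basis. g i x *\<^sub>R i)"
          by (simp add: euclidean_representation)
      qed
    qed
  qed (use g(3) in simp)
qed

lemma W12_norm_scale:
  assumes \<Omega>: "open \<Omega>" "bounded \<Omega>" and \<eta>: "\<eta> \<in> test_functions \<Omega>"
  shows "W12_norm \<Omega> (\<lambda>x. a * \<eta> x) = \<bar>a\<bar> * W12_norm \<Omega> \<eta>"
proof -
  note g = weak_gradient_test_function[OF \<Omega> \<eta>] and L = L2_test_function(1)[OF \<Omega> \<eta>]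
  have "is_weak_gradient \<Omega> (\<lambda>x. a * \<eta> x) (\<lambda>x. a *\<^sub>R grad \<eta> x)"
    using weak_gradient_lincomb[OF \<Omega> L L g g, of a 0] by simp
  from W12_norm_eq[OF \<Omega> this] show ?thesis
    unfolding W12_norm_eq[OF \<Omega> g]
    by (simp add: power_mult_distrib real_sqrt_mult flip: distrib_left)
qed

lemma test_functions_scale: "\<eta> \<in> test_functions \<Omega> \<Longrightarrow> (\<lambda>x. a * \<eta> x) \<in> test_functions \<Omega>"
  using test_functions_mult[OF _ smooth_const, of \<eta> \<Omega> a] .

lemma tensor_test_function:
  assumes \<theta>: "\<theta> \<in> test_functions {0<..<T}" and \<eta>: "\<eta> \<in> test_functions \<Omega>"
  shows "(\<lambda>z. \<theta> (fst z) * \<eta> (snd z)) \<in> test_functions (cyl T \<Omega>)"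
proof -
  obtain K1 where K1: "smooth \<theta>" "compact K1" "K1 \<subseteq> {0<..<T}" "\<And>x. x \<notin> K1 \<Longrightarrow> \<theta> x = 0"
    using test_functionsE[OF \<theta>] by metis
  obtain K2 where K2: "smooth \<eta>" "compact K2" "K2 \<subseteq> \<Omega>" "\<And>x. x \<notin> K2 \<Longrightarrow> \<eta> x = 0"
    using test_functionsE[OF \<eta>] by metis
  show ?thesis
  proof (rule test_functionsI[of _ "K1 \<times> K2"])
    show "smooth (\<lambda>z. \<theta> (fst z) * \<eta> (snd z))"
      by (intro smooth_mult smooth_comp_linear[OF bounded_linear_fst] smooth_comp_linear[OF bounded_linear_snd] K1 K2)
    show "compact (K1 \<times> K2)"
      by (intro compact_Times K1 K2)
    show "K1 \<times> K2 \<subseteq> cyl T \<Omega>"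
      using K1 K2 by (auto simp: cyl_def)
    show "\<theta> (fst z) * \<eta> (snd z) = 0" if "z \<notin> K1 \<times> K2" for z
      using that K1(4)[of "fst z"] K2(4)[of "snd z"] by (cases z) auto
  qed
qed

lemma tensor_time_derivative:
  assumes \<theta>: "smooth \<theta>" and \<eta>: "smooth \<eta>"
  shows "frechet_derivative (\<lambda>z::real \<times> 'a::euclidean_space. \<theta> (fst z) * \<eta> (snd z)) (at (t, x)) (1, 0) = grad \<theta> t * \<eta> x"
proof -
  have 1: "((\<lambda>z::real \<times> 'a. \<theta> (fst z)) has_derivative (\<lambda>h. grad \<theta> t \<bullet> fst h)) (at (t, x))"
    using has_derivative_compose[OF bounded_linear_imp_has_derivative[OF bounded_linear_fst]
        smooth_has_gradient[OF \<theta>, of "fst (t, x)"]]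
    by simp
  have 2: "((\<lambda>z::real \<times> 'a. \<eta> (snd z)) has_derivative (\<lambda>h. grad \<eta> x \<bullet> snd h)) (at (t, x))"
    using has_derivative_compose[OF bounded_linear_imp_has_derivative[OF bounded_linear_snd]
        smooth_has_gradient[OF \<eta>, of "snd (t, x)"]]
    by simp
  from has_derivative_mult[OF 1 2]
  have "frechet_derivative (\<lambda>z. \<theta> (fst z) * \<eta> (snd z)) (at (t, x)) = (\<lambda>h. \<theta> t * (grad \<eta> x \<bullet> snd h) + (grad \<theta> t \<bullet> fst h) * \<eta> x)"
    by (metis (no_types, lifting) frechet_derivative_at fst_conv snd_conv)
  then show ?thesis
    by simp
qed

text \<open>
  Approximating \<open>\<theta>\<close> by simple functions gives simple functions with values in the multiples of \<open>\<eta>\<close>.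
\<close>

lemma tensor_L2_time:
  assumes \<Omega>: "open \<Omega>" "bounded \<Omega>" and \<theta>: "\<theta> \<in> test_functions {0<..<T}" and \<eta>: "\<eta> \<in> test_functions \<Omega>"
  shows "(\<lambda>t x. \<theta> t * \<eta> x) \<in> L2_time T (W12_0 \<Omega>) (W12_norm \<Omega>)"
proof -
  have in0: "(\<lambda>x. a * \<eta> x) \<in> W12_0 \<Omega>" for a
    by (intro W12_0_test_function[OF \<Omega>] test_functions_scale \<eta>)
  obtain K where K: "smooth \<theta>" "compact K" "\<And>x. x \<notin> K \<Longrightarrow> \<theta> x = 0"
    using test_functionsE[OF \<theta>] by metis
  have [measurable]: "\<theta> \<in> borel_measurable borel"
    using K(1) by (rule borel_measurable_smooth)
  have "\<theta> \<in> borel_measurable lborel"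
    by simp
  from borel_measurable_implies_sequence_metric[OF this, of 0]
  obtain a where a0: "\<forall>k. simple_function lborel (a k)" "\<forall>t\<in>space lborel. (\<lambda>k. a k t) \<longlonglongrightarrow> \<theta> t"
    by blast
  have a: "simple_function lborel (a k)" "(\<lambda>k. a k t) \<longlonglongrightarrow> \<theta> t" for k t
    using a0 by auto
  let ?s = "\<lambda>k t x. a k t * \<eta> x"
  have "simple_on T (W12_0 \<Omega>) (?s k)" for k
    unfolding simple_on_def
  proof (intro conjI allI)
    have "finite (a k ` UNIV)"
      using simple_functionD(1)[OF a(1)] by simp
    then have "finite ((\<lambda>b x. b * \<eta> x) ` a k ` UNIV)"
      by simp
    then show "finite (?s k ` {0<..<T})"
      by (rule finite_subset[rotated]) auto
    show "?s k ` {0<..<T} \<subseteq> W12_0 \<Omega>"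
      using in0 by auto
    fix c
    have "a k -` {b. (\<lambda>x. b * \<eta> x) = c} \<inter> space lborel \<in> sets lborel"
      by (rule simple_functionD(2)[OF a(1)])
    then have "{0<..<T} \<inter> a k -` {b. (\<lambda>x. b * \<eta> x) = c} \<in> sets lborel"
      by simp
    also have "{0<..<T} \<inter> a k -` {b. (\<lambda>x. b * \<eta> x) = c} = {t\<in>{0<..<T}. ?s k t = c}"
      by auto
    finally show "{t\<in>{0<..<T}. ?s k t = c} \<in> sets lebesgue"
      by simp
  qed
  moreover have "(\<lambda>k. W12_norm \<Omega> (\<lambda>x. ?s k t x - \<theta> t * \<eta> x)) \<longlonglongrightarrow> 0" for t
  proof -
    have "W12_norm \<Omega> (\<lambda>x. ?s k t x - \<theta> t * \<eta> x) = \<bar>a k t - \<theta> t\<bar> * W12_norm \<Omega> \<eta>" for k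
      using W12_norm_scale[OF \<Omega> \<eta>, of "a k t - \<theta> t"] by (simp add: left_diff_distrib)
    moreover have "(\<lambda>k. \<bar>a k t - \<theta> t\<bar> * W12_norm \<Omega> \<eta>) \<longlonglongrightarrow> \<bar>\<theta> t - \<theta> t\<bar> * W12_norm \<Omega> \<eta>"
      by (intro tendsto_intros a)
    ultimately show ?thesis
      by simp
  qed
  moreover have "integrable (lebesgue_on {0<..<T}) (\<lambda>t. (W12_norm \<Omega> (\<lambda>x. \<theta> t * \<eta> x))\<^sup>2)"
  proof -
    have "integrable lborel (\<lambda>t. (W12_norm \<Omega> \<eta>)\<^sup>2 * (\<theta> t)\<^sup>2)"
      using K by (intro integrable_mult_right integrable_compactly_supported[of _ K] continuous_intros smooth_continuous) auto
    then have "integrable lborel (\<lambda>t. indicator {0<..<T} t *\<^sub>R ((W12_norm \<Omega> \<eta>)\<^sup>2 * (\<theta> t)\<^sup>2))"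
      by (rule integrable_mult_indicator[rotated]) simp
    then have "integrable (lebesgue_on {0<..<T}) (\<lambda>t. (W12_norm \<Omega> \<eta>)\<^sup>2 * (\<theta> t)\<^sup>2)"
      by (subst integral_lebesgue_on_borel(2)) auto
    then show ?thesis
      by (simp add: W12_norm_scale[OF \<Omega> \<eta>] power_mult_distrib mult.commute[of "(W12_norm \<Omega> \<eta>)\<^sup>2"])
  qed
  ultimately show ?thesis
    unfolding L2_time_def using in0 by (auto intro!: exI[of _ ?s])
qed

lemma tensor_space_gradient:
  assumes \<Omega>: "open \<Omega>" "bounded \<Omega>" and \<theta>: "\<theta> \<in> test_functions {0<..<T}" and \<eta>: "\<eta> \<in> test_functions \<Omega>"
  shows "is_space_gradient T \<Omega> (\<lambda>t x. \<theta> t * \<eta> x) (\<lambda>t x. \<theta> t *\<^sub>R grad \<eta> x)"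
    "(\<lambda>t x. \<theta> t * \<eta> x) \<in> Linfty_cyl T \<Omega>"
proof -
  have sm: "smooth \<theta>" "smooth \<eta>"
    using \<theta> \<eta> by (auto intro: test_functions_smooth)
  have [measurable]: "\<theta> \<in> borel_measurable borel" "\<eta> \<in> borel_measurable borel" "grad \<eta> \<in> borel_measurable borel"
    using sm by (auto intro: borel_measurable_smooth borel_measurable_grad)
  have "(\<lambda>z::real \<times> 'a. \<theta> (fst z) *\<^sub>R grad \<eta> (snd z)) \<in> borel_measurable borel"
    by measurable
  then have m: "(\<lambda>(t, x). \<theta> t *\<^sub>R grad \<eta> x) \<in> borel_measurable (lebesgue_on (cyl T \<Omega>))"
    by (simp add: measurable_lebesgue_on case_prod_unfold)
  have "(\<lambda>z::real \<times> 'a. \<theta> (fst z) * \<eta> (snd z)) \<in> borel_measurable borel"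
    by measurable
  then have m': "(\<lambda>(t, x). \<theta> t * \<eta> x) \<in> borel_measurable (lebesgue_on (cyl T \<Omega>))"
    by (simp add: measurable_lebesgue_on case_prod_unfold)
  note g = weak_gradient_test_function[OF \<Omega> \<eta>] and L = L2_test_function(1)[OF \<Omega> \<eta>]
  have "is_weak_gradient \<Omega> (\<lambda>x. \<theta> t * \<eta> x) (\<lambda>x. \<theta> t *\<^sub>R grad \<eta> x)" for t
    using weak_gradient_lincomb[OF \<Omega> L L g g, of "\<theta> t" 0] by simp
  with m show "is_space_gradient T \<Omega> (\<lambda>t x. \<theta> t * \<eta> x) (\<lambda>t x. \<theta> t *\<^sub>R grad \<eta> x)"
    by (simp add: is_space_gradient_def)
  obtain C1 where C1: "C1 > 0" "\<And>t. \<bar>\<theta> t\<bar> \<le> C1"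
    using test_functions_bounded[OF \<theta>] by metis
  obtain C2 where C2: "\<And>x. \<bar>\<eta> x\<bar> \<le> C2"
    using test_functions_bounded[OF \<eta>] by metis
  have "\<bar>\<theta> t * \<eta> x\<bar> \<le> C1 * C2" for t x
    unfolding abs_mult using C1 C2 by (intro mult_mono) auto
  with m' show "(\<lambda>t x. \<theta> t * \<eta> x) \<in> Linfty_cyl T \<Omega>"
    unfolding Linfty_cyl_def by (auto intro!: exI[of _ "C1 * C2"])
qed

text \<open>
  The distributional definition of the time derivative evaluates the pairing in the weak equation on tensor products, and so eliminates
  the decomposition of the time derivative.
\<close>

lemma solution_tensor_identity:
  assumes \<Omega>: "open \<Omega>" "bounded \<Omega>" and \<theta>: "\<theta> \<in> test_functions {0<..<T}" and \<eta>: "\<eta> \<in> test_functions \<Omega>"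
    and time: "is_time_derivative T \<Omega> u f F"
    and eq: "\<And>v Dv. v \<in> L2_time T (W12_0 \<Omega>) (W12_norm \<Omega>) \<inter> Linfty_cyl T \<Omega> \<Longrightarrow>
           is_space_gradient T \<Omega> v Dv \<Longrightarrow>
           pairing T \<Omega> f F v
             + integral\<^sup>L (lebesgue_on (cyl T \<Omega>)) (\<lambda>(t,x). Du t x \<bullet> Dv t x)
             + integral\<^sup>L (lebesgue_on (cyl T \<Omega>))
                 (\<lambda>(t,x). B * ((norm (Du t x))\<^sup>2 / u t x) * v t x)
           = 0"
  shows "integral\<^sup>L (lebesgue_on (cyl T \<Omega>)) (\<lambda>z. u (fst z) (snd z) * (grad \<theta> (fst z) * \<eta> (snd z)))
    = integral\<^sup>L (lebesgue_on (cyl T \<Omega>)) (\<lambda>z. Du (fst z) (snd z) \<bullet> (\<theta> (fst z) *\<^sub>R grad \<eta> (snd z)))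
    + integral\<^sup>L (lebesgue_on (cyl T \<Omega>))
        (\<lambda>z. B * ((norm (Du (fst z) (snd z)))\<^sup>2 / u (fst z) (snd z)) * (\<theta> (fst z) * \<eta> (snd z)))"
proof -
  have sm: "smooth \<theta>" "smooth \<eta>"
    using \<theta> \<eta> by (auto intro: test_functions_smooth)
  have "- integral\<^sup>L (lebesgue_on (cyl T \<Omega>))
      (\<lambda>(t,x). u t x * frechet_derivative (\<lambda>z. \<theta> (fst z) * \<eta> (snd z)) (at (t,x)) (1,0))
      = pairing T \<Omega> f F (\<lambda>t x. (\<lambda>z. \<theta> (fst z) * \<eta> (snd z)) (t, x))"
    using time tensor_test_function[OF \<theta> \<eta>] unfolding is_time_derivative_def by blast
  then have 1: "- integral\<^sup>L (lebesgue_on (cyl T \<Omega>)) (\<lambda>(t,x). u t x * (grad \<theta> t * \<eta> x))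
      = pairing T \<Omega> f F (\<lambda>t x. \<theta> t * \<eta> x)"
    unfolding tensor_time_derivative[OF sm] by simp
  have 2: "pairing T \<Omega> f F (\<lambda>t x. \<theta> t * \<eta> x)
       + integral\<^sup>L (lebesgue_on (cyl T \<Omega>)) (\<lambda>(t,x). Du t x \<bullet> (\<theta> t *\<^sub>R grad \<eta> x))
       + integral\<^sup>L (lebesgue_on (cyl T \<Omega>)) (\<lambda>(t,x). B * ((norm (Du t x))\<^sup>2 / u t x) * (\<theta> t * \<eta> x)) = 0"
    using tensor_L2_time[OF \<Omega> \<theta> \<eta>] tensor_space_gradient[OF \<Omega> \<theta> \<eta>] by (intro eq) auto
  show ?thesis
    using 1 2 by (simp add: case_prod_unfold)
qed

lemma AE_translate:
  fixes P :: "real \<Rightarrow> bool"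
  assumes "AE t in lborel. P t"
  shows "AE t in lborel. P (t - h)"
proof -
  obtain N where N: "{t \<in> space lborel. \<not> P t} \<subseteq> N" "emeasure lborel N = 0" "N \<in> sets lborel"
    using AE_E[OF assms] .
  have [measurable]: "N \<in> sets borel"
    using N(3) by simp
  have "AE t in lborel. t \<notin> N"
    using N by (intro AE_not_in) (auto simp: null_sets_def)
  then have "AE t in lborel. - h + 1 * t \<notin> N"
    by (intro AE_borel_affine[of 1 "\<lambda>t. t \<notin> N" "- h"]) auto
  then show ?thesis
    by eventually_elim (use N(1) in auto)
qed

text \<open>
  Tonelli's theorem for a bound \<open>W\<close> that is only Lebesgue measurable in time.
\<close>

lemma integrable_by_slices:
  fixes K :: "real \<times> 'a::euclidean_space \<Rightarrow> real"
  assumes \<Omega>: "\<Omega> \<in> sets borel" and K: "K \<in> borel_measurable borel" "\<And>z. K z \<ge> 0" "\<And>z. z \<notin> cyl T \<Omega> \<Longrightarrow> K z = 0"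
    and W: "integrable (lebesgue_on {0<..<T}) W"
    and le: "AE t in lborel. 0 < t \<and> t < T \<longrightarrow> integrable (lebesgue_on \<Omega>) (\<lambda>x. K (t, x)) \<and> (LINT x|lebesgue_on \<Omega>. K (t, x)) \<le> W t"
  shows "integrable lborel K"
proof -
  have [measurable]: "K \<in> borel_measurable borel" "\<Omega> \<in> sets borel"
    using K \<Omega> by auto
  have [measurable]: "K \<in> borel_measurable (lborel \<Otimes>\<^sub>M lborel)"
    by (rule measurable_lborel_prod) measurable
  let ?h = "\<lambda>t. \<integral>\<^sup>+x. ennreal (K (t, x)) \<partial>lborel"
  have h_meas: "?h \<in> borel_measurable lborel"
    by measurable
  have h_off: "?h t = 0" if "t \<notin> {0<..<T}" for t
  proof -
    have "K (t, x) = 0" for x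
      using K(3)[of "(t, x)"] that by (auto simp: cyl_def)
    then show ?thesis by simp
  qed
  have "(\<integral>\<^sup>+z. ennreal (K z) \<partial>lborel) = (\<integral>\<^sup>+t. ?h t \<partial>lborel)"
    unfolding lborel_prod[symmetric] by (subst lborel.nn_integral_fst[symmetric]) auto
  also have "\<dots> = (\<integral>\<^sup>+t. ?h t * indicator {0<..<T} t \<partial>lebesgue)"
    unfolding nn_integral_completion using h_off by (intro nn_integral_cong) (auto simp: indicator_def)
  also have "\<dots> = (\<integral>\<^sup>+t. ?h t \<partial>lebesgue_on {0<..<T})"
    by (rule nn_integral_restrict_space[symmetric]) simp
  also have "\<dots> \<le> (\<integral>\<^sup>+t. ennreal (W t) \<partial>lebesgue_on {0<..<T})"
  proof (rule nn_integral_mono_AE)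
    have "AE t in lborel. t \<in> {0<..<T} \<longrightarrow> ?h t \<le> ennreal (W t)"
      using le
    proof eventually_elim
      case (elim t)
      show ?case
      proof
        assume "t \<in> {0<..<T}"
        then have i: "integrable (lebesgue_on \<Omega>) (\<lambda>x. K (t, x))" and l: "(LINT x|lebesgue_on \<Omega>. K (t, x)) \<le> W t"
          using elim by auto
        have ind: "(\<lambda>x. indicator \<Omega> x *\<^sub>R K (t, x)) = (\<lambda>x. K (t, x))"
          using K(3) by (intro ext) (auto simp: indicator_def cyl_def)
        have m: "(\<lambda>x. K (t, x)) \<in> borel_measurable borel"
          by measurable
        have il: "integrable lborel (\<lambda>x. K (t, x))" and el: "(LINT x|lebesgue_on \<Omega>. K (t, x)) = (LBINT x. K (t, x))"
          using integral_lebesgue_on_borel[OF \<Omega> m] i unfolding ind by auto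
        have "?h t = ennreal (LBINT x. K (t, x))"
          by (rule nn_integral_eq_integral[OF il]) (simp add: K)
        also have "\<dots> \<le> ennreal (W t)"
          using l el by (intro ennreal_leI) simp
        finally show "?h t \<le> ennreal (W t)" .
      qed
    qed
    then show "AE t in lebesgue_on {0<..<T}. ?h t \<le> ennreal (W t)"
      by (simp add: AE_lebesgue_on_iff)
  qed
  also have "\<dots> \<le> (\<integral>\<^sup>+t. ennreal (norm (W t)) \<partial>lebesgue_on {0<..<T})"
    by (intro nn_integral_mono ennreal_leI) simp
  also have "\<dots> < \<infinity>"
    using W by (simp add: integrable_iff_bounded)
  finally show ?thesis
    using K(2) by (intro integrableI_nonneg) auto
qed

lemma integrable_mult_bounded:
  fixes f g :: "'x \<Rightarrow> real"
  assumes f: "integrable M f" and g: "g \<in> borel_measurable M" "\<And>z. \<bar>g z\<bar> \<le> C"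
  shows "integrable M (\<lambda>z. f z * g z)"
proof (rule Bochner_Integration.integrable_bound)
  show "integrable M (\<lambda>z. \<bar>f z\<bar> * C)"
    using f by simp
  have "norm (f z * g z) \<le> norm (\<bar>f z\<bar> * C)" for z
    unfolding real_norm_def abs_mult abs_abs
    by (rule mult_left_mono[OF order_trans[OF g(2) abs_ge_self] abs_ge_zero])
  then show "AE z in M. norm (f z * g z) \<le> norm (\<bar>f z\<bar> * C)"
    by (intro AE_I2)
qed (use f g in auto)

lemma W12_0_borel_slice:
  fixes w :: "'a::euclidean_space \<Rightarrow> real" and g :: "'a \<Rightarrow> 'a"
  assumes \<Omega>: "open \<Omega>" "bounded \<Omega>" and w: "(\<lambda>x. w x - c) \<in> W12_0 \<Omega>" and Dw: "is_weak_gradient \<Omega> w Dw"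
    and W: "W \<in> borel_measurable (lebesgue_on \<Omega>)" "AE x in lebesgue_on \<Omega>. w x = W x"
    and g: "g \<in> borel_measurable (lebesgue_on \<Omega>)" "AE x in lebesgue_on \<Omega>. Dw x = g x"
  shows "\<exists>\<phi>. (\<forall>k. \<phi> k \<in> test_functions \<Omega>) \<and> L2_lim (lebesgue_on \<Omega>) \<phi> (\<lambda>x. W x - c) \<and>
      L2_lim (lebesgue_on \<Omega>) (\<lambda>k. grad (\<phi> k)) g"
    "L2 (lebesgue_on \<Omega>) (\<lambda>x. W x - c)" "L2 (lebesgue_on \<Omega>) g"
    "(W12_norm \<Omega> (\<lambda>x. w x - c))\<^sup>2 = (LINT x|lebesgue_on \<Omega>. (W x - c)\<^sup>2) + (LINT x|lebesgue_on \<Omega>. (norm (g x))\<^sup>2)"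
proof -
  let ?D = "lebesgue_on \<Omega>"
  interpret D: finite_measure ?D
    by (rule finite_measure_lebesgue_on[OF \<Omega>])
  note W(1) [measurable] g(1) [measurable]
  have w2: "L2 ?D (\<lambda>x. w x - c)" and Dw2: "L2 ?D Dw"
    using w Dw by (auto simp: W12_0_def W12_def L2_space_iff weak_gradient_iff[OF \<Omega>])
  have "L2 ?D (\<lambda>x. (w x - c) + c)"
    by (intro L2_add w2 D.L2_bounded[where C = "\<bar>c\<bar>"]) auto
  then have "L2 ?D w"
    by simp
  from weak_gradient_add_const[OF \<Omega> this Dw, of "- c"]
  have wg: "is_weak_gradient \<Omega> (\<lambda>x. w x - c) Dw"
    by simp
  have ae: "AE x in ?D. w x - c = W x - c"
    using W(2) by eventually_elim simp
  have Wc: "(\<lambda>x. W x - c) \<in> borel_measurable ?D"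
    by measurable
  obtain \<phi> where \<phi>: "\<And>k. \<phi> k \<in> test_functions \<Omega>" "L2_lim ?D \<phi> (\<lambda>x. w x - c)" "L2_lim ?D (\<lambda>k. grad (\<phi> k)) Dw"
    using W12_0_approximation[OF \<Omega> w wg] by metis
  then show "\<exists>\<phi>. (\<forall>k. \<phi> k \<in> test_functions \<Omega>) \<and> L2_lim ?D \<phi> (\<lambda>x. W x - c) \<and> L2_lim ?D (\<lambda>k. grad (\<phi> k)) g"
    using L2_lim_cong_limit_AE[OF \<phi>(2) Wc ae] L2_lim_cong_limit_AE[OF \<phi>(3) g] by blast
  show "L2 ?D (\<lambda>x. W x - c)"
    by (rule L2_cong_AE[OF w2 Wc ae])
  show "L2 ?D g"
    by (rule L2_cong_AE[OF Dw2 g])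
  have [measurable]: "(\<lambda>x. w x - c) \<in> borel_measurable ?D" "Dw \<in> borel_measurable ?D"
    using w2 Dw2 by (auto simp: L2_def)
  have "(LINT x|?D. (w x - c)\<^sup>2) = (LINT x|?D. (W x - c)\<^sup>2)"
  proof (rule integral_cong_AE)
    show "AE x in ?D. (w x - c)\<^sup>2 = (W x - c)\<^sup>2"
      using ae by eventually_elim simp
  qed measurable
  moreover have "(LINT x|?D. (norm (Dw x))\<^sup>2) = (LINT x|?D. (norm (g x))\<^sup>2)"
  proof (rule integral_cong_AE)
    show "AE x in ?D. (norm (Dw x))\<^sup>2 = (norm (g x))\<^sup>2"
      using g(2) by eventually_elim simp
  qed measurable
  moreover have "0 \<le> (LINT x|?D. (w x - c)\<^sup>2) + (LINT x|?D. (norm (Dw x))\<^sup>2)"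
    by (intro add_nonneg_nonneg Bochner_Integration.integral_nonneg) auto
  ultimately show "(W12_norm \<Omega> (\<lambda>x. w x - c))\<^sup>2 = (LINT x|?D. (W x - c)\<^sup>2) + (LINT x|?D. (norm (g x))\<^sup>2)"
    unfolding W12_norm_eq[OF \<Omega> wg] by simp
qed

text \<open>
  A solution together with Borel representatives. The weak equation is kept only in its tensor product form.
\<close>

locale represented_solution = cylinder_data \<Omega> T B c U G
  for \<Omega> :: "'a::euclidean_space set" and T B c :: real
    and U :: "real \<times> 'a \<Rightarrow> real" and G :: "real \<times> 'a \<Rightarrow> 'a" +
  fixes u :: "real \<Rightarrow> 'a \<Rightarrow> real" and Du :: "real \<Rightarrow> 'a \<Rightarrow> 'a"
  assumes u_meas: "(\<lambda>z. u (fst z) (snd z)) \<in> borel_measurable (lebesgue_on (cyl T \<Omega>))"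
    and Du_meas: "(\<lambda>z. Du (fst z) (snd z)) \<in> borel_measurable (lebesgue_on (cyl T \<Omega>))"
    and U_ae: "AE z in lborel. z \<in> cyl T \<Omega> \<longrightarrow> u (fst z) (snd z) = U z"
    and G_ae: "AE z in lborel. z \<in> cyl T \<Omega> \<longrightarrow> Du (fst z) (snd z) = G z"
    and u_L2: "(\<lambda>t x. u t x - c) \<in> L2_time T (W12_0 \<Omega>) (W12_norm \<Omega>)"
    and u_C: "(\<lambda>t x. u t x - c) \<in> C_time_L1 T \<Omega>"
    and u_0: "AE x in lebesgue_on \<Omega>. u 0 x = 1"
    and gradient: "AE t in lebesgue_on {0<..<T}. is_weak_gradient \<Omega> (u t) (Du t)"
    and tensor_identity: "\<And>\<theta> \<eta>. \<theta> \<in> test_functions {0<..<T} \<Longrightarrow> \<eta> \<in> test_functions \<Omega> \<Longrightarrow>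
      integral\<^sup>L (lebesgue_on (cyl T \<Omega>)) (\<lambda>z. u (fst z) (snd z) * (grad \<theta> (fst z) * \<eta> (snd z)))
      = integral\<^sup>L (lebesgue_on (cyl T \<Omega>)) (\<lambda>z. Du (fst z) (snd z) \<bullet> (\<theta> (fst z) *\<^sub>R grad \<eta> (snd z)))
      + integral\<^sup>L (lebesgue_on (cyl T \<Omega>))
        (\<lambda>z. B * ((norm (Du (fst z) (snd z)))\<^sup>2 / u (fst z) (snd z)) * (\<theta> (fst z) * \<eta> (snd z)))"
begin

abbreviation "D \<equiv> lebesgue_on \<Omega>"

text \<open>
  Times at which the slices of the solution are related to those of the representatives.
\<close>

definition good :: "real \<Rightarrow> bool" where
  "good t \<longleftrightarrow> (\<lambda>x. u t x - c) \<in> W12_0 \<Omega> \<and> is_weak_gradient \<Omega> (u t) (Du t) \<and>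
     (AE x in D. u t x = U (t, x)) \<and> (AE x in D. Du t x = G (t, x))"

lemma slice_measurable [measurable]:
  "(\<lambda>x. U (t, x)) \<in> borel_measurable D" "(\<lambda>x. G (t, x)) \<in> borel_measurable D"
  by (rule measurable_lebesgue_on, measurable)+

lemma AE_good: "AE t in lborel. 0 < t \<and> t < T \<longrightarrow> good t"
proof -
  have "AE z in lborel \<Otimes>\<^sub>M lborel. z \<in> Q \<longrightarrow> u (fst z) (snd z) = U z \<and> Du (fst z) (snd z) = G z"
    unfolding lborel_prod using U_ae G_ae by eventually_elim auto
  from lborel_pair.AE_pair[OF this]
  have "AE t in lborel. AE x in lborel. (t, x) \<in> Q \<longrightarrow> u t x = U (t, x) \<and> Du t x = G (t, x)"
    by simp
  moreover have "AE t in lborel. t \<in> {0<..<T} \<longrightarrow> (\<lambda>x. u t x - c) \<in> W12_0 \<Omega>"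
    "AE t in lborel. t \<in> {0<..<T} \<longrightarrow> is_weak_gradient \<Omega> (u t) (Du t)"
    using u_L2 gradient by (auto simp: L2_time_def AE_lebesgue_on_iff)
  ultimately show ?thesis
  proof eventually_elim
    case (elim t)
    show ?case
    proof
      assume t: "0 < t \<and> t < T"
      have "AE x in lborel. x \<in> \<Omega> \<longrightarrow> u t x = U (t, x)" "AE x in lborel. x \<in> \<Omega> \<longrightarrow> Du t x = G (t, x)"
        using elim(1) t by (auto simp: mem_Q elim!: eventually_mono)
      then show "good t"
        using elim(2,3) t by (simp add: good_def AE_lebesgue_on_iff)
    qed
  qed
qed

lemma good_slice:
  assumes "good t"
  shows "\<exists>\<phi>. (\<forall>k. \<phi> k \<in> test_functions \<Omega>) \<and> L2_lim D \<phi> (\<lambda>x. U (t, x) - c) \<and>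
      L2_lim D (\<lambda>k. grad (\<phi> k)) (\<lambda>x. G (t, x))"
    "L2 D (\<lambda>x. U (t, x) - c)" "L2 D (\<lambda>x. G (t, x))"
    "(W12_norm \<Omega> (\<lambda>x. u t x - c))\<^sup>2 = (LINT x|D. (U (t, x) - c)\<^sup>2) + (LINT x|D. (norm (G (t, x)))\<^sup>2)"
proof -
  have "(\<lambda>x. u t x - c) \<in> W12_0 \<Omega>" "is_weak_gradient \<Omega> (u t) (Du t)"
    and ae: "AE x in D. u t x = U (t, x)" "AE x in D. Du t x = G (t, x)"
    using assms by (auto simp: good_def)
  note * = W12_0_borel_slice[OF \<Omega> this(1,2) slice_measurable(1) ae(1) slice_measurable(2) ae(2)]
  show "\<exists>\<phi>. (\<forall>k. \<phi> k \<in> test_functions \<Omega>) \<and> L2_lim D \<phi> (\<lambda>x. U (t, x) - c) \<and>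
      L2_lim D (\<lambda>k. grad (\<phi> k)) (\<lambda>x. G (t, x))"
    by (rule *(1))
  show "L2 D (\<lambda>x. U (t, x) - c)" "L2 D (\<lambda>x. G (t, x))"
    "(W12_norm \<Omega> (\<lambda>x. u t x - c))\<^sup>2 = (LINT x|D. (U (t, x) - c)\<^sup>2) + (LINT x|D. (norm (G (t, x)))\<^sup>2)"
    by (fact *(2), fact *(3), fact *(4))
qed

lemma W12_norm_integrable: "integrable (lebesgue_on {0<..<T}) (\<lambda>t. (W12_norm \<Omega> (\<lambda>x. u t x - c))\<^sup>2)"
  using u_L2 by (simp add: L2_time_def)

lemma gradient_L2: "L2 lborel G"
  unfolding L2_def
proof
  show "integrable lborel (\<lambda>z. (norm (G z))\<^sup>2)"
  proof (rule integrable_by_slices[OF \<Omega>_borel _ _ _ W12_norm_integrable])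
    show "AE t in lborel. 0 < t \<and> t < T \<longrightarrow> integrable D (\<lambda>x. (norm (G (t, x)))\<^sup>2) \<and>
        (LINT x|D. (norm (G (t, x)))\<^sup>2) \<le> (W12_norm \<Omega> (\<lambda>x. u t x - c))\<^sup>2"
      using AE_good
    proof eventually_elim
      case (elim t)
      then show ?case
        using good_slice(3,4)[of t] by (auto simp: L2_def)
    qed
  qed (auto simp: G_off)
qed simp

text \<open>
  On the bounded cylinder it suffices that \<open>U - c\<close> is square integrable.
\<close>

lemma solution_integrable: "integrable lborel (\<lambda>z. indicator Q z * U z)"
proof -
  have "integrable lborel (\<lambda>z. indicator Q z * (U z - c)\<^sup>2)"
  proof (rule integrable_by_slices[OF \<Omega>_borel _ _ _ W12_norm_integrable])
    show "AE t in lborel. 0 < t \<and> t < T \<longrightarrow> integrable D (\<lambda>x. indicator Q (t, x) * (U (t, x) - c)\<^sup>2) \<and>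
        (LINT x|D. indicator Q (t, x) * (U (t, x) - c)\<^sup>2) \<le> (W12_norm \<Omega> (\<lambda>x. u t x - c))\<^sup>2"
      using AE_good
    proof eventually_elim
      case (elim t)
      show ?case
      proof
        assume t: "0 < t \<and> t < T"
        have "integrable D (\<lambda>x. indicator Q (t, x) * (U (t, x) - c)\<^sup>2) \<longleftrightarrow> integrable D (\<lambda>x. (U (t, x) - c)\<^sup>2)"
          "(LINT x|D. indicator Q (t, x) * (U (t, x) - c)\<^sup>2) = (LINT x|D. (U (t, x) - c)\<^sup>2)"
          using t by (intro Bochner_Integration.integrable_cong Bochner_Integration.integral_cong; simp add: mem_Q)+
        then show "integrable D (\<lambda>x. indicator Q (t, x) * (U (t, x) - c)\<^sup>2) \<and>
          (LINT x|D. indicator Q (t, x) * (U (t, x) - c)\<^sup>2) \<le> (W12_norm \<Omega> (\<lambda>x. u t x - c))\<^sup>2"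
          using elim t good_slice(2,4)[of t] by (simp add: L2_def)
      qed
    qed
  qed auto
  then have *: "integrable lborel (\<lambda>z. indicator Q z * (U z - c)\<^sup>2 + (c + 1) * indicator Q z)"
    using Q_finite by (intro Bochner_Integration.integrable_add integrable_mult_right integrable_real_indicator) auto
  show ?thesis
  proof (rule Bochner_Integration.integrable_bound[OF *])
    have "U z \<le> (U z - c)\<^sup>2 + (c + 1)" for z
      using sum_squares_bound[of "U z - c" 1] U_ge[of z] by (simp add: power2_eq_square)
    then have "\<bar>U z\<bar> \<le> \<bar>(U z - c)\<^sup>2 + (c + 1)\<bar>" for z
      using U_ge[of z] c by (smt (verit))
    then show "AE z in lborel. norm (indicator Q z * U z) \<le> norm (indicator Q z * (U z - c)\<^sup>2 + (c + 1) * indicator Q z)"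
      by (intro AE_I2) (auto simp: indicator_def)
  qed measurable
qed

sublocale energy_class \<Omega> T B c U G
  by unfold_locales (rule gradient_L2 solution_integrable)+

lemma u_integrable: "t \<in> {0..T} \<Longrightarrow> integrable D (u t)"
proof -
  interpret finite_measure D
    by (rule finite_measure_lebesgue_on[OF \<Omega>])
  assume "t \<in> {0..T}"
  then have "integrable D (\<lambda>x. (u t x - c) + c)"
    using u_C by (intro Bochner_Integration.integrable_add) (auto simp: C_time_L1_def)
  then show ?thesis by simp
qed

context
  fixes \<eta> assumes \<eta>: "\<eta> \<in> test_functions \<Omega>"
begin

text \<open>
  \<open>moment\<close> is defined with the solution itself, which makes it continuous at every time, and \<open>flux\<close> with the representatives,
  which makes Fubini's theorem available. The integral of \<open>flux\<close> over a slice is minus the time derivative of \<open>moment\<close>.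
\<close>

definition moment :: "real \<Rightarrow> real" where
  "moment t = (LINT x|D. u t x * \<eta> x)"

definition flux :: "real \<times> 'a \<Rightarrow> real" where
  "flux z = G z \<bullet> grad \<eta> (snd z) + absorb z * \<eta> (snd z)"

lemma \<eta>_measurable [measurable]:
  "\<eta> \<in> borel_measurable borel" "grad \<eta> \<in> borel_measurable borel" "\<eta> \<in> borel_measurable D"
  using test_functions_smooth[OF \<eta>]
  by (auto intro: borel_measurable_smooth borel_measurable_grad measurable_lebesgue_on)

lemma times_\<eta>_integrable: "integrable D f \<Longrightarrow> integrable D (\<lambda>x. f x * \<eta> x)"
  using test_functions_bounded[OF \<eta>] by (metis integrable_mult_bounded \<eta>_measurable(3))

lemma G_grad_integrable: "integrable lborel (\<lambda>z. G z \<bullet> grad \<eta> (snd z))"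
proof -
  obtain C where C: "C > 0" "\<And>x. norm (grad \<eta> x) \<le> C"
    using test_functions_bounded[OF \<eta>] by metis
  show ?thesis
  proof (rule Bochner_Integration.integrable_bound)
    show "integrable lborel (\<lambda>z. norm (G z) * C)"
      using G_integrable by simp
    have "\<bar>G z \<bullet> grad \<eta> (snd z)\<bar> \<le> norm (G z) * C" for z
      using order_trans[OF Cauchy_Schwarz_ineq2 mult_left_mono[OF C(2) norm_ge_zero]] .
    then show "AE z in lborel. norm (G z \<bullet> grad \<eta> (snd z)) \<le> norm (norm (G z) * C)"
      by (intro AE_I2) (auto intro: order_trans[OF _ abs_ge_self])
  qed measurable
qed

lemma absorb_\<eta>_integrable: "integrable lborel (\<lambda>z. absorb z * \<eta> (snd z))"
proof -
  obtain C where "\<And>x. \<bar>\<eta> x\<bar> \<le> C"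
    using test_functions_bounded[OF \<eta>] by metis
  then show ?thesis
    by (intro integrable_mult_bounded[OF absorb_integrable, of _ C]) auto
qed

lemma flux_density_integrable: "integrable lborel flux"
  unfolding flux_def[abs_def]
  by (rule Bochner_Integration.integrable_add[OF G_grad_integrable absorb_\<eta>_integrable])

lemma moment_continuous: "continuous_on {0..T} moment"
  unfolding continuous_on_def
proof
  obtain C where C: "C > 0" "\<And>x. \<bar>\<eta> x\<bar> \<le> C"
    using test_functions_bounded[OF \<eta>] by metis
  fix t assume t: "t \<in> {0..T}"
  have lim: "((\<lambda>s. C * L1_norm \<Omega> (\<lambda>x. (u s x - c) - (u t x - c))) \<longlongrightarrow> 0) (at t within {0..T})"
    using u_C t by (intro tendsto_mult_right_zero) (auto simp: C_time_L1_def)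
  have "eventually (\<lambda>s. norm (moment s - moment t) \<le> C * L1_norm \<Omega> (\<lambda>x. (u s x - c) - (u t x - c))) (at t within {0..T})"
    unfolding eventually_at_filter
  proof (intro always_eventually allI impI)
    fix s assume s: "s \<in> {0..T}"
    have d: "integrable D (\<lambda>x. u s x - u t x)"
      using u_integrable s t by simp
    have "moment s - moment t = (LINT x|D. (u s x - u t x) * \<eta> x)"
      using times_\<eta>_integrable u_integrable s t by (simp add: moment_def left_diff_distrib)
    then have "norm (moment s - moment t) \<le> (LINT x|D. norm ((u s x - u t x) * \<eta> x))"
      by (simp only: integral_norm_bound)
    also have "\<dots> \<le> (LINT x|D. \<bar>u s x - u t x\<bar> * C)"
    proof (rule integral_mono)
      show "integrable D (\<lambda>x. norm ((u s x - u t x) * \<eta> x))"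
        by (intro integrable_norm times_\<eta>_integrable d)
      show "integrable D (\<lambda>x. \<bar>u s x - u t x\<bar> * C)"
        using d by simp
      show "norm ((u s x - u t x) * \<eta> x) \<le> \<bar>u s x - u t x\<bar> * C" for x
        unfolding real_norm_def abs_mult using C by (intro mult_left_mono) auto
    qed
    also have "\<dots> = C * L1_norm \<Omega> (\<lambda>x. (u s x - c) - (u t x - c))"
      by (simp add: L1_norm_def mult.commute)
    finally show "norm (moment s - moment t) \<le> C * L1_norm \<Omega> (\<lambda>x. (u s x - c) - (u t x - c))" .
  qed
  then have "((\<lambda>s. moment s - moment t) \<longlongrightarrow> 0) (at t within {0..T})"
    by (rule Lim_null_comparison[OF _ lim])
  then show "(moment \<longlongrightarrow> moment t) (at t within {0..T})"
    by (simp add: LIM_zero_iff)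
qed

lemma moment_eq_representative:
  assumes "good t" "0 < t" "t < T"
  shows "moment t = (LBINT x. indicator Q (t, x) * U (t, x) * \<eta> x)"
proof -
  have ae: "AE x in D. u t x = U (t, x)"
    using assms by (simp add: good_def)
  have "moment t = (LINT x|D. U (t, x) * \<eta> x)"
    unfolding moment_def
  proof (rule integral_cong_AE)
    show "(\<lambda>x. u t x * \<eta> x) \<in> borel_measurable D"
      using times_\<eta>_integrable[OF u_integrable[of t]] assms by auto
    show "AE x in D. u t x * \<eta> x = U (t, x) * \<eta> x"
      using ae by eventually_elim simp
  qed measurable
  also have "\<dots> = (LBINT x. indicator \<Omega> x *\<^sub>R (U (t, x) * \<eta> x))"
    by (rule integral_lebesgue_on_borel(1)[OF \<Omega>_borel]) measurable
  also have "\<dots> = (LBINT x. indicator Q (t, x) * U (t, x) * \<eta> x)"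
    using assms by (intro Bochner_Integration.integral_cong) (auto simp: indicator_def mem_Q)
  finally show ?thesis .
qed

lemma weak_moment_derivative:
  assumes \<theta>: "\<theta> \<in> test_functions {0<..<T}"
  shows "(LBINT t. grad \<theta> t * moment t) = (LBINT t. \<theta> t * (LBINT x. flux (t, x)))"
proof -
  have sm: "smooth \<theta>"
    using \<theta> by (rule test_functions_smooth)
  obtain C where C: "C > 0" "\<And>x. \<bar>\<eta> x\<bar> \<le> C"
    using test_functions_bounded[OF \<eta>] by metis
  obtain C' where C': "C' > 0" "\<And>t. \<bar>\<theta> t\<bar> \<le> C'" "\<And>t. norm (grad \<theta> t) \<le> C'"
    using test_functions_bounded[OF \<theta>] by metis
  obtain K where K: "K \<subseteq> {0<..<T}" "\<And>t. t \<notin> K \<Longrightarrow> grad \<theta> t = 0"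
    using test_functionsE[OF \<theta>] by metis
  have [measurable]: "\<theta> \<in> borel_measurable borel" "grad \<theta> \<in> borel_measurable borel"
    using sm by (auto intro: borel_measurable_smooth borel_measurable_grad)
  have [measurable]: "(\<lambda>z. grad \<theta> (fst z) * \<eta> (snd z)) \<in> borel_measurable (lebesgue_on Q)"
    "(\<lambda>z. \<theta> (fst z) *\<^sub>R grad \<eta> (snd z)) \<in> borel_measurable (lebesgue_on Q)"
    "(\<lambda>z. \<theta> (fst z) * \<eta> (snd z)) \<in> borel_measurable (lebesgue_on Q)"
    by (rule measurable_lebesgue_on, measurable)+
  note u_meas [measurable] Du_meas [measurable]
  let ?f = "\<lambda>z. indicator Q z * U z * (grad \<theta> (fst z) * \<eta> (snd z))"
  have "integral\<^sup>L (lebesgue_on Q) (\<lambda>z. u (fst z) (snd z) * (grad \<theta> (fst z) * \<eta> (snd z)))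
      = (LBINT z. indicator Q z *\<^sub>R (U z * (grad \<theta> (fst z) * \<eta> (snd z))))"
  proof (rule integral_lebesgue_on_AE_eq(1)[OF Q_borel])
    show "AE z in lborel. z \<in> Q \<longrightarrow> u (fst z) (snd z) * (grad \<theta> (fst z) * \<eta> (snd z)) = U z * (grad \<theta> (fst z) * \<eta> (snd z))"
      using U_ae by eventually_elim auto
  qed measurable
  also have "\<dots> = (LBINT z. ?f z)"
    by (simp add: mult.assoc)
  also have "\<dots> = (LBINT t. grad \<theta> t * moment t)"
  proof -
    have "integrable lborel ?f"
    proof (rule integrable_mult_bounded[OF U_int])
      show "\<bar>grad \<theta> (fst z) * \<eta> (snd z)\<bar> \<le> C' * C" for z :: "real \<times> 'a"
        unfolding abs_mult using C C' by (intro mult_mono) auto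
    qed measurable
    then have fp: "integrable (lborel \<Otimes>\<^sub>M lborel) (\<lambda>(t, x). ?f (t, x))"
      unfolding lborel_prod by (simp add: case_prod_unfold)
    have "(LBINT z. ?f z) = (LBINT t. LBINT x. ?f (t, x))"
      using lborel_pair.integral_fst[OF fp] unfolding lborel_prod by (simp add: case_prod_unfold)
    also have "\<dots> = (LBINT t. grad \<theta> t * moment t)"
    proof (rule integral_cong_AE)
      show "(\<lambda>t. LBINT x. ?f (t, x)) \<in> borel_measurable lborel"
        using lborel_pair.integrable_fst[OF fp] by auto
      have "(\<lambda>t. indicator {0..T} t *\<^sub>R (grad \<theta> t * moment t)) \<in> borel_measurable borel"
        by (intro borel_measurable_continuous_on_indicator continuous_intros moment_continuous
            continuous_on_subset[OF continuous_grad[OF sm]]) auto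
      also have "(\<lambda>t. indicator {0..T} t *\<^sub>R (grad \<theta> t * moment t)) = (\<lambda>t. grad \<theta> t * moment t)"
      proof
        fix t
        show "indicator {0..T} t *\<^sub>R (grad \<theta> t * moment t) = grad \<theta> t * moment t"
          using K(1) K(2)[of t] by (cases "t \<in> K") (auto simp: indicator_def subset_iff)
      qed
      finally show "(\<lambda>t. grad \<theta> t * moment t) \<in> borel_measurable lborel"
        by simp
      show "AE t in lborel. (LBINT x. ?f (t, x)) = grad \<theta> t * moment t"
        using AE_good
      proof eventually_elim
        case (elim t)
        show ?case
        proof (cases "t \<in> K")
          case True
          then have t: "0 < t" "t < T"
            using K(1) by auto
          then have "grad \<theta> t * moment t = (LBINT x. grad \<theta> t * (indicator Q (t, x) * U (t, x) * \<eta> x))"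
            using elim moment_eq_representative[of t] by (simp only: integral_mult_right_zero)
          then show ?thesis
            by (simp add: mult_ac)
        qed (simp add: K)
      qed
    qed
    finally show ?thesis .
  qed
  finally have L: "integral\<^sup>L (lebesgue_on Q) (\<lambda>z. u (fst z) (snd z) * (grad \<theta> (fst z) * \<eta> (snd z)))
      = (LBINT t. grad \<theta> t * moment t)" .
  have "integral\<^sup>L (lebesgue_on Q) (\<lambda>z. Du (fst z) (snd z) \<bullet> (\<theta> (fst z) *\<^sub>R grad \<eta> (snd z)))
      = (LBINT z. indicator Q z *\<^sub>R (G z \<bullet> (\<theta> (fst z) *\<^sub>R grad \<eta> (snd z))))"
  proof (rule integral_lebesgue_on_AE_eq(1)[OF Q_borel])
    show "AE z in lborel. z \<in> Q \<longrightarrow> Du (fst z) (snd z) \<bullet> (\<theta> (fst z) *\<^sub>R grad \<eta> (snd z)) = G z \<bullet> (\<theta> (fst z) *\<^sub>R grad \<eta> (snd z))"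
      using G_ae by eventually_elim auto
  qed measurable
  also have "\<dots> = (LBINT z. (G z \<bullet> grad \<eta> (snd z)) * \<theta> (fst z))"
    using G_off by (intro Bochner_Integration.integral_cong) (auto simp: indicator_def)
  finally have R1: "integral\<^sup>L (lebesgue_on Q) (\<lambda>z. Du (fst z) (snd z) \<bullet> (\<theta> (fst z) *\<^sub>R grad \<eta> (snd z)))
      = (LBINT z. (G z \<bullet> grad \<eta> (snd z)) * \<theta> (fst z))" .
  have "integral\<^sup>L (lebesgue_on Q) (\<lambda>z. B * ((norm (Du (fst z) (snd z)))\<^sup>2 / u (fst z) (snd z)) * (\<theta> (fst z) * \<eta> (snd z)))
      = (LBINT z. indicator Q z *\<^sub>R (absorb z * (\<theta> (fst z) * \<eta> (snd z))))"
  proof (rule integral_lebesgue_on_AE_eq(1)[OF Q_borel])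
    show "AE z in lborel. z \<in> Q \<longrightarrow> B * ((norm (Du (fst z) (snd z)))\<^sup>2 / u (fst z) (snd z)) * (\<theta> (fst z) * \<eta> (snd z))
        = absorb z * (\<theta> (fst z) * \<eta> (snd z))"
      using G_ae U_ae by eventually_elim (auto simp: absorb_def)
  qed measurable
  also have "\<dots> = (LBINT z. (absorb z * \<eta> (snd z)) * \<theta> (fst z))"
    using absorb_off by (intro Bochner_Integration.integral_cong) (auto simp: indicator_def)
  finally have R2: "integral\<^sup>L (lebesgue_on Q) (\<lambda>z. B * ((norm (Du (fst z) (snd z)))\<^sup>2 / u (fst z) (snd z)) * (\<theta> (fst z) * \<eta> (snd z)))
      = (LBINT z. (absorb z * \<eta> (snd z)) * \<theta> (fst z))" .
  have \<theta>_mult: "integrable lborel (\<lambda>z. f z * \<theta> (fst z))" if "integrable lborel f" for f :: "real \<times> 'a \<Rightarrow> real"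
    using C' by (intro integrable_mult_bounded[OF that, of _ C']) auto
  have "(LBINT z. (G z \<bullet> grad \<eta> (snd z)) * \<theta> (fst z)) + (LBINT z. (absorb z * \<eta> (snd z)) * \<theta> (fst z))
      = (LBINT z. flux z * \<theta> (fst z))"
    using \<theta>_mult[OF G_grad_integrable] \<theta>_mult[OF absorb_\<eta>_integrable] by (simp add: flux_def distrib_right)
  also have "\<dots> = (LBINT t. \<theta> t * (LBINT x. flux (t, x)))"
  proof -
    have p: "integrable (lborel \<Otimes>\<^sub>M lborel) (\<lambda>(t, x). flux (t, x) * \<theta> t)"
      unfolding lborel_prod using \<theta>_mult[OF flux_density_integrable] by (simp add: case_prod_unfold)
    have "(LBINT z. flux z * \<theta> (fst z)) = (LBINT t. LBINT x. flux (t, x) * \<theta> t)"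
      using lborel_pair.integral_fst[OF p] unfolding lborel_prod by (simp add: case_prod_unfold)
    then show ?thesis
      by (simp only: integral_mult_left_zero mult.commute[of "\<theta> _"])
  qed
  finally show ?thesis
    using tensor_identity[OF \<theta> \<eta>] L R1 R2 by simp
qed

lemma moment_increment:
  assumes "0 \<le> a" "a < b" "b \<le> T"
  shows "moment b - moment a = - (LBINT t. indicator {a<..<b} t * (LBINT x. flux (t, x)))"
proof (rule weak_derivative_increment[OF T moment_continuous _ weak_moment_derivative assms])
  have "integrable (lborel \<Otimes>\<^sub>M lborel) (\<lambda>(t, x). flux (t, x))"
    unfolding lborel_prod using flux_density_integrable by (simp add: case_prod_unfold)
  from lborel_pair.integrable_fst[OF this] show "integrable lborel (\<lambda>t. LBINT x. flux (t, x))" .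
qed

lemma reversed_flux:
  assumes "h > 0" "0 < t" "t < T"
  shows "(LBINT y. indicator {0<..<h} (fst y) * flux (t - fst y, snd y))
    = (LBINT \<tau>. indicator {max 0 (t - h)<..<t} \<tau> * (LBINT x. flux (\<tau>, x)))"
proof -
  let ?L = "\<lambda>y::real \<times> 'a. indicator {0<..<h} (fst y) * flux (t - fst y, snd y)"
  let ?H = "\<lambda>\<tau>. LBINT x. flux (\<tau>, x)"
  have "integrable lborel (\<lambda>y. flux (t - fst y, snd y) * indicator {0<..<h} (fst y))"
    by (rule integrable_mult_bounded[OF reflected_integrable[OF flux_density_integrable], where C = 1])
      (auto simp: indicator_def)
  then have Lp: "integrable (lborel \<Otimes>\<^sub>M lborel) (\<lambda>(\<sigma>, x). ?L (\<sigma>, x))"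
    unfolding lborel_prod by (simp add: case_prod_unfold mult.commute)
  have "(LBINT y. ?L y) = (LBINT \<sigma>. LBINT x. ?L (\<sigma>, x))"
    using lborel_pair.integral_fst[OF Lp] unfolding lborel_prod by (simp add: case_prod_unfold)
  also have "\<dots> = (LBINT \<sigma>. indicator {max 0 (t - h)<..<t} (t + -1 * \<sigma>) * ?H (t + -1 * \<sigma>))"
  proof (intro Bochner_Integration.integral_cong refl)
    fix \<sigma> :: real
    show "(LBINT x. ?L (\<sigma>, x)) = indicator {max 0 (t - h)<..<t} (t + -1 * \<sigma>) * ?H (t + -1 * \<sigma>)"
    proof (cases "t - \<sigma> > 0")
      case True
      then show ?thesis
        by (auto simp: indicator_def)
    next
      case False
      then have "flux (t - \<sigma>, x) = 0" for x
        by (simp add: flux_def G_off absorb_off mem_Q)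
      then show ?thesis
        by simp
    qed
  qed
  also have "\<dots> = (LBINT \<tau>. indicator {max 0 (t - h)<..<t} \<tau> * ?H \<tau>)"
    using lborel_integral_real_affine[of "-1" "\<lambda>\<tau>. indicator {max 0 (t - h)<..<t} \<tau> * ?H \<tau>" t] by simp
  finally show ?thesis .
qed

end

text \<open>
  For \<open>t \<le> h\<close> the earlier slice is the initial one, where \<open>u = 1\<close> agrees with \<open>U\<close> off the cylinder.
\<close>

lemma slice_increment:
  assumes h: "h > 0" and t: "0 < t" "t < T" "good t" "0 < t - h \<longrightarrow> good (t - h)"
  shows "integrable D (\<lambda>x. U (t, x) - U (t - h, x))"
    and "\<eta> \<in> test_functions \<Omega> \<Longrightarrow> (LINT x|D. (U (t, x) - U (t - h, x)) * \<eta> x)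
      + (LBINT y. indicator {0<..<h} (fst y) * (G (t - fst y, snd y) \<bullet> grad \<eta> (snd y)
            + absorb (t - fst y, snd y) * \<eta> (snd y))) = 0"
proof -
  define s where "s = max 0 (t - h)"
  have s: "0 \<le> s" "s < t" "t \<le> T" "s \<in> {0..T}" "t \<in> {0..T}"
    using t h by (auto simp: s_def)
  have ae_t: "AE x in D. u t x = U (t, x)"
    using t by (simp add: good_def)
  have ae_s: "AE x in D. u s x = U (t - h, x)"
  proof (cases "t - h > 0")
    case True
    then show ?thesis
      using t by (simp add: good_def s_def)
  next
    case False
    then have "U (t - h, x) = 1" for x
      by (intro U_off) (auto simp: mem_Q)
    then show ?thesis
      using u_0 False by (simp add: s_def)
  qed
  note ut = u_integrable[OF s(5)] and us = u_integrable[OF s(4)]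
  have [measurable]: "u t \<in> borel_measurable D" "u s \<in> borel_measurable D"
    using ut us by auto
  have ae: "AE x in D. u t x - u s x = U (t, x) - U (t - h, x)"
    using ae_t ae_s by eventually_elim simp
  show "integrable D (\<lambda>x. U (t, x) - U (t - h, x))"
    by (rule integrable_cong_AE_imp[OF Bochner_Integration.integrable_diff[OF ut us]])
      (use ae in \<open>auto elim!: eventually_mono\<close>)
  assume \<eta>: "\<eta> \<in> test_functions \<Omega>"
  note [measurable] = \<eta>_measurable[OF \<eta>]
  have "(LINT x|D. (U (t, x) - U (t - h, x)) * \<eta> x) = (LINT x|D. (u t x - u s x) * \<eta> x)"
  proof (rule integral_cong_AE)
    show "AE x in D. (U (t, x) - U (t - h, x)) * \<eta> x = (u t x - u s x) * \<eta> x"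
      using ae by eventually_elim simp
  qed measurable
  also have "\<dots> = moment \<eta> t - moment \<eta> s"
    using times_\<eta>_integrable[OF \<eta> ut] times_\<eta>_integrable[OF \<eta> us]
    by (simp add: left_diff_distrib moment_def[OF \<eta>])
  finally show "(LINT x|D. (U (t, x) - U (t - h, x)) * \<eta> x)
      + (LBINT y. indicator {0<..<h} (fst y) * (G (t - fst y, snd y) \<bullet> grad \<eta> (snd y)
            + absorb (t - fst y, snd y) * \<eta> (snd y))) = 0"
    using moment_increment[OF \<eta> s(1,2,3)] reversed_flux[OF \<eta> h t(1,2)]
    by (simp add: s_def flux_def[OF \<eta>])
qed

sublocale weak_data \<Omega> T B c U G
proof
  show "AE t in lborel. 0 < t \<and> t < T \<longrightarrow> (\<exists>\<phi>. (\<forall>k. \<phi> k \<in> test_functions \<Omega>) \<and>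
      L2_lim D \<phi> (\<lambda>x. U (t, x) - c) \<and> L2_lim D (\<lambda>k. grad (\<phi> k)) (\<lambda>x. G (t, x)))"
    using AE_good by eventually_elim (use good_slice(1) in blast)
  fix h :: real assume h: "h > 0"
  show "AE t in lborel. 0 < t \<and> t < T \<longrightarrow>
      integrable D (\<lambda>x. U (t, x) - U (t - h, x)) \<and> (\<forall>\<eta>\<in>test_functions \<Omega>.
      (LINT x|D. (U (t, x) - U (t - h, x)) * \<eta> x)
      + (LBINT y. indicator {0<..<h} (fst y) * (G (t - fst y, snd y) \<bullet> grad \<eta> (snd y)
            + absorb (t - fst y, snd y) * \<eta> (snd y))) = 0)"
    using AE_good AE_translate[OF AE_good, of h]
  proof eventually_elim
    case (elim t)
    then show ?case
      using slice_increment[OF h, of t] h by auto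
  qed
qed

end

text \<open>
  The maximum with \<open>c\<close> turns the almost everywhere lower bound into one at every point, which spares all later divisions an
  exceptional set.
\<close>

theorem solution_weak_data:
  fixes \<Omega> :: "'a::euclidean_space set"
  assumes \<Omega>: "open \<Omega>" "bounded \<Omega>" and T: "T > 0" and B: "B \<ge> 1" and c: "0 < c" "c \<le> 1"
    and sol: "is_solution T \<Omega> B c u"
  obtains U G where "weak_data \<Omega> T B c U G" "AE z in lborel. z \<in> cyl T \<Omega> \<longrightarrow> u (fst z) (snd z) = U z"
proof -
  let ?Q = "cyl T \<Omega>"
  have Q [measurable]: "?Q \<in> sets borel"
    using \<Omega> by (simp add: cyl_def open_Times borel_open)
  note s1 = sol[unfolded is_solution_def]
  note s2 = conjunct2[OF s1] note s3 = conjunct2[OF s2] note s4 = conjunct2[OF s3]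
  have u_meas: "(\<lambda>z. u (fst z) (snd z)) \<in> borel_measurable (lebesgue_on ?Q)"
    using conjunct1[OF s1] by (simp only: case_prod_unfold)
  have u_ge: "AE z in lborel. z \<in> ?Q \<longrightarrow> u (fst z) (snd z) \<ge> c"
    using conjunct1[OF s2] by (simp only: case_prod_unfold AE_lebesgue_on_iff[OF Q])
  obtain Du f F where sg: "is_space_gradient T \<Omega> u Du" and td: "is_time_derivative T \<Omega> u f F"
    and eq: "\<forall>v Dv. v \<in> L2_time T (W12_0 \<Omega>) (W12_norm \<Omega>) \<inter> Linfty_cyl T \<Omega> \<longrightarrow>
           is_space_gradient T \<Omega> v Dv \<longrightarrow>
           pairing T \<Omega> f F v
             + integral\<^sup>L (lebesgue_on (cyl T \<Omega>)) (\<lambda>(t,x). Du t x \<bullet> Dv t x)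
             + integral\<^sup>L (lebesgue_on (cyl T \<Omega>))
                 (\<lambda>(t,x). B * ((norm (Du t x))\<^sup>2 / u t x) * v t x)
           = 0"
    using conjunct2[OF s4]
    apply -
    apply (erule exE)+
    apply (erule conjE)+
    apply (rule that)
    apply assumption+
    done
  have Du_meas: "(\<lambda>z. Du (fst z) (snd z)) \<in> borel_measurable (lebesgue_on ?Q)"
    using sg by (simp add: is_space_gradient_def case_prod_unfold)
  obtain U0 where U0 [measurable]: "U0 \<in> borel_measurable borel"
    and U0_ae: "AE z in lborel. z \<in> ?Q \<longrightarrow> u (fst z) (snd z) = U0 z"
    by (rule lebesgue_on_borel_representative[OF Q u_meas])
  obtain G where G: "G \<in> borel_measurable borel" "AE z in lborel. z \<in> ?Q \<longrightarrow> Du (fst z) (snd z) = G z"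
    "\<And>z. z \<notin> ?Q \<Longrightarrow> G z = 0"
    by (rule lebesgue_on_borel_representative_vec[OF Q Du_meas], rule that)
  define U where "U z = (if z \<in> ?Q then max c (U0 z) else 1)" for z
  have U: "U \<in> borel_measurable borel"
    unfolding U_def[abs_def] by measurable
  have U_ae: "AE z in lborel. z \<in> ?Q \<longrightarrow> u (fst z) (snd z) = U z"
    using U0_ae u_ge by eventually_elim (auto simp: U_def)
  interpret represented_solution \<Omega> T B c U G u Du
  proof
    show "U z \<ge> c" "z \<notin> ?Q \<Longrightarrow> U z = 1" for z
      using c by (auto simp: U_def)
    show "(\<lambda>t x. u t x - c) \<in> L2_time T (W12_0 \<Omega>) (W12_norm \<Omega>)" "(\<lambda>t x. u t x - c) \<in> C_time_L1 T \<Omega>"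
      using conjunct1[OF s3] by (rule IntD1, rule IntD2)
    show "AE x in lebesgue_on \<Omega>. u 0 x = 1"
      by (rule conjunct1[OF s4])
    show "AE t in lebesgue_on {0<..<T}. is_weak_gradient \<Omega> (u t) (Du t)"
      using sg by (simp add: is_space_gradient_def)
    fix \<theta> \<eta> assume "\<theta> \<in> test_functions {0<..<T}" "\<eta> \<in> test_functions \<Omega>"
    from solution_tensor_identity[OF \<Omega> this td eq[rule_format]]
    show "integral\<^sup>L (lebesgue_on ?Q) (\<lambda>z. u (fst z) (snd z) * (grad \<theta> (fst z) * \<eta> (snd z)))
      = integral\<^sup>L (lebesgue_on ?Q) (\<lambda>z. Du (fst z) (snd z) \<bullet> (\<theta> (fst z) *\<^sub>R grad \<eta> (snd z)))
      + integral\<^sup>L (lebesgue_on ?Q)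
        (\<lambda>z. B * ((norm (Du (fst z) (snd z)))\<^sup>2 / u (fst z) (snd z)) * (\<theta> (fst z) * \<eta> (snd z)))" .
  qed (fact \<Omega> T B c(1) U G U_ae u_meas Du_meas)+
  show ?thesis
    using weak_data_axioms U_ae by (rule that)
qed

section \<open>Decay of the solutions\<close>

text \<open>
  \<open>\<mu>\<close> is so large that the exponential at time \<open>\<tau>\<close> exceeds, at every point of the domain, its values at all times up to \<open>\<tau>/2\<close>;
  the rate \<open>\<delta>\<close> depends on \<open>\<tau>\<close> but not on \<open>n\<close>, because \<open>n\<close> enters the barrier only through the factor \<open>\<kappa>\<close>.
\<close>

lemma solution_decay:
  fixes \<Omega> :: "'a::euclidean_space set" and u :: "nat \<Rightarrow> real \<Rightarrow> 'a \<Rightarrow> real"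
  assumes \<Omega>: "open \<Omega>" "bounded \<Omega>" and T: "T > 0" and B: "B \<ge> 1" and \<tau>: "0 < \<tau>" "\<tau> < T"
    and sol: "\<And>n. n \<ge> 1 \<Longrightarrow> is_solution T \<Omega> B (1 / real n) (u n)"
  obtains \<delta> where "\<delta> > 0" "\<And>n. n \<ge> 1 \<Longrightarrow> AE z in lborel. z \<in> cyl T \<Omega> \<longrightarrow> \<tau> \<le> fst z \<longrightarrow>
      \<bar>u n (fst z) (snd z)\<bar> \<le> real n powr (- \<delta>)"
proof -
  obtain R where R: "R > 0" "\<And>x. x \<in> \<Omega> \<Longrightarrow> norm x \<le> R"
    using \<Omega>(2) by (auto simp: bounded_pos)
  obtain e :: 'a where e: "e \<in> Basis"
    using nonempty_Basis by blast
  then have e1: "norm e = 1"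
    by simp
  have xe: "\<bar>x \<bullet> e\<bar> \<le> R" if "x \<in> \<Omega>" for x
    using Cauchy_Schwarz_ineq2[of x e] R(2)[OF that] e1 by simp
  define \<mu> where "\<mu> = (4 * R + 1) / \<tau>"
  define \<tau>\<^sub>0 where "\<tau>\<^sub>0 = \<tau> / 2"
  define A where "A = exp (\<mu> * R + \<mu>\<^sup>2 * \<tau>\<^sub>0)"
  define M where "M = exp (\<mu> * R + \<mu>\<^sup>2 * T)"
  define \<delta> where "\<delta> = (exp (- (\<mu> * R) + \<mu>\<^sup>2 * \<tau>) - A) / M"
  have \<mu>: "\<mu> > 0" and M: "M > 0"
    using R \<tau> by (auto simp: \<mu>_def M_def)
  have \<delta>: "\<delta> > 0"
  proof -
    have "\<mu> * \<tau>\<^sub>0 > 2 * R"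
      using \<tau> by (simp add: \<mu>_def \<tau>\<^sub>0_def)
    then have "\<mu> * (\<mu> * \<tau>\<^sub>0) > \<mu> * (2 * R)"
      using \<mu> by (rule mult_strict_left_mono)
    then have "\<mu> * R + \<mu>\<^sup>2 * \<tau>\<^sub>0 < - (\<mu> * R) + \<mu>\<^sup>2 * \<tau>"
      by (simp add: \<tau>\<^sub>0_def power2_eq_square algebra_simps)
    then show ?thesis
      using M by (simp add: \<delta>_def A_def)
  qed
  show ?thesis
  proof (rule that[OF \<delta>])
    fix n :: nat assume n: "n \<ge> 1"
    define c where "c = 1 / real n"
    define \<kappa> where "\<kappa> = ln (real n) / M"
    have c: "0 < c" "c \<le> 1" and \<kappa>: "\<kappa> \<ge> 0"
      using n M by (auto simp: c_def \<kappa>_def)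
    have "is_solution T \<Omega> B c (u n)"
      using sol[OF n] by (simp add: c_def)
    then obtain U G where wd: "weak_data \<Omega> T B c U G"
      and U: "AE z in lborel. z \<in> cyl T \<Omega> \<longrightarrow> u n (fst z) (snd z) = U z"
      using solution_weak_data[OF \<Omega> T B c] by blast
    interpret weak_data \<Omega> T B c U G
      by (rule wd)
    have up: "heat \<mu> e z \<le> exp (\<mu> * R + \<mu>\<^sup>2 * s)" if "fst z \<le> s" "snd z \<in> \<Omega>" for z s
      using xe[OF that(2)] that(1) \<mu> by (auto simp: heat_def intro!: add_mono mult_left_mono)
    interpret barrier \<Omega> T B c U G \<kappa> \<mu> A \<tau>\<^sub>0 e
    proof
      show "c * exp (\<kappa> * (heat \<mu> e z - A)) \<le> 1" if "fst z \<le> T" "snd z \<in> \<Omega>" for z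
      proof -
        have "heat \<mu> e z - A \<le> M"
        proof -
          have "A \<ge> 0"
            by (simp add: A_def)
          moreover have "heat \<mu> e z \<le> M"
            using up[OF that] by (simp add: M_def)
          ultimately show ?thesis
            by linarith
        qed
        then have "\<kappa> * (heat \<mu> e z - A) \<le> \<kappa> * M"
          using \<kappa> by (rule mult_left_mono)
        also have "\<dots> = ln (real n)"
          using M by (simp add: \<kappa>_def)
        finally have "exp (\<kappa> * (heat \<mu> e z - A)) \<le> exp (ln (real n))"
          by simp
        then show ?thesis
          using n by (simp add: c_def)
      qed
      show "exp (\<kappa> * (heat \<mu> e z - A)) \<le> 1" if "fst z \<le> \<tau>\<^sub>0" "snd z \<in> \<Omega>" for z
        using up[OF that] \<kappa> by (simp add: A_def mult_nonneg_nonpos)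
    qed (use \<tau> \<kappa> e1 in \<open>auto simp: \<tau>\<^sub>0_def\<close>)
    show "AE z in lborel. z \<in> cyl T \<Omega> \<longrightarrow> \<tau> \<le> fst z \<longrightarrow> \<bar>u n (fst z) (snd z)\<bar> \<le> real n powr (- \<delta>)"
      using comparison U
    proof eventually_elim
      case (elim z)
      show ?case
      proof (intro impI)
        assume z: "z \<in> cyl T \<Omega>" "\<tau> \<le> fst z"
        then have x: "snd z \<in> \<Omega>"
          by (simp add: mem_Q)
        have "- R \<le> snd z \<bullet> e"
          using xe[OF x] by simp
        then have "\<mu> * (- R) + \<mu>\<^sup>2 * \<tau> \<le> \<mu> * (snd z \<bullet> e) + \<mu>\<^sup>2 * fst z"
          using z(2) \<mu> by (intro add_mono mult_left_mono) auto
        then have "\<delta> * M \<le> heat \<mu> e z - A"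
          using M by (simp add: \<delta>_def heat_def)
        then have "\<kappa> * (\<delta> * M) \<le> \<kappa> * (heat \<mu> e z - A)"
          using \<kappa> by (rule mult_left_mono)
        moreover have "\<kappa> * (\<delta> * M) = \<delta> * ln (real n)"
          using M by (simp add: \<kappa>_def)
        ultimately have "exp (\<delta> * ln (real n)) \<le> E z"
          by (simp add: E_def)
        then have "U z * exp (\<delta> * ln (real n)) \<le> U z * E z"
          using U_pos[of z] by (intro mult_left_mono) auto
        also have "\<dots> \<le> 1"
          using elim(1) z(1) by blast
        finally have "U z \<le> exp (- (\<delta> * ln (real n)))"
          by (simp add: exp_minus field_simps)
        then show "\<bar>u n (fst z) (snd z)\<bar> \<le> real n powr (- \<delta>)"
          using elim(2) z(1) U_pos[of z] n by (simp add: powr_def)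
      qed
    qed
  qed
qed

text \<open>
  The bounds hold on the sets \<open>t \<ge> T / (j + 2)\<close> outside null sets. Replacing \<open>u\<^sub>n\<close> by \<open>0\<close> where one of these countably many bounds
  fails gives representatives that satisfy them everywhere, and each compact subset of the cylinder lies in one of the sets.
\<close>

theorem proposition5p1:
  fixes \<Omega> :: "'a::euclidean_space set"
    and T B :: real
    and u :: "nat \<Rightarrow> real \<Rightarrow> 'a \<Rightarrow> real"
  assumes "DIM('a) \<ge> 2"
    and "open \<Omega>" and "bounded \<Omega>"
    and "T > 0"
    and "B \<ge> 1"
    and "\<And>n. n \<ge> 1 \<Longrightarrow> is_solution T \<Omega> B (1 / real n) (u n)"
  shows "\<exists>w :: nat \<Rightarrow> real \<times> 'a \<Rightarrow> real.
           (\<forall>n\<ge>1. AE (t,x) in lebesgue_on (cyl T \<Omega>). w n (t,x) = u n t x) \<and>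
           (\<forall>K. compact K \<and> K \<subseteq> cyl T \<Omega> \<longrightarrow> uniform_limit K w (\<lambda>_. 0) sequentially)"
proof -
  define \<tau> where "\<tau> j = T * inverse (real (Suc (Suc j)))" for j
  have \<tau>: "0 < \<tau> j" "\<tau> j < T" for j
    using assms(4) by (auto simp: \<tau>_def field_simps add_pos_nonneg)
  have "\<exists>\<delta>>0. \<forall>n\<ge>1. AE z in lborel. z \<in> cyl T \<Omega> \<longrightarrow> \<tau> j \<le> fst z \<longrightarrow>
      \<bar>u n (fst z) (snd z)\<bar> \<le> real n powr (- \<delta>)" for j
  proof (rule solution_decay[OF assms(2,3,4,5) \<tau>[of j] assms(6)])
    fix \<delta> :: real
    assume "\<delta> > 0" "\<And>n. n \<ge> 1 \<Longrightarrow> AE z in lborel. z \<in> cyl T \<Omega> \<longrightarrow> \<tau> j \<le> fst z \<longrightarrow>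
      \<bar>u n (fst z) (snd z)\<bar> \<le> real n powr (- \<delta>)"
    then show ?thesis
      by blast
  qed
  then have "\<forall>j. \<exists>\<delta>>0. \<forall>n\<ge>1. AE z in lborel. z \<in> cyl T \<Omega> \<longrightarrow> \<tau> j \<le> fst z \<longrightarrow>
      \<bar>u n (fst z) (snd z)\<bar> \<le> real n powr (- \<delta>)"
    by (rule allI)
  from choice[OF this] obtain \<delta> where "\<forall>j. \<delta> j > 0 \<and> (\<forall>n\<ge>1. AE z in lborel. z \<in> cyl T \<Omega> \<longrightarrow> \<tau> j \<le> fst z \<longrightarrow>
      \<bar>u n (fst z) (snd z)\<bar> \<le> real n powr (- \<delta> j))"
    by blast
  then have \<delta>: "\<delta> j > 0"
    "n \<ge> 1 \<Longrightarrow> AE z in lborel. z \<in> cyl T \<Omega> \<longrightarrow> \<tau> j \<le> fst z \<longrightarrow>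
      \<bar>u n (fst z) (snd z)\<bar> \<le> real n powr (- \<delta> j)" for j n
    by blast+
  define w where "w n z = (if \<forall>j. \<tau> j \<le> fst z \<longrightarrow> \<bar>u n (fst z) (snd z)\<bar> \<le> real n powr (- \<delta> j)
    then u n (fst z) (snd z) else 0)" for n z
  have w_bound: "\<bar>w n z\<bar> \<le> real n powr (- \<delta> j)" if "\<tau> j \<le> fst z" for n j z
    using that by (auto simp: w_def)
  have "AE (t, x) in lebesgue_on (cyl T \<Omega>). w n (t, x) = u n t x" if n: "n \<ge> 1" for n
  proof -
    have Q: "cyl T \<Omega> \<in> sets borel"
      using assms(2) by (simp add: cyl_def open_Times borel_open)
    have "AE z in lborel. \<forall>j. z \<in> cyl T \<Omega> \<longrightarrow> \<tau> j \<le> fst z \<longrightarrow> \<bar>u n (fst z) (snd z)\<bar> \<le> real n powr (- \<delta> j)"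
      unfolding AE_all_countable using \<delta>(2)[OF n] by blast
    then have "AE z in lborel. z \<in> cyl T \<Omega> \<longrightarrow> w n z = u n (fst z) (snd z)"
      by eventually_elim (auto simp: w_def)
    then show ?thesis
      by (simp add: AE_lebesgue_on_iff[OF Q] case_prod_unfold)
  qed
  moreover have "uniform_limit K w (\<lambda>_. 0) sequentially" if K: "compact K" "K \<subseteq> cyl T \<Omega>" for K
  proof (cases "K = {}")
    case False
    obtain z0 where z0: "z0 \<in> K" "\<And>z. z \<in> K \<Longrightarrow> fst z0 \<le> fst z"
      using continuous_attains_inf[OF K(1) False continuous_on_fst[OF continuous_on_id]] by auto
    then have "fst z0 > 0"
      using K(2) by (auto simp: cyl_def)
    moreover have "\<tau> \<longlonglongrightarrow> 0"
      unfolding \<tau>_def[abs_def] using LIMSEQ_Suc[OF LIMSEQ_inverse_real_of_nat]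
      by (rule tendsto_mult_right_zero)
    ultimately have "eventually (\<lambda>j. \<tau> j < fst z0) sequentially"
      by (rule order_tendstoD(2)[rotated])
    then obtain j where j: "\<tau> j < fst z0"
      by (auto simp: eventually_sequentially)
    have lim: "(\<lambda>n. real n powr (- \<delta> j)) \<longlonglongrightarrow> 0"
      by (rule tendsto_neg_powr[OF _ filterlim_real_sequentially]) (simp add: \<delta>)
    show ?thesis
    proof (rule uniform_limitI)
      fix \<epsilon> :: real assume "\<epsilon> > 0"
      then have "eventually (\<lambda>n. real n powr (- \<delta> j) < \<epsilon>) sequentially"
        by (rule order_tendstoD(2)[OF lim])
      then show "eventually (\<lambda>n. \<forall>z\<in>K. dist (w n z) 0 < \<epsilon>) sequentially"
      proof eventually_elim
        case (elim n)
        show ?case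
        proof
          fix z assume "z \<in> K"
          then have "\<tau> j \<le> fst z"
            using less_imp_le[OF j] order_trans[OF _ z0(2)] by blast
          from w_bound[OF this, of n] elim show "dist (w n z) 0 < \<epsilon>"
            by simp
        qed
      qed
    qed
  qed simp
  ultimately show ?thesis
    by blast
qed

end
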